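(* Let $M$ be a closed oriented manifold which is universally enlargeable. Then $M$ is essential in rational homology: the classifying map $c\colon M\to B\pi_1(M)$ of the universal covering satisfies $c_*([M])\neq 0$ in $H_*(B\pi_1(M);\mathbb{Q})$, where $[M]$ is the fundamental class of $M$.
   Context: Manifolds are connected and smooth. Universally enlargeable: a closed oriented manifold $M$ of dimension $n$, with universal covering $\widetilde M\to M$, is universally enlargeable if for every $\epsilon>0$ there is an $\epsilon$-contracting (i.e. $\epsilon$-Lipschitz) map $f_\epsilon\colon\widetilde M\to (S^n,g_{can})$ to the $n$-sphere with its canonical metric, which is constant outside a compact set and is of nonzero degree. Here $\widetilde M$ carries the pullback of an arbitrary Riemannian metric on $M$, fixed independently of $\epsilon$. *)

theory Defs
  imports "HOL-Analysis.Analysis" "HOL-Homology.Homology" "HOL-Algebra.Group_Action"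
begin

section \<open>Smooth manifolds\<close>

text \<open>
  A chart of a space with points in \<^typ>\<open>'a\<close> is a pair of an open set and a coordinate map; the
  model space is the Euclidean space \<^typ>\<open>'e\<close>, so the dimension is \<^term>\<open>DIM('e::euclidean_space)\<close>
  and in particular is positive.
\<close>

type_synonym ('a, 'e) chart = "'a set \<times> ('a \<Rightarrow> 'e)"

primrec Ck_on :: "nat \<Rightarrow> 'a::real_normed_vector set \<Rightarrow> ('a \<Rightarrow> 'b::real_normed_vector) \<Rightarrow> bool" where
  "Ck_on 0 S f \<longleftrightarrow> continuous_on S f"
| "Ck_on (Suc k) S f \<longleftrightarrow>
     (\<forall>x\<in>S. f differentiable (at x)) \<and> (\<forall>v. Ck_on k S (\<lambda>x. frechet_derivative f (at x) v))"

text \<open>This is the usual notion when \<open>S\<close> is open and the domain is finite-dimensional.\<close>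

definition smooth_on :: "'a::real_normed_vector set \<Rightarrow> ('a \<Rightarrow> 'b::real_normed_vector) \<Rightarrow> bool" where
  "smooth_on S f \<longleftrightarrow> (\<forall>k. Ck_on k S f)"

definition chart_change :: "('a, 'e) chart \<Rightarrow> ('a, 'e) chart \<Rightarrow> 'e \<Rightarrow> 'e" where
  "chart_change c d = snd d \<circ> inv_into (fst c) (snd c)"

definition smooth_atlas :: "'a topology \<Rightarrow> ('a, 'e::euclidean_space) chart set \<Rightarrow> bool" where
  "smooth_atlas X A \<longleftrightarrow>
     (\<forall>(U, \<phi>)\<in>A. openin X U \<and> open (\<phi> ` U) \<and>
        homeomorphic_map (subtopology X U) (top_of_set (\<phi> ` U)) \<phi>) \<and>
     (\<Union>c\<in>A. fst c) = topspace X \<and>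
     (\<forall>c\<in>A. \<forall>d\<in>A. smooth_on (snd c ` (fst c \<inter> fst d)) (chart_change c d))"

text \<open>The atlas need not be maximal: it is used only to determine the smooth structure.\<close>

definition smooth_manifold :: "'a topology \<Rightarrow> ('a, 'e::euclidean_space) chart set \<Rightarrow> bool" where
  "smooth_manifold X A \<longleftrightarrow>
     Hausdorff_space X \<and> second_countable X \<and> connected_space X \<and> topspace X \<noteq> {} \<and>
     smooth_atlas X A"

definition closed_manifold :: "'a topology \<Rightarrow> ('a, 'e::euclidean_space) chart set \<Rightarrow> bool" where
  "closed_manifold X A \<longleftrightarrow> smooth_manifold X A \<and> compact_space X"


section \<open>Riemannian metrics and distance\<close>

text \<open>
  A Riemannian metric is given by its local expressions: \<open>g c x v w\<close> is the inner product at the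
  point \<open>x\<close> of the tangent vectors whose coordinates in the chart \<open>c\<close> are \<open>v\<close> and \<open>w\<close>.
\<close>

type_synonym ('a, 'e) metric_tensor = "('a, 'e) chart \<Rightarrow> 'a \<Rightarrow> 'e \<Rightarrow> 'e \<Rightarrow> real"

definition riemannian_metric ::
  "('a, 'e::euclidean_space) chart set \<Rightarrow> ('a, 'e) metric_tensor \<Rightarrow> bool" where
  "riemannian_metric A g \<longleftrightarrow>
     (\<forall>c\<in>A. \<forall>x\<in>fst c. bilinear (g c x) \<and> (\<forall>v w. g c x v w = g c x w v) \<and>
        (\<forall>v. v \<noteq> 0 \<longrightarrow> 0 < g c x v v)) \<and>
     (\<forall>c\<in>A. \<forall>v w. smooth_on (snd c ` fst c) (\<lambda>y. g c (inv_into (fst c) (snd c) y) v w)) \<and>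
     (\<forall>c\<in>A. \<forall>d\<in>A. \<forall>x\<in>fst c \<inter> fst d. \<forall>v w.
        let L = frechet_derivative (chart_change c d) (at (snd c x))
        in g c x v w = g d x (L v) (L w))"

definition C1_curve_on ::
  "('a, 'e::euclidean_space) chart set \<Rightarrow> real set \<Rightarrow> (real \<Rightarrow> 'a) \<Rightarrow> bool" where
  "C1_curve_on A I \<gamma> \<longleftrightarrow>
     (\<forall>c\<in>A. \<exists>D. continuous_on {t\<in>I. \<gamma> t \<in> fst c} D \<and>
        (\<forall>t\<in>I. \<gamma> t \<in> fst c \<longrightarrow> ((snd c \<circ> \<gamma>) has_vector_derivative D t) (at t within I)))"

definition piecewise_C1_curve ::
  "'a topology \<Rightarrow> ('a, 'e::euclidean_space) chart set \<Rightarrow> (real \<Rightarrow> 'a) \<Rightarrow> bool" where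
  "piecewise_C1_curve X A \<gamma> \<longleftrightarrow> pathin X \<gamma> \<and>
     (\<exists>(k::nat) \<tau>. \<tau> 0 = 0 \<and> \<tau> k = 1 \<and>
        (\<forall>i<k. \<tau> i < \<tau> (Suc i) \<and> C1_curve_on A {\<tau> i..\<tau> (Suc i)} \<gamma>))"

text \<open>For a Riemannian metric the speed does not depend on the chart that is chosen.\<close>

definition curve_speed ::
  "('a, 'e::euclidean_space) chart set \<Rightarrow> ('a, 'e) metric_tensor \<Rightarrow> (real \<Rightarrow> 'a) \<Rightarrow> real \<Rightarrow> real" where
  "curve_speed A g \<gamma> t =
     (let c = (SOME c. c \<in> A \<and> \<gamma> t \<in> fst c);
          v = vector_derivative (snd c \<circ> \<gamma>) (at t)
      in sqrt (g c (\<gamma> t) v v))"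

definition curve_length ::
  "('a, 'e::euclidean_space) chart set \<Rightarrow> ('a, 'e) metric_tensor \<Rightarrow> (real \<Rightarrow> 'a) \<Rightarrow> real" where
  "curve_length A g \<gamma> = integral {0..1} (curve_speed A g \<gamma>)"

definition riemannian_dist ::
  "'a topology \<Rightarrow> ('a, 'e::euclidean_space) chart set \<Rightarrow> ('a, 'e) metric_tensor \<Rightarrow> 'a \<Rightarrow> 'a \<Rightarrow> real"
  where
  "riemannian_dist X A g x y =
     Inf {curve_length A g \<gamma> |\<gamma>. piecewise_C1_curve X A \<gamma> \<and> \<gamma> 0 = x \<and> \<gamma> 1 = y}"

text \<open>
  The smooth structure of the total space \<open>Y\<close> of a covering map \<open>p\<close>, and the pullback of a metric
  along \<open>p\<close>; the latter does not depend on the chart \<open>d\<close> of the base that is chosen.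
\<close>

definition pullback_atlas ::
  "'b topology \<Rightarrow> ('b \<Rightarrow> 'a) \<Rightarrow> ('a, 'e) chart set \<Rightarrow> ('b, 'e) chart set" where
  "pullback_atlas Y p A =
     {(V, snd d \<circ> p) |V d. openin Y V \<and> inj_on p V \<and> d \<in> A \<and> p ` V \<subseteq> fst d}"

definition pullback_metric ::
  "('b \<Rightarrow> 'a) \<Rightarrow> ('a, 'e::euclidean_space) chart set \<Rightarrow> ('a, 'e) metric_tensor \<Rightarrow>
     ('b, 'e) metric_tensor" where
  "pullback_metric p A g c x v w =
     (let d = (SOME d. d \<in> A \<and> p x \<in> fst d);
          L = frechet_derivative (snd d \<circ> p \<circ> inv_into (fst c) (snd c)) (at (snd c x))
      in g d (p x) (L v) (L w))"

text \<open>The distance induced on \<^term>\<open>nsphere n\<close> by the canonical Riemannian metric.\<close>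

definition sphere_dist :: "nat \<Rightarrow> (nat \<Rightarrow> real) \<Rightarrow> (nat \<Rightarrow> real) \<Rightarrow> real" where
  "sphere_dist n x y = arccos (\<Sum>i\<le>n. x i * y i)"


section \<open>Fundamental group and coverings\<close>

definition path_homotopic :: "'a topology \<Rightarrow> (real \<Rightarrow> 'a) \<Rightarrow> (real \<Rightarrow> 'a) \<Rightarrow> bool" where
  "path_homotopic X \<gamma> \<delta> \<longleftrightarrow>
     homotopic_with (\<lambda>h. h 0 = \<gamma> 0 \<and> h 1 = \<gamma> 1) (top_of_set {0..1}) X \<gamma> \<delta>"

definition path_concat :: "(real \<Rightarrow> 'a) \<Rightarrow> (real \<Rightarrow> 'a) \<Rightarrow> real \<Rightarrow> 'a" where
  "path_concat \<gamma> \<delta> t = (if t \<le> 1/2 then \<gamma> (2 * t) else \<delta> (2 * t - 1))"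

definition loop_class :: "'a topology \<Rightarrow> (real \<Rightarrow> 'a) \<Rightarrow> (real \<Rightarrow> 'a) set" where
  "loop_class X \<gamma> = {\<delta>. path_homotopic X \<gamma> \<delta>}"

definition fundamental_group :: "'a topology \<Rightarrow> 'a \<Rightarrow> (real \<Rightarrow> 'a) set monoid" where
  "fundamental_group X a =
     \<lparr>carrier = loop_class X ` {\<gamma>. pathin X \<gamma> \<and> \<gamma> 0 = a \<and> \<gamma> 1 = a},
      mult = (\<lambda>C D. \<Union>\<gamma>\<in>C. \<Union>\<delta>\<in>D. loop_class X (path_concat \<gamma> \<delta>)),
      one = loop_class X (\<lambda>_. a)\<rparr>"

definition simply_connected_space :: "'a topology \<Rightarrow> bool" where
  "simply_connected_space X \<longleftrightarrow> path_connected_space X \<and>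
     (\<forall>\<gamma>. pathin X \<gamma> \<and> \<gamma> 1 = \<gamma> 0 \<longrightarrow> path_homotopic X \<gamma> (\<lambda>_. \<gamma> 0))"

text \<open>The analogue of \<^const>\<open>covering_space\<close> for abstract topologies.\<close>

definition covering_map :: "'b topology \<Rightarrow> ('b \<Rightarrow> 'a) \<Rightarrow> 'a topology \<Rightarrow> bool" where
  "covering_map Y p X \<longleftrightarrow>
     continuous_map Y X p \<and> p ` topspace Y = topspace X \<and>
     (\<forall>x\<in>topspace X. \<exists>U. x \<in> U \<and> openin X U \<and>
        (\<exists>\<V>. \<Union>\<V> = {y \<in> topspace Y. p y \<in> U} \<and>
             (\<forall>V\<in>\<V>. openin Y V) \<and> pairwise disjnt \<V> \<and>
             (\<forall>V\<in>\<V>. homeomorphic_map (subtopology Y V) (subtopology X U) p)))"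

definition universal_covering :: "'b topology \<Rightarrow> ('b \<Rightarrow> 'a) \<Rightarrow> 'a topology \<Rightarrow> bool" where
  "universal_covering Y p X \<longleftrightarrow> covering_map Y p X \<and> simply_connected_space Y"


section \<open>Classifying spaces and classifying maps\<close>

text \<open>
  For a discrete group \<open>G\<close>, a principal \<open>G\<close>-bundle is a covering whose total space carries a
  continuous \<open>G\<close>-action that is simply transitive on each fibre.
\<close>

definition principal_bundle ::
  "'g monoid \<Rightarrow> ('g \<Rightarrow> 'c \<Rightarrow> 'c) \<Rightarrow> 'c topology \<Rightarrow> ('c \<Rightarrow> 'd) \<Rightarrow> 'd topology \<Rightarrow> bool" where
  "principal_bundle G act E q B \<longleftrightarrow>
     covering_map E q B \<and> group_action G (topspace E) act \<and>
     (\<forall>g\<in>carrier G. continuous_map E E (act g)) \<and>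
     (\<forall>g\<in>carrier G. \<forall>e\<in>topspace E. q (act g e) = q e) \<and>
     (\<forall>e\<in>topspace E. \<forall>e'\<in>topspace E. q e = q e' \<longrightarrow> (\<exists>!g. g \<in> carrier G \<and> act g e = e'))"

text \<open>\<open>E \<rightarrow> B\<close> is a model of \<open>EG \<rightarrow> BG\<close>.\<close>

definition universal_bundle ::
  "'g monoid \<Rightarrow> ('g \<Rightarrow> 'c \<Rightarrow> 'c) \<Rightarrow> 'c topology \<Rightarrow> ('c \<Rightarrow> 'd) \<Rightarrow> 'd topology \<Rightarrow> bool" where
  "universal_bundle G act E q B \<longleftrightarrow>
     principal_bundle G act E q B \<and> topspace E \<noteq> {} \<and> contractible_space E"

text \<open>
  The action of the fundamental group on the universal covering by deck transformations: the class
  of a loop moves the base point \<open>e\<close> to the end point of the lift of the loop starting at \<open>e\<close>.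
\<close>

definition deck_action ::
  "'b topology \<Rightarrow> ('b \<Rightarrow> 'a) \<Rightarrow> 'a topology \<Rightarrow> 'b \<Rightarrow> ((real \<Rightarrow> 'a) set \<Rightarrow> 'b \<Rightarrow> 'b) \<Rightarrow> bool" where
  "deck_action Y p X e act \<longleftrightarrow>
     principal_bundle (fundamental_group X (p e)) act Y p X \<and>
     (\<forall>\<gamma>. pathin Y \<gamma> \<and> \<gamma> 0 = e \<and> p (\<gamma> 1) = p e \<longrightarrow> act (loop_class X (p \<circ> \<gamma>)) e = \<gamma> 1)"

text \<open>
  A map of the bases classifies the principal bundle \<open>Y \<rightarrow> X\<close> if it is covered by a morphism of
  principal bundles, which identifies \<open>Y\<close> with the pullback of \<open>E\<close>.
\<close>

definition classifying_map ::
  "'g monoid \<Rightarrow> ('g \<Rightarrow> 'b \<Rightarrow> 'b) \<Rightarrow> 'b topology \<Rightarrow> ('b \<Rightarrow> 'a) \<Rightarrow> 'a topology \<Rightarrow>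
     ('g \<Rightarrow> 'c \<Rightarrow> 'c) \<Rightarrow> 'c topology \<Rightarrow> ('c \<Rightarrow> 'd) \<Rightarrow> 'd topology \<Rightarrow> ('a \<Rightarrow> 'd) \<Rightarrow> bool" where
  "classifying_map G actY Y p X actE E q B c \<longleftrightarrow>
     continuous_map X B c \<and>
     (\<exists>C. continuous_map Y E C \<and>
        (\<forall>g\<in>carrier G. \<forall>y\<in>topspace Y. C (actY g y) = actE g (C y)) \<and>
        (\<forall>y\<in>topspace Y. q (C y) = c (p y)))"


section \<open>Orientations, fundamental classes, degree\<close>

definition cyclic_generator :: "'g monoid \<Rightarrow> 'g \<Rightarrow> bool" where
  "cyclic_generator G s \<longleftrightarrow> s \<in> carrier G \<and> (\<forall>x\<in>carrier G. \<exists>k::int. x = s [^]\<^bsub>G\<^esub> k)"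

text \<open>
  An orientation of an \<open>n\<close>-manifold \<open>X\<close> is a locally consistent choice of generators of the local
  homology groups \<open>H\<^sub>n(X, X - {x})\<close>.
\<close>

definition orientation :: "nat \<Rightarrow> 'a topology \<Rightarrow> ('a \<Rightarrow> 'a chain set) \<Rightarrow> bool" where
  "orientation n X \<omega> \<longleftrightarrow>
     (\<forall>x\<in>topspace X.
        cyclic_generator (relative_homology_group (int n) X (topspace X - {x})) (\<omega> x)) \<and>
     (\<forall>x\<in>topspace X. \<exists>U \<alpha>. openin X U \<and> x \<in> U \<and>
        \<alpha> \<in> carrier (relative_homology_group (int n) X (topspace X - U)) \<and>
        (\<forall>y\<in>U. hom_induced (int n) X (topspace X - U) X (topspace X - {y}) id \<alpha> = \<omega> y))"

text \<open>
  The fundamental class of \<open>X\<close> along the compact set \<open>K\<close>: the class in \<open>H\<^sub>n(X, X - K)\<close> that restricts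
  to the orientation at each point of \<open>K\<close>. For a closed manifold \<open>X\<close> and \<open>K = X\<close> it is the fundamental
  class in \<open>H\<^sub>n(X)\<close>.
\<close>

definition fundamental_class_along ::
  "nat \<Rightarrow> 'a topology \<Rightarrow> 'a set \<Rightarrow> ('a \<Rightarrow> 'a chain set) \<Rightarrow> 'a chain set \<Rightarrow> bool" where
  "fundamental_class_along n X K \<omega> \<mu> \<longleftrightarrow>
     \<mu> \<in> carrier (relative_homology_group (int n) X (topspace X - K)) \<and>
     (\<forall>x\<in>K. hom_induced (int n) X (topspace X - K) X (topspace X - {x}) id \<mu> = \<omega> x)"

definition fundamental_class ::
  "nat \<Rightarrow> 'a topology \<Rightarrow> ('a \<Rightarrow> 'a chain set) \<Rightarrow> 'a chain set \<Rightarrow> bool" where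
  "fundamental_class n X \<omega> \<mu> \<longleftrightarrow> fundamental_class_along n X (topspace X) \<omega> \<mu>"

text \<open>
  \<open>\<omega>'\<close> is the pullback of \<open>\<omega>\<close> along the covering map \<open>p\<close>: near each \<open>y\<close> the two correspond under the
  isomorphisms (excision) \<open>H\<^sub>n(Y, Y - {y}) \<leftarrow> H\<^sub>n(V, V - {y}) \<rightarrow> H\<^sub>n(X, X - {p y})\<close>.
\<close>

definition pullback_orientation ::
  "nat \<Rightarrow> 'b topology \<Rightarrow> ('b \<Rightarrow> 'a) \<Rightarrow> 'a topology \<Rightarrow> ('a \<Rightarrow> 'a chain set) \<Rightarrow> ('b \<Rightarrow> 'b chain set) \<Rightarrow>
     bool" where
  "pullback_orientation n Y p X \<omega> \<omega>' \<longleftrightarrow>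
     (\<forall>y\<in>topspace Y. \<exists>V \<beta>. openin Y V \<and> y \<in> V \<and> inj_on p V \<and>
        \<beta> \<in> carrier (relative_homology_group (int n) (subtopology Y V) (V - {y})) \<and>
        hom_induced (int n) (subtopology Y V) (V - {y}) Y (topspace Y - {y}) id \<beta> = \<omega>' y \<and>
        hom_induced (int n) (subtopology Y V) (V - {y}) X (topspace X - {p y}) p \<beta> = \<omega> (p y))"

text \<open>
  The degree of a map \<open>f\<close> from an oriented manifold to the sphere (of the same dimension \<open>n > 0\<close>)
  that has the constant value \<open>q\<close> outside a compact set \<open>K\<close>: the integer \<open>d\<close> such that
  \<open>H\<^sub>n(X, X - K) \<rightarrow> H\<^sub>n(S\<^sup>n, {q}) \<cong> H\<^sub>n(S\<^sup>n)\<close> takes the fundamental class to \<open>d\<close> times the generator \<open>\<sigma>\<close>,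
  which encodes the orientation of the sphere.
\<close>

definition has_degree ::
  "nat \<Rightarrow> 'a topology \<Rightarrow> ('a \<Rightarrow> 'a chain set) \<Rightarrow> (nat \<Rightarrow> real) chain set \<Rightarrow> ('a \<Rightarrow> nat \<Rightarrow> real) \<Rightarrow>
     int \<Rightarrow> bool" where
  "has_degree n X \<omega> \<sigma> f d \<longleftrightarrow>
     continuous_map X (nsphere n) f \<and>
     (\<exists>K q \<mu>. compactin X K \<and> q \<in> topspace (nsphere n) \<and> f ` (topspace X - K) \<subseteq> {q} \<and>
        fundamental_class_along n X K \<omega> \<mu> \<and>
        hom_induced (int n) X (topspace X - K) (nsphere n) {q} f \<mu> =
          hom_induced (int n) (nsphere n) {} (nsphere n) {q} id \<sigma>
            [^]\<^bsub>relative_homology_group (int n) (nsphere n) {q}\<^esub> d)"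

text \<open>
  \<open>M\<close> is an oriented manifold with metric \<open>g\<close> and \<open>p\<close> is its universal covering. Which of the two
  orientations \<open>\<sigma>\<close> of the sphere is taken only affects the sign of the degree.
\<close>

definition universally_enlargeable ::
  "'a topology \<Rightarrow> ('a, 'e::euclidean_space) chart set \<Rightarrow> ('a \<Rightarrow> 'a chain set) \<Rightarrow> ('a, 'e) metric_tensor \<Rightarrow>
     'b topology \<Rightarrow> ('b \<Rightarrow> 'a) \<Rightarrow> bool" where
  "universally_enlargeable M A \<omega> g M' p \<longleftrightarrow>
     (let n = DIM('e); A' = pullback_atlas M' p A; g' = pullback_metric p A g
      in \<exists>\<omega>' \<sigma>. pullback_orientation n M' p M \<omega> \<omega>' \<and>
           cyclic_generator (homology_group (int n) (nsphere n)) \<sigma> \<and>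
           (\<forall>\<epsilon>>0. \<exists>f.
              (\<forall>x\<in>topspace M'. \<forall>y\<in>topspace M'.
                 sphere_dist n (f x) (f y) \<le> \<epsilon> * riemannian_dist M' A' g' x y) \<and>
              (\<exists>d. d \<noteq> 0 \<and> has_degree n M' \<omega>' \<sigma> f d)))"


section \<open>Singular homology with rational coefficients\<close>

type_synonym 'a rat_chain = "((nat \<Rightarrow> real) \<Rightarrow> 'a) \<Rightarrow>\<^sub>0 rat"

definition rat_chain_boundary :: "nat \<Rightarrow> 'a rat_chain \<Rightarrow> 'a rat_chain" where
  "rat_chain_boundary p c =
     (if p = 0 then 0
      else \<Sum>s\<in>Poly_Mapping.keys c. \<Sum>k\<le>p.
             Poly_Mapping.single (singular_face p k s) ((-1) ^ k * Poly_Mapping.lookup c s))"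

definition rat_chain_map :: "nat \<Rightarrow> ('a \<Rightarrow> 'b) \<Rightarrow> 'a rat_chain \<Rightarrow> 'b rat_chain" where
  "rat_chain_map p f c =
     (\<Sum>s\<in>Poly_Mapping.keys c. Poly_Mapping.single (simplex_map p f s) (Poly_Mapping.lookup c s))"

definition rat_chains :: "nat \<Rightarrow> 'a topology \<Rightarrow> 'a rat_chain set" where
  "rat_chains p X = {c. Poly_Mapping.keys c \<subseteq> singular_simplex_set p X}"

definition rat_cycle_group :: "nat \<Rightarrow> 'a topology \<Rightarrow> 'a rat_chain monoid" where
  "rat_cycle_group p X =
     \<lparr>carrier = {c \<in> rat_chains p X. rat_chain_boundary p c = 0}, mult = (+), one = 0\<rparr>"

definition rat_boundaries :: "nat \<Rightarrow> 'a topology \<Rightarrow> 'a rat_chain set" where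
  "rat_boundaries p X = rat_chain_boundary (Suc p) ` rat_chains (Suc p) X"

definition rat_homology_group :: "nat \<Rightarrow> 'a topology \<Rightarrow> 'a rat_chain set monoid" where
  "rat_homology_group p X = rat_cycle_group p X Mod rat_boundaries p X"

definition rat_homology_class :: "nat \<Rightarrow> 'a topology \<Rightarrow> 'a rat_chain \<Rightarrow> 'a rat_chain set" where
  "rat_homology_class p X z = rat_boundaries p X #>\<^bsub>rat_cycle_group p X\<^esub> z"

definition rat_hom_induced ::
  "nat \<Rightarrow> 'a topology \<Rightarrow> 'b topology \<Rightarrow> ('a \<Rightarrow> 'b) \<Rightarrow> 'a rat_chain set \<Rightarrow> 'b rat_chain set" where
  "rat_hom_induced p X Y f C = (\<Union>z\<in>C. rat_homology_class p Y (rat_chain_map p f z))"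

text \<open>The change of coefficients \<open>H\<^sub>p(X; \<int>) \<rightarrow> H\<^sub>p(X; \<rat>)\<close>.\<close>

definition rationalize :: "nat \<Rightarrow> 'a topology \<Rightarrow> 'a chain set \<Rightarrow> 'a rat_chain set" where
  "rationalize p X C = (\<Union>z\<in>C. rat_homology_class p X (Poly_Mapping.map rat_of_int z))"

end

theory Submission
  imports Defs
begin

text \<open>
  Suppose that \<open>k c\<^sub>*[M]\<close> bounds an integral chain \<open>b\<close> in \<open>B\<close>. Choose a \<open>G\<close>-equivariant map of sets
  \<open>\<theta>: E \<rightarrow> M'\<close>, not necessarily continuous, and let \<open>f: M' \<rightarrow> S\<^sup>n\<close> be \<open>\<epsilon>\<close>-Lipschitz. Up to the action of \<open>G\<close> only
  finitely many simplices lie over the fundamental cycle and over \<open>b\<close>, so for small \<open>\<epsilon>\<close> the values of \<open>f\<close>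
  on each of them, and of \<open>f \<circ> \<theta>\<close> on their vertices, lie in an open half-space that does not contain
  the origin. Sending a simplex of \<open>E\<close> to the affine simplex that is spanned by the values of \<open>f \<circ> \<theta>\<close> at
  its vertices therefore extends \<open>f\<close> up to homotopy to the lift of \<open>b\<close>. Since \<open>f\<close> has the constant value
  \<open>q0\<close> outside a compact set, the sum over all lifts is finite modulo \<open>q0\<close>, and \<open>k deg f\<close> times the
  generator of \<open>H\<^sub>n(S\<^sup>n, q0)\<close> bounds the image of the lift of \<open>b\<close>; so \<open>deg f = 0\<close>.
  That \<open>deg f\<close> can be computed from the lift of the fundamental cycle of \<open>M\<close> is the uniqueness of
  the fundamental class along a compact set.
\<close>

section \<open>Local homology of manifolds\<close>

text \<open>\<open>B\<close> is not assumed to have a cell structure, so extending \<open>f\<close>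
  over \<open>E\<close> cell by cell is not an option. An affine simplex needs only the values at
  its vertices, and for these an arbitrary equivariant \<open>\<theta>\<close> is enough: up to
  \<open>G\<close> finitely many vertices occur, and equivariance turns every comparison into one
  between translates of finitely many points of \<open>M'\<close>. The Lipschitz condition has to be
  used uniformly over all translates, which works because a deck transformation takes a lift of a
  curve to another lift of the same curve. The order of the choices matters: the simplices and
  \<open>\<theta>\<close> come before \<epsilon>, and \<open>f\<close> with its compact set
  \<open>K\<close> only afterwards.

  Two different truncations of the sum over all lifts are forced. The degree is computed from the
  lifts that meet \<open>K\<close>, whereas the straightening sees the lifts at whose vertices
  \<open>f \<circ> \<theta>\<close> differs from \<open>q0\<close>; neither family need contain the
  other. Both are compared with a third truncation, which discards only lifts on which both maps
  have the constant value \<open>q0\<close>.\<close>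

text \<open>
  The points of detection \<open>Q\<close> are a separate argument so that \<open>Q = {}\<close> expresses the vanishing of
  \<open>H\<^sub>i(X, X - K)\<close>.
\<close>

definition point_detected :: "nat \<Rightarrow> 'a topology \<Rightarrow> 'a set \<Rightarrow> 'a set \<Rightarrow> bool" where
  "point_detected i X K Q \<longleftrightarrow>
     (\<forall>z. singular_relcycle i X (topspace X - K) z \<longrightarrow>
        (\<forall>x\<in>Q. singular_relboundary i X (topspace X - {x}) z) \<longrightarrow>
        singular_relboundary i X (topspace X - K) z)"

text \<open>
  All degrees \<open>i \<ge> n\<close> are treated at once: the Mayer-Vietoris step for \<open>A \<union> B\<close> in degree \<open>i\<close> uses
  \<open>A \<inter> B\<close> in degree \<open>i + 1\<close>, where the local homology vanishes.
\<close>

definition locally_determined :: "nat \<Rightarrow> 'a topology \<Rightarrow> 'a set \<Rightarrow> bool" where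
  "locally_determined n X K \<longleftrightarrow> (\<forall>i\<ge>n. point_detected i X K K)"

definition local_homology_vanishes_above :: "nat \<Rightarrow> 'a topology \<Rightarrow> bool" where
  "local_homology_vanishes_above n X \<longleftrightarrow> (\<forall>i>n. \<forall>x\<in>topspace X. point_detected i X {x} {})"

section \<open>Gluing along closed sets: Mayer-Vietoris for chains\<close>

lemma singular_relcycle_mono:
  assumes "singular_relcycle p X S c" "S \<subseteq> T"
  shows "singular_relcycle p X T c"
  using assms singular_chain_mono unfolding singular_relcycle by blast

lemma singular_relboundary_mono:
  assumes "singular_relboundary p X S c" "S \<subseteq> T"
  shows "singular_relboundary p X T c"
  using assms singular_chain_mono unfolding singular_relboundary by blast

text \<open>After sufficiently many barycentric subdivisions every simplex lies in one of the two
  open sets, and the keys are distributed accordingly. Only the subdivided chain is split, so a user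
  has to correct for the subdivision by a chain homotopy.\<close>

lemma chain_split_open_cover:
  assumes c: "singular_chain p X c" and U: "openin X U" and V: "openin X V"
    and UV: "topspace X = U \<union> V"
  obtains n a b where "singular_chain p (subtopology X U) a" "singular_chain p (subtopology X V) b"
    "(singular_subdivision p ^^ n) c = a + b"
proof -
  obtain n where n: "\<And>m f. \<lbrakk>n \<le> m; f \<in> Poly_Mapping.keys ((singular_subdivision p ^^ m) c)\<rbrakk>
                      \<Longrightarrow> \<exists>W \<in> {U,V}. f \<in> (standard_simplex p) \<rightarrow> W"
  proof -
    have 1: "openin X W" if "W \<in> {U, V}" for W using that U V by blast
    have 2: "topspace X \<subseteq> \<Union>{U, V}" using UV by simp
    show thesis if "\<And>n. (\<And>m f. \<lbrakk>n \<le> m; f \<in> Poly_Mapping.keys ((singular_subdivision p ^^ m) c)\<rbrakk>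
                      \<Longrightarrow> \<exists>W \<in> {U,V}. f \<in> (standard_simplex p) \<rightarrow> W) \<Longrightarrow> thesis"
      by (rule sufficient_iterated_singular_subdivision_exists[OF 1 2 c], assumption, rule that)
  qed
  have ch: "singular_chain p X ((singular_subdivision p ^^ n) c)"
    using c by (induction n) (auto simp: singular_chain_singular_subdivision)
  have "Poly_Mapping.keys ((singular_subdivision p ^^ n) c)
     \<subseteq> singular_simplex_set p (subtopology X U) \<union> singular_simplex_set p (subtopology X V)"
  proof
    fix f assume f: "f \<in> Poly_Mapping.keys ((singular_subdivision p ^^ n) c)"
    then have "singular_simplex p X f" using ch unfolding singular_chain_def by blast
    then show "f \<in> singular_simplex_set p (subtopology X U) \<union> singular_simplex_set p (subtopology X V)"
      using n[OF order_refl f] by (auto simp: singular_simplex_subtopology)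
  qed
  then obtain a b where "Poly_Mapping.keys a \<subseteq> singular_simplex_set p (subtopology X U)"
    "Poly_Mapping.keys b \<subseteq> singular_simplex_set p (subtopology X V)"
    "a + b = (singular_subdivision p ^^ n) c"
    using frag_split by blast
  then show thesis
    using that[of a b n] by (simp add: singular_chain_def)
qed

text \<open>This is the part H_{i+1}(X, X - (A \<inter> B)) -> H_i(X, X - (A \<union> B)) -> H_i(X,
  X - A) \<oplus> H_i(X, X - B) of the Mayer-Vietoris sequence, carried out on chains: the first
  group vanishes because i + 1 exceeds \<open>n\<close>, so the second map is injective.\<close>

lemma locally_determined_Un:
  assumes A: "closedin X A" and B: "closedin X B"
    and dA: "locally_determined n X A" and dB: "locally_determined n X B"
    and dAB: "locally_determined n X (A \<inter> B)"
    and van: "local_homology_vanishes_above n X"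
  shows "locally_determined n X (A \<union> B)"
  unfolding locally_determined_def point_detected_def
proof (intro allI impI)
  fix i z
  assume i: "n \<le> i" and z: "singular_relcycle i X (topspace X - (A \<union> B)) z"
    and loc: "\<forall>x\<in>A \<union> B. singular_relboundary i X (topspace X - {x}) z"
  have AX: "A \<subseteq> topspace X" "B \<subseteq> topspace X"
    using A B closedin_subset by blast+
  have "singular_relboundary i X (topspace X - A) z"
    using dA i loc singular_relcycle_mono[OF z] unfolding locally_determined_def point_detected_def by blast
  then obtain u a where u: "singular_chain (Suc i) X u"
    and a: "singular_chain i (subtopology X (topspace X - A)) a" and zu: "chain_boundary (Suc i) u + a = z"
    unfolding singular_relboundary by blast
  have "singular_relboundary i X (topspace X - B) z"
    using dB i loc singular_relcycle_mono[OF z] unfolding locally_determined_def point_detected_def by blast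
  then obtain v b where v: "singular_chain (Suc i) X v"
    and b: "singular_chain i (subtopology X (topspace X - B)) b" and zv: "chain_boundary (Suc i) v + b = z"
    unfolding singular_relboundary by blast
  let ?Y = "subtopology X (topspace X - A \<inter> B)"
  have a': "singular_chain i ?Y a"
    by (rule singular_chain_mono[OF a]) blast
  have b': "singular_chain i ?Y b"
    by (rule singular_chain_mono[OF b]) blast
  have duv: "chain_boundary (Suc i) (u - v) = b - a"
  proof -
    have "chain_boundary (Suc i) u = z - a" "chain_boundary (Suc i) v = z - b"
      using zu zv by (simp_all add: eq_diff_eq)
    then show ?thesis by (simp add: chain_boundary_diff)
  qed
  \<comment> \<open>The two reasons \<open>u\<close> and \<open>v\<close> for \<open>z\<close> to
    bound differ by a relative cycle one degree higher. That it bounds is what makes the reasons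
    compatible.\<close>
  have uv: "singular_relcycle (Suc i) X (topspace X - A \<inter> B) (u - v)"
    unfolding singular_relcycle using u v duv a' b' by (simp add: singular_chain_diff)
  \<comment> \<open>In degree i + 1 > \<open>n\<close> the condition at single points holds for
    every relative cycle, since there the local homology is zero.\<close>
  have "singular_relboundary (Suc i) X (topspace X - {x}) (u - v)" if "x \<in> A \<inter> B" for x
    using van that AX i singular_relcycle_mono[OF uv, of "topspace X - {x}"]
    unfolding local_homology_vanishes_above_def point_detected_def by fastforce
  then have "singular_relboundary (Suc i) X (topspace X - A \<inter> B) (u - v)"
    using dAB uv i unfolding locally_determined_def point_detected_def by (meson le_SucI)
  then obtain w e where w: "singular_chain (Suc (Suc i)) X w" and e: "singular_chain (Suc i) ?Y e"
    and uvw: "chain_boundary (Suc (Suc i)) w + e = u - v"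
    unfolding singular_relboundary by blast
  have de: "chain_boundary (Suc i) e = b - a"
    using duv uvw chain_boundary_boundary_alt[OF w] by (metis add_0 chain_boundary_add)
  have oA: "openin ?Y (topspace X - A)"
    unfolding openin_subtopology using A by (intro exI[of _ "topspace X - A"]) auto
  have oB: "openin ?Y (topspace X - B)"
    unfolding openin_subtopology using B by (intro exI[of _ "topspace X - B"]) auto
  have subA: "subtopology ?Y (topspace X - A) = subtopology X (topspace X - A)"
    and subB: "subtopology ?Y (topspace X - B) = subtopology X (topspace X - B)"
    by (auto simp: subtopology_subtopology intro!: arg_cong[where f="subtopology X"])
  have cov: "topspace ?Y = (topspace X - A) \<union> (topspace X - B)" by auto
  obtain m e1 e2 where e1: "singular_chain (Suc i) (subtopology X (topspace X - A)) e1"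
    and e2: "singular_chain (Suc i) (subtopology X (topspace X - B)) e2"
    and e12: "(singular_subdivision (Suc i) ^^ m) e = e1 + e2"
    using chain_split_open_cover[OF e oA oB cov] unfolding subA subB by metis
  \<comment> \<open>\<open>h\<close> is the chain homotopy from the identity to the iterated
    subdivision; it does not leave the subspace in which a chain lies.\<close>
  obtain h where h: "\<And>p c1 c2. h p (c1-c2) = h p c1 - h p (c2 :: 'a chain)"
    "\<And>p (X::'a topology) c. singular_chain p X c \<Longrightarrow> singular_chain (Suc p) X (h p c)"
    "\<And>p (X::'a topology) c. singular_chain p X c
        \<Longrightarrow> chain_boundary (Suc p) (h p c) + h (p - Suc 0) (chain_boundary p c) = (singular_subdivision p ^^ m) c - c"
    using chain_homotopic_iterated_singular_subdivision[of m] by metis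
  have eX: "singular_chain (Suc i) X e" using e by (simp add: singular_chain_subtopology)
  have "chain_boundary (Suc (Suc i)) (h (Suc i) e) + h i (b - a) = e1 + e2 - e"
    using h(3)[OF eX] de e12 by simp
  then have "chain_boundary (Suc i) (chain_boundary (Suc (Suc i)) (h (Suc i) e) + h i (b - a))
    = chain_boundary (Suc i) (e1 + e2 - e)" by simp
  then have "chain_boundary (Suc i) (h i b) - chain_boundary (Suc i) (h i a)
    = chain_boundary (Suc i) e1 + chain_boundary (Suc i) e2 - (b - a)"
    using chain_boundary_boundary_alt[OF h(2)[OF eX]] by (simp add: chain_boundary_add chain_boundary_diff h(1) de)
  \<comment> \<open>The same chain in two forms: the left one visibly avoids \<open>B\<close>, the
    right one visibly avoids \<open>A\<close>. It differs from \<open>b\<close>, hence from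
    \<open>z\<close>, by a boundary.\<close>
  then have r: "b - chain_boundary (Suc i) e2 + chain_boundary (Suc i) (h i b)
       = a + chain_boundary (Suc i) e1 + chain_boundary (Suc i) (h i a)" (is "?r = ?r'")
    by (simp add: algebra_simps)
  have rB: "singular_chain i (subtopology X (topspace X - B)) ?r"
    by (intro singular_chain_add singular_chain_diff b singular_chain_boundary_alt e2 h(2))
  have rA: "singular_chain i (subtopology X (topspace X - A)) ?r"
    unfolding r by (intro singular_chain_add singular_chain_diff a singular_chain_boundary_alt e1 h(2))
  have rAB: "singular_chain i (subtopology X (topspace X - (A \<union> B))) ?r"
    using rA rB unfolding singular_chain_subtopology by blast
  have sub: "singular_chain (Suc i) X (v + e2 - h i b)"
    using v e2 h(2)[OF b] by (simp add: singular_chain_add singular_chain_diff singular_chain_subtopology)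
  have "chain_boundary (Suc i) (v + e2 - h i b) + ?r = z"
    using zv by (simp add: chain_boundary_add chain_boundary_diff)
  then show "singular_relboundary i X (topspace X - (A \<union> B)) z"
    unfolding singular_relboundary using sub rAB by blast
qed

lemma locally_determined_empty: "locally_determined n X {}"
  unfolding locally_determined_def point_detected_def
  by (metis Diff_empty singular_chain_imp_relboundary singular_relcycle subtopology_topspace)

text \<open>The gluing step for K and \<Union>\<H> needs the set K \<inter> \<Union>\<H>, which is a
  union of at most as many members of the intersection-closed family as \<H> has. Hence the
  induction is on the number of sets, over all subfamilies at once.\<close>

lemma locally_determined_finite_Union:
  assumes closed: "\<And>K. K \<in> \<F> \<Longrightarrow> closedin X K"
    and det: "\<And>K. K \<in> \<F> \<Longrightarrow> locally_determined n X K"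
    and Int: "\<And>K L. K \<in> \<F> \<Longrightarrow> L \<in> \<F> \<Longrightarrow> K \<inter> L \<in> \<F>"
    and van: "local_homology_vanishes_above n X"
    and "finite \<G>" "\<G> \<subseteq> \<F>"
  shows "locally_determined n X (\<Union>\<G>)"
proof -
  have "\<forall>\<G>. card \<G> = m \<longrightarrow> finite \<G> \<longrightarrow> \<G> \<subseteq> \<F> \<longrightarrow> locally_determined n X (\<Union>\<G>)" for m
  proof (induction m rule: less_induct)
    case (less m)
    show ?case
    proof (intro allI impI)
      fix \<G> assume G: "card \<G> = m" "finite \<G>" "\<G> \<subseteq> \<F>"
      show "locally_determined n X (\<Union>\<G>)"
      proof (cases "\<G> = {}")
        case True then show ?thesis by (simp add: locally_determined_empty)
      next
        case False
        then obtain K where K: "K \<in> \<G>" by blast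
        define \<H> where "\<H> = \<G> - {K}"
        have H: "finite \<H>" "card \<H> < m" "\<H> \<subseteq> \<F>"
          using G K card_Diff1_less[of \<G> K] by (auto simp: \<H>_def)
        have eq: "\<Union>\<G> = K \<union> \<Union>\<H>" using K by (auto simp: \<H>_def)
        have "card ((\<inter>) K ` \<H>) < m" using H card_image_le[of \<H> "(\<inter>) K"] by linarith
        moreover have "(\<inter>) K ` \<H> \<subseteq> \<F>" using H K G Int by blast
        ultimately have 1: "locally_determined n X (\<Union>((\<inter>) K ` \<H>))"
          using less H by blast
        have "\<Union>((\<inter>) K ` \<H>) = K \<inter> \<Union>\<H>" by blast
        with 1 have 1: "locally_determined n X (K \<inter> \<Union>\<H>)" by simp
        show ?thesis unfolding eq
        proof (rule locally_determined_Un[OF _ _ _ _ 1 van])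
          show "closedin X K" "locally_determined n X K" using K G closed det by blast+
          show "closedin X (\<Union>\<H>)" using H closed by (intro closedin_Union) auto
          show "locally_determined n X (\<Union>\<H>)" using less H by blast
        qed
      qed
    qed
  qed
  then show ?thesis using assms by blast
qed


section \<open>Local homology of Euclidean space\<close>

lemma contractible_cycle_imp_boundary:
  assumes "contractible_space X" "p \<noteq> 0" "singular_relcycle p X {} c"
  shows "singular_relboundary p X {} c"
proof -
  have "trivial_group (homology_group (int p) X)"
    using trivial_reduced_homology_group_contractible_space[OF assms(1), of "int p"] assms(2)
    by (simp add: un_reduced_homology_group)
  moreover have "homologous_rel_set p X {} c \<in> carrier (homology_group (int p) X)"
    using assms(3) by (auto simp: carrier_relative_homology_group)
  ultimately have "homologous_rel_set p X {} c = singular_relboundary_set p X {}"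
    by (metis one_relative_homology_group singletonD trivial_group_def)
  then show ?thesis by (simp add: homologous_rel_set_eq_relboundary)
qed

text \<open>\<open>z - b\<close> is an absolute cycle in a contractible space. This is injectivity
  of the connecting map H_p(X, S) -> H_{p-1}(S), which reduces questions about relative cycles to
  their boundaries.\<close>

lemma relboundary_if_boundary_bounds:
  assumes X: "contractible_space X" and p: "p \<noteq> 0" and z: "singular_chain p X z"
    and b: "singular_chain p (subtopology X S) b" and eq: "chain_boundary p z = chain_boundary p b"
  shows "singular_relboundary p X S z"
proof -
  have bX: "singular_chain p X b" using b by (simp add: singular_chain_subtopology)
  have "singular_relcycle p X {} (z - b)"
    using z bX eq by (simp add: singular_cycle singular_chain_diff chain_boundary_diff)
  then have "singular_relboundary p X {} (z - b)"
    using contractible_cycle_imp_boundary X p by blast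
  then obtain d where "singular_chain (Suc p) X d" "chain_boundary (Suc p) d = z - b"
    by (auto simp: singular_boundary)
  then show ?thesis unfolding singular_relboundary using b by (metis diff_add_cancel)
qed

text \<open>A self-map \<open>r\<close> of the subspace \<open>S\<close> that is homotopic to the
  identity moves the boundary of \<open>z\<close> only by a boundary inside \<open>S\<close>. It
  will be used with radial maps, whose image lies where more is known.\<close>

lemma homotopic_id_imp_boundary_bounds:
  fixes X :: "'a topology"
  assumes z: "singular_relcycle p X S z" and p: "p \<noteq> 0"
    and hom: "homotopic_with (\<lambda>_. True) (subtopology X S) (subtopology X S) id r"
  obtains h where "singular_chain p (subtopology X S) h"
    "chain_boundary p z = chain_map (p - 1) r (chain_boundary p z) + chain_boundary p h"
proof -
  have dz: "singular_chain (p - 1) (subtopology X S) (chain_boundary p z)"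
    using z by (simp add: singular_relcycle)
  have "singular_relcycle (p - 1) (subtopology X S) {} (chain_boundary p z)"
    using dz z chain_boundary_boundary unfolding singular_cycle
    by (metis One_nat_def singular_relcycle)
  moreover have "homotopic_with (\<lambda>h. h \<in> {} \<rightarrow> {}) (subtopology X S) (subtopology X S) id r"
    using hom by simp
  ultimately have "homologous_rel (p - 1) (subtopology X S) {} (chain_map (p - 1) id (chain_boundary p z))
      (chain_map (p - 1) r (chain_boundary p z))"
    using homotopic_imp_homologous_rel_chain_maps by blast
  then obtain h where "singular_chain (Suc (p - 1)) (subtopology X S) h"
    "chain_boundary (Suc (p - 1)) h = chain_boundary p z - chain_map (p - 1) r (chain_boundary p z)"
    unfolding homologous_rel_def singular_boundary chain_map_ident[OF dz] by blast
  then show thesis using p that[of h] by simp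
qed

text \<open>A ray that starts at the point x of the convex set K never returns to K after leaving
  it, and a factor at least 1 moves points outward along such rays. So the straight homotopy stays
  outside K.\<close>

lemma homotopic_radial:
  fixes x :: "'e::euclidean_space"
  assumes K: "convex K" "x \<in> K" and f: "continuous_on (- {x}) f" "\<And>y. y \<noteq> x \<Longrightarrow> f y \<ge> (1::real)"
  shows "homotopic_with (\<lambda>_. True) (subtopology euclidean (- K)) (subtopology euclidean (- K))
     id (\<lambda>y. x + f y *\<^sub>R (y - x))"
proof (rule homotopic_with_linear)
  show "continuous_on (- K) (\<lambda>y. x + f y *\<^sub>R (y - x))"
    using K by (intro continuous_intros continuous_on_subset[OF f(1)]) auto
  fix y assume y: "y \<in> - K"
  then have yx: "y \<noteq> x" using K by auto
  show "closed_segment (id y) (x + f y *\<^sub>R (y - x)) \<subseteq> - K"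
  proof
    fix w assume "w \<in> closed_segment (id y) (x + f y *\<^sub>R (y - x))"
    then obtain u where u: "0 \<le> u" "u \<le> 1" and w: "w = (1 - u) *\<^sub>R y + u *\<^sub>R (x + f y *\<^sub>R (y - x))"
      by (auto simp: in_segment)
    define s where "s = 1 - u + u * f y"
    have ws: "w = x + s *\<^sub>R (y - x)" unfolding w s_def by (simp add: algebra_simps)
    have "u * f y \<ge> u" using u f(2)[OF yx] by (simp add: mult_le_cancel_left1)
    then have s: "s \<ge> 1" by (simp add: s_def)
    show "w \<in> - K"
    proof
      assume "w \<in> K"
      then have "(1 - 1/s) *\<^sub>R x + (1/s) *\<^sub>R w \<in> K"
        using K s by (intro convexD) auto
      moreover have "(1 - 1/s) *\<^sub>R x + (1/s) *\<^sub>R w = y" unfolding ws using s by (simp add: algebra_simps)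
      ultimately show False using y by simp
    qed
  qed
qed auto

lemma contractible_space_euclidean: "contractible_space (euclidean :: 'e::real_normed_vector topology)"
  using contractible_UNIV contractible_space_top_of_set[of "UNIV :: 'e set"] by simp

text \<open>It suffices to know that \<open>z\<close> vanishes at a single point x of K: a chain
  \<open>a\<close> that avoids x and has the boundary of \<open>z\<close> is pushed radially off K.
  The push changes the boundary of \<open>z\<close> only by a boundary in the complement of
  K.\<close>

lemma convex_imp_locally_determined:
  fixes K :: "'e::euclidean_space set"
  assumes "convex K" "compact K" "n \<noteq> 0"
  shows "locally_determined n euclidean K"
proof (cases "K = {}")
  case False
  then obtain x where x: "x \<in> K" by blast
  obtain R where R: "R > 0" "K \<subseteq> ball x R"
    using compact_imp_bounded[OF assms(2)] bounded_subset_ballD by blast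
  \<comment> \<open>R / |y - x| moves y to the sphere of radius R around x, which K does not reach;
    the maximum with 1 keeps the push outward also for points that are already farther away.\<close>
  define f where "f y = max 1 (R / norm (y - x))" for y
  define r where "r y = x + f y *\<^sub>R (y - x)" for y
  have contf: "continuous_on (- {x}) f"
    unfolding f_def by (intro continuous_intros) auto
  have rK: "r y \<in> - K" if "y \<noteq> x" for y
  proof -
    have "norm (r y - x) = f y * norm (y - x)" by (simp add: r_def f_def)
    also have "\<dots> \<ge> (R / norm (y - x)) * norm (y - x)" by (intro mult_right_mono) (auto simp: f_def)
    finally have "norm (r y - x) \<ge> R" using that by simp
    then show ?thesis using R by (auto simp: dist_norm norm_minus_commute)
  qed
  have hom: "homotopic_with (\<lambda>_. True) (subtopology euclidean (- K)) (subtopology euclidean (- K)) id r"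
    unfolding r_def by (rule homotopic_radial[OF assms(1) x contf]) (simp add: f_def)
  have contr: "continuous_map (subtopology euclidean (- {x})) (subtopology euclidean (- K)) r"
    using rK unfolding r_def by (auto intro!: continuous_intros contf)
  show ?thesis
    unfolding locally_determined_def point_detected_def
  proof (intro allI impI)
    fix i z assume i: "n \<le> i" and z: "singular_relcycle i euclidean (topspace euclidean - K) z"
      and loc: "\<forall>x\<in>K. singular_relboundary i euclidean (topspace euclidean - {x}) z"
    have i0: "i \<noteq> 0" using i assms(3) by simp
    obtain u a where u: "singular_chain (Suc i) euclidean u"
      and a: "singular_chain i (subtopology euclidean (- {x})) a" and zu: "chain_boundary (Suc i) u + a = z"
      using loc x unfolding singular_relboundary by (force simp: Compl_eq_Diff_UNIV)
    have da: "chain_boundary i z = chain_boundary i a"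
      using zu chain_boundary_boundary_alt[OF u] by (metis add_0 chain_boundary_add)
    obtain h where h: "singular_chain i (subtopology euclidean (- K)) h"
      "chain_boundary i z = chain_map (i - 1) r (chain_boundary i z) + chain_boundary i h"
      using homotopic_id_imp_boundary_bounds[OF _ i0 hom] z by (auto simp: Compl_eq_Diff_UNIV)
    have ra: "singular_chain i (subtopology euclidean (- K)) (chain_map i r a)"
      using a contr by (rule singular_chain_chain_map)
    have "chain_boundary i z = chain_boundary i (chain_map i r a + h)"
      using h(2) chain_boundary_chain_map[OF a, of r] da by (simp add: chain_boundary_add)
    then show "singular_relboundary i euclidean (topspace euclidean - K) z"
      using relboundary_if_boundary_bounds[OF contractible_space_euclidean i0, of z "- K" "chain_map i r a + h"]
       z ra h(1) by (simp add: singular_chain_add singular_relcycle Compl_eq_Diff_UNIV)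
  qed
qed (simp add: locally_determined_empty)

text \<open>The unit sphere has dimension \<open>DIM('e) - 1\<close>, so the bound on
  \<open>i\<close> is the first degree above it; in dimension 1 the sphere consists of two points
  and the degrees in question are still positive.\<close>

lemma sphere_cycle_imp_boundary:
  fixes x :: "'e::euclidean_space"
  assumes "i \<ge> DIM('e)" "singular_relcycle i (top_of_set (sphere x 1)) {} c"
  shows "singular_relboundary i (top_of_set (sphere x 1)) {} c"
proof -
  have i0: "i \<noteq> 0" using assms(1) DIM_positive[where 'a='e] by linarith
  have "sphere x 1 homeomorphic (sphere 0 1 :: 'e set)"
    by (rule homeomorphic_spheres) auto
  moreover obtain f :: "(nat \<Rightarrow> real) \<Rightarrow> 'e" and g where
    "homeomorphic_maps (nsphere (DIM('e) - 1)) (top_of_set (sphere 0 1 \<inter> span Basis)) f g"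
    by (rule homeomorphic_maps_nsphere_euclidean_sphere[of "Basis :: 'e set" "DIM('e)"])
      (auto simp: independent_Basis orthogonal_Basis)
  then have "nsphere (DIM('e) - 1) homeomorphic_space top_of_set (sphere 0 1 :: 'e set)"
    by (auto simp: homeomorphic_space_def)
  ultimately have "top_of_set (sphere x 1) homeomorphic_space nsphere (DIM('e) - 1)"
    by (metis homeomorphic_space_iff_homeomorphic homeomorphic_space_sym homeomorphic_space_trans)
  then have "homology_group (int i) (top_of_set (sphere x 1)) \<cong> homology_group (int i) (nsphere (DIM('e) - 1))"
    by (rule homeomorphic_space_imp_isomorphic_homology_groups)
  moreover have "trivial_group (homology_group (int i) (nsphere (DIM('e) - 1)))"
    using reduced_homology_group_nsphere(2)[of "int i" "DIM('e) - 1"] assms(1) i0 DIM_positive[where 'a='e]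
    by (simp add: un_reduced_homology_group)
  ultimately have "trivial_group (homology_group (int i) (top_of_set (sphere x 1)))"
    by (metis isomorphic_group_triviality group_relative_homology_group)
  moreover have "homologous_rel_set i (top_of_set (sphere x 1)) {} c \<in> carrier (homology_group (int i) (top_of_set (sphere x 1)))"
    using assms(2) by (auto simp: carrier_relative_homology_group)
  ultimately have "homologous_rel_set i (top_of_set (sphere x 1)) {} c = singular_relboundary_set i (top_of_set (sphere x 1)) {}"
    by (metis one_relative_homology_group singletonD trivial_group_def)
  then show ?thesis by (simp add: homologous_rel_set_eq_relboundary)
qed

text \<open>The boundary of a relative cycle lies in the complement of x, which is pushed radially
  to the unit sphere around x. There it is a cycle of degree i - 1, which is at least
  \<open>DIM('e)\<close>.\<close>

lemma local_homology_vanishes_above_euclidean: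
  "local_homology_vanishes_above DIM('e) (euclidean :: 'e::euclidean_space topology)"
  unfolding local_homology_vanishes_above_def point_detected_def
proof (intro allI impI ballI)
  fix i z and x :: 'e
  assume i: "DIM('e) < i" and z: "singular_relcycle i euclidean (topspace euclidean - {x}) z"
  have i0: "i \<noteq> 0" using i by simp
  define f where "f y = 1 / norm (y - x)" for y
  define r where "r y = x + f y *\<^sub>R (y - x)" for y
  have rs: "r y \<in> sphere x 1" if "y \<noteq> x" for y
    using that by (simp add: r_def f_def dist_norm)
  have contr: "continuous_on (- {x}) r"
    unfolding r_def f_def by (intro continuous_intros) auto
  have hom: "homotopic_with (\<lambda>_. True) (subtopology euclidean (- {x})) (subtopology euclidean (- {x})) id r"
  proof (rule homotopic_with_linear)
    fix y assume y: "y \<in> - {x}"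
    have "x \<notin> closed_segment y (r y)"
    proof
      assume "x \<in> closed_segment y (r y)"
      then obtain u where u: "0 \<le> u" "u \<le> 1" "x = (1 - u) *\<^sub>R y + u *\<^sub>R r y"
        by (auto simp: in_segment)
      then have "((1 - u) + u * f y) *\<^sub>R (y - x) = 0" unfolding r_def by (simp add: algebra_simps)
      then have "(1 - u) + u * f y = 0" using y by simp
      moreover have "f y > 0" using y by (simp add: f_def)
      ultimately show False using u by (smt (verit) mult_nonneg_nonneg mult_pos_pos)
    qed
    then show "closed_segment (id y) (r y) \<subseteq> - {x}" by auto
  qed (use contr in auto)
  have z': "singular_relcycle i euclidean (- {x}) z" using z by (simp add: Compl_eq_Diff_UNIV)
  obtain h where h: "singular_chain i (subtopology euclidean (- {x})) h"
      "chain_boundary i z = chain_map (i - 1) r (chain_boundary i z) + chain_boundary i h"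
    using homotopic_id_imp_boundary_bounds[OF z' i0 hom] by blast
  have "singular_relcycle (i - 1) (subtopology euclidean (- {x})) {} (chain_boundary i z)"
    using z' chain_boundary_boundary unfolding singular_cycle
    by (metis One_nat_def singular_relcycle)
  moreover have "continuous_map (subtopology euclidean (- {x})) (top_of_set (sphere x 1)) r"
    using contr rs by auto
  ultimately have "singular_relcycle (i - 1) (top_of_set (sphere x 1)) {} (chain_map (i - 1) r (chain_boundary i z))"
    by (rule singular_relcycle_chain_map) auto
  then have "singular_relboundary (i - 1) (top_of_set (sphere x 1)) {} (chain_map (i - 1) r (chain_boundary i z))"
    by (rule sphere_cycle_imp_boundary[rotated]) (use i in auto)
  then have "singular_relboundary (i - 1) (subtopology euclidean (- {x})) {} (chain_map (i - 1) r (chain_boundary i z))"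
    by (rule singular_boundary_mono[rotated]) auto
  then obtain b where b: "singular_chain i (subtopology euclidean (- {x})) b"
    "chain_boundary i b = chain_map (i - 1) r (chain_boundary i z)"
    using i0 by (auto simp: singular_boundary)
  have "chain_boundary i z = chain_boundary i (b + h)" using h(2) b(2) by (simp add: chain_boundary_add)
  then show "singular_relboundary i euclidean (topspace euclidean - {x}) z"
    using relboundary_if_boundary_bounds[OF contractible_space_euclidean i0, of z "- {x}" "b + h"]
       z' b h(1) by (simp add: singular_chain_add singular_relcycle Compl_eq_Diff_UNIV)
qed

definition chain_support :: "nat \<Rightarrow> 'a chain \<Rightarrow> 'a set" where
  "chain_support p c = (\<Union>f\<in>Poly_Mapping.keys c. f ` standard_simplex p)"

lemma compactin_chain_support:
  assumes "singular_chain p X c"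
  shows "compactin X (chain_support p c)"
  unfolding chain_support_def
proof (rule compactin_Union, simp_all, clarify)
  fix f assume "f \<in> Poly_Mapping.keys c"
  then have "continuous_map (subtopology (powertop_real UNIV) (standard_simplex p)) X f"
    using assms by (auto simp: singular_chain_def singular_simplex_def)
  moreover have "compactin (subtopology (powertop_real UNIV) (standard_simplex p)) (standard_simplex p)"
    by (simp add: compactin_subtopology compactin_standard_simplex)
  ultimately show "compactin X (f ` standard_simplex p)" by (metis image_compactin)
qed

lemma singular_chain_subtopology_support:
  "singular_chain p (subtopology X S) c \<longleftrightarrow> singular_chain p X c \<and> chain_support p c \<subseteq> S"
  by (auto simp: singular_chain_subtopology chain_support_def)

text \<open>\<open>K\<close> may be too wild to be cut into convex pieces, so it is enlarged to a
  finite union L of closed balls. Supports of chains are compact: small balls still miss the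
  boundary of \<open>z\<close>, and a chain that shows vanishing at the centre of a ball misses the
  whole ball, so that \<open>z\<close> vanishes at every point of L. The conclusion for L restricts
  to \<open>K\<close>.\<close>

lemma compact_imp_locally_determined:
  fixes K :: "'e::euclidean_space set"
  assumes K: "compact K"
  shows "locally_determined DIM('e) euclidean K"
  unfolding locally_determined_def point_detected_def
proof (intro allI impI)
  fix i z assume i: "DIM('e) \<le> i" and z: "singular_relcycle i euclidean (topspace euclidean - K) z"
    and loc: "\<forall>x\<in>K. singular_relboundary i euclidean (topspace euclidean - {x}) z"
  define S where "S = chain_support (i - 1) (chain_boundary i z)"
  have S: "compact S" "S \<inter> K = {}"
    using z compactin_chain_support[of "i - 1" euclidean "chain_boundary i z"]
    by (auto simp: S_def singular_relcycle singular_chain_subtopology_support)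
  have "\<exists>e>0. cball x e \<inter> S = {} \<and>
      (\<forall>y\<in>cball x e. singular_relboundary i euclidean (- {y}) z)" if x: "x \<in> K" for x
  proof -
    obtain u a where u: "singular_chain (Suc i) euclidean u"
      and a: "singular_chain i (subtopology euclidean (- {x})) a" and zu: "chain_boundary (Suc i) u + a = z"
      using loc x unfolding singular_relboundary by (force simp: Compl_eq_Diff_UNIV)
    define T where "T = chain_support i a"
    have T: "compact T" "x \<notin> T"
      using a compactin_chain_support[of i euclidean a]
      by (auto simp: T_def singular_chain_subtopology_support)
    have "open (- (S \<union> T))" using S T by (intro open_Compl closed_Un compact_imp_closed)
    moreover have "x \<in> - (S \<union> T)" using S T x by auto
    ultimately obtain e where e: "e > 0" "cball x e \<subseteq> - (S \<union> T)"
      by (meson open_contains_cball)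
    have "singular_relboundary i euclidean (- {y}) z" if "y \<in> cball x e" for y
    proof -
      have "singular_chain i (subtopology euclidean (- {y})) a"
        using a e that by (auto simp: singular_chain_subtopology_support T_def)
      then show ?thesis unfolding singular_relboundary using u zu by blast
    qed
    then show ?thesis using e by blast
  qed
  then obtain e where e: "\<And>x. x \<in> K \<Longrightarrow> e x > 0" "\<And>x. x \<in> K \<Longrightarrow> cball x (e x) \<inter> S = {}"
     "\<And>x y. x \<in> K \<Longrightarrow> y \<in> cball x (e x) \<Longrightarrow> singular_relboundary i euclidean (- {y}) z"
    by metis
  obtain F where F: "F \<subseteq> K" "finite F" "K \<subseteq> (\<Union>x\<in>F. ball x (e x))"
  proof (rule compactE_image[OF K, of K "\<lambda>x. ball x (e x)"])
    show "K \<subseteq> (\<Union>x\<in>K. ball x (e x))" using e(1) by force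
  qed auto
  define L where "L = \<Union>((\<lambda>x. cball x (e x)) ` F)"
  have KL: "K \<subseteq> L" using F(3) ball_subset_cball unfolding L_def by blast
  have LS: "L \<inter> S = {}" using e(2) F(1) by (auto simp: L_def)
  have "locally_determined DIM('e) euclidean L"
    unfolding L_def
  \<comment> \<open>Balls are not closed under intersection; compact convex sets are.\<close>
  proof (rule locally_determined_finite_Union[where \<F>="{C. compact C \<and> convex C}"])
    show "locally_determined DIM('e) euclidean C" if "C \<in> {C. compact C \<and> convex C}" for C :: "'e set"
      using that convex_imp_locally_determined[of C "DIM('e)"] by auto
  qed (use F in \<open>auto simp: compact_imp_closed compact_Int convex_Int local_homology_vanishes_above_euclidean\<close>)
  moreover have "singular_relcycle i euclidean (- L) z"
    using z LS by (auto simp: singular_relcycle singular_chain_subtopology_support S_def)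
  moreover have "\<forall>y\<in>L. singular_relboundary i euclidean (- {y}) z"
    using e(3) F(1) by (auto simp: L_def)
  ultimately have "singular_relboundary i euclidean (- L) z"
    using i unfolding locally_determined_def point_detected_def by (simp add: Compl_eq_Diff_UNIV)
  then show "singular_relboundary i euclidean (topspace euclidean - K) z"
    using singular_relboundary_mono[of i euclidean "- L" z "- K"] KL by (auto simp: Compl_eq_Diff_UNIV)
qed


section \<open>Excision and passage to charts\<close>

lemma excise_relcycle:
  assumes U: "openin X U" and K: "closedin X K" "K \<subseteq> U" and z: "singular_relcycle p X (topspace X - K) z"
  obtains z' where "singular_relcycle p (subtopology X U) (U - K) z'"
    "homologous_rel p X (topspace X - K) z z'"
proof -
  have UX: "U \<subseteq> topspace X" using U openin_subset by blast
  have "X closure_of (topspace X - U) = topspace X - U" "X interior_of (topspace X - K) = topspace X - K"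
    using U K(1) by (auto simp: closure_of_eq interior_of_eq)
  then have cl: "X closure_of (topspace X - U) \<subseteq> X interior_of (topspace X - K)"
    using K(2) by auto
  have eq: "topspace X - (topspace X - U) = U" "topspace X - K - (topspace X - U) = U - K"
    using UX by auto
  show thesis
    using excised_relcycle_exists[OF cl, of "topspace X" p z] z that unfolding eq by auto
qed

text \<open>This is injectivity of the excision map H_p(U, U - K) -> H_p(X, X - K), where
  \<open>excise_relcycle\<close> is its surjectivity, both in terms of representing chains.\<close>

lemma excise_relboundary:
  assumes U: "openin X U" and K: "closedin X K" "K \<subseteq> U"
    and z: "singular_relcycle p (subtopology X U) (U - K) z"
    and b: "singular_relboundary p X (topspace X - K) z"
  shows "singular_relboundary p (subtopology X U) (U - K) z"
proof -
  have UX: "U \<subseteq> topspace X" using U openin_subset by blast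
  have "X closure_of (topspace X - U) = topspace X - U" "X interior_of (topspace X - K) = topspace X - K"
    using U K(1) by (auto simp: closure_of_eq interior_of_eq)
  then have cl: "X closure_of (topspace X - U) \<subseteq> X interior_of (topspace X - K)"
    using K(2) by auto
  have eq: "topspace X - (topspace X - U) = U" "topspace X - K - (topspace X - U) = U - K"
    using UX by auto
  let ?h = "hom_induced (int p) (subtopology X U) (U - K) X (topspace X - K) id"
  let ?G = "relative_homology_group (int p) (subtopology X U) (U - K)"
  let ?H = "relative_homology_group (int p) X (topspace X - K)"
  have iso: "?h \<in> iso ?G ?H"
    using homology_excision_axiom[OF cl, of "topspace X" "int p"] unfolding eq by simp
  have zz: "chain_map p id z = z"
    using z by (auto simp: singular_relcycle chain_map_ident)
  have "?h (homologous_rel_set p (subtopology X U) (U - K) z) = homologous_rel_set p X (topspace X - K) (chain_map p id z)"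
    using UX by (intro hom_induced_chain_map z) (auto simp: continuous_map_from_subtopology)
  also have "\<dots> = \<one>\<^bsub>?H\<^esub>" unfolding zz one_relative_homology_group homologous_rel_set_eq_relboundary by (rule b)
  also have "\<dots> = ?h \<one>\<^bsub>?G\<^esub>"
    using iso hom_one[of ?h ?G ?H] by (simp add: iso_def)
  finally have eq: "?h (homologous_rel_set p (subtopology X U) (U - K) z) = ?h \<one>\<^bsub>?G\<^esub>" .
  have "homologous_rel_set p (subtopology X U) (U - K) z = \<one>\<^bsub>?G\<^esub>"
  proof (rule inj_onD[of ?h "carrier ?G"])
    show "?h (homologous_rel_set p (subtopology X U) (U - K) z) = ?h \<one>\<^bsub>?G\<^esub>" by (rule eq)
    show "inj_on ?h (carrier ?G)" using iso by (simp add: iso_def bij_betw_def)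
    show "homologous_rel_set p (subtopology X U) (U - K) z \<in> carrier ?G"
      using z by (auto simp: carrier_relative_homology_group)
    show "\<one>\<^bsub>?G\<^esub> \<in> carrier ?G"
      by (intro monoid.one_closed group.is_monoid group_relative_homology_group)
  qed
  then show ?thesis by (simp add: homologous_rel_set_eq_relboundary)
qed

lemma relboundary_from_open:
  assumes U: "openin X U" and z: "singular_relboundary p (subtopology X U) (U - K) z"
  shows "singular_relboundary p X (topspace X - K) z"
proof -
  have UX: "U \<subseteq> topspace X" using U openin_subset by blast
  have "singular_relboundary p X (topspace X - K) (chain_map p id z)"
    using UX by (intro singular_relboundary_chain_map[OF z]) (auto simp: continuous_map_from_subtopology)
  then show ?thesis using singular_relboundary_imp_chain[OF z] by (simp add: chain_map_ident)
qed

lemma relcycle_from_open: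
  assumes U: "openin X U" and z: "singular_relcycle p (subtopology X U) (U - K) z"
  shows "singular_relcycle p X (topspace X - K) z"
proof -
  have UX: "U \<subseteq> topspace X" using U openin_subset by blast
  have "singular_relcycle p X (topspace X - K) (chain_map p id z)"
    using UX by (intro singular_relcycle_chain_map[OF z]) (auto simp: continuous_map_from_subtopology)
  moreover have "chain_map p id z = z"
    using z chain_map_ident unfolding singular_relcycle by blast
  ultimately show ?thesis by simp
qed

text \<open>Both directions are used for a chart: one descends from the Euclidean space to the open
  image of the chart, the other ascends from the chart domain to the manifold.\<close>

lemma point_detected_open_iff:
  assumes X: "t1_space X" and U: "openin X U" and K: "closedin X K" "K \<subseteq> U" and Q: "Q \<subseteq> K"
  shows "point_detected p X K Q \<longleftrightarrow> point_detected p (subtopology X U) K Q"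
proof -
  have UX: "U \<subseteq> topspace X" using U openin_subset by blast
  have tU: "topspace (subtopology X U) = U" using UX by auto
  have Q1: "closedin X {x}" "{x} \<subseteq> U" if "x \<in> Q" for x
    using that Q K(2) UX X by (auto simp: t1_space_closedin_singleton)
  show ?thesis
  proof
    assume d: "point_detected p X K Q"
    show "point_detected p (subtopology X U) K Q"
      unfolding point_detected_def tU
    proof (intro allI impI)
      fix z assume z: "singular_relcycle p (subtopology X U) (U - K) z"
        and loc: "\<forall>x\<in>Q. singular_relboundary p (subtopology X U) (U - {x}) z"
      have "singular_relboundary p X (topspace X - K) z"
        using d relcycle_from_open[OF U z] relboundary_from_open[OF U] loc unfolding point_detected_def by blast
      then show "singular_relboundary p (subtopology X U) (U - K) z"
        by (rule excise_relboundary[OF U K z])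
    qed
  next
    assume d: "point_detected p (subtopology X U) K Q"
    show "point_detected p X K Q"
      unfolding point_detected_def
    proof (intro allI impI)
      fix z assume z: "singular_relcycle p X (topspace X - K) z"
        and loc: "\<forall>x\<in>Q. singular_relboundary p X (topspace X - {x}) z"
      obtain z' where z': "singular_relcycle p (subtopology X U) (U - K) z'"
        "homologous_rel p X (topspace X - K) z z'"
        by (rule excise_relcycle[OF U K z])
      have "singular_relboundary p (subtopology X U) (U - {x}) z'" if x: "x \<in> Q" for x
      proof (rule excise_relboundary[OF U Q1[OF x]])
        show "singular_relcycle p (subtopology X U) (U - {x}) z'"
          by (rule singular_relcycle_mono[OF z'(1)]) (use x Q in blast)
        have "singular_relboundary p X (topspace X - {x}) (z - z')"
          using singular_relboundary_mono[of p X "topspace X - K" "z - z'" "topspace X - {x}"] z'(2) x Q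
          unfolding homologous_rel_def by blast
        then have "singular_relboundary p X (topspace X - {x}) (z - (z - z'))"
          using loc x singular_relboundary_diff by blast
        then show "singular_relboundary p X (topspace X - {x}) z'" by simp
      qed
      then have "singular_relboundary p (subtopology X U) (U - K) z'"
        using d z'(1) unfolding point_detected_def tU by blast
      then have "singular_relboundary p X (topspace X - K) z'"
        by (rule relboundary_from_open[OF U])
      then have "singular_relboundary p X (topspace X - K) ((z - z') + z')"
        using z'(2) unfolding homologous_rel_def by (intro singular_relboundary_add)
      then show "singular_relboundary p X (topspace X - K) z" by simp
    qed
  qed
qed

lemma point_detected_homeomorphic:
  assumes f: "homeomorphic_map X Y f" and K: "K \<subseteq> topspace X" and Q: "Q \<subseteq> topspace X"
    and d: "point_detected p Y (f ` K) (f ` Q)"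
  shows "point_detected p X K Q"
  unfolding point_detected_def
proof (intro allI impI)
  fix z assume z: "singular_relcycle p X (topspace X - K) z"
    and loc: "\<forall>x\<in>Q. singular_relboundary p X (topspace X - {x}) z"
  obtain g where g: "homeomorphic_maps X Y f g" using f homeomorphic_map_maps by blast
  have cf: "continuous_map X Y f" and cg: "continuous_map Y X g"
    and gf: "\<And>x. x \<in> topspace X \<Longrightarrow> g (f x) = x" and fg: "\<And>y. y \<in> topspace Y \<Longrightarrow> f (g y) = y"
    using g by (auto simp: homeomorphic_maps_def)
  have im: "f \<in> topspace X - A \<rightarrow> topspace Y - f ` A" if "A \<subseteq> topspace X" for A
    using cf gf that unfolding continuous_map_def by (auto simp: Pi_iff) (metis subsetD)
  have "singular_relcycle p Y (topspace Y - f ` K) (chain_map p f z)"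
    by (rule singular_relcycle_chain_map[OF z cf im[OF K]])
  moreover have "\<forall>y\<in>f ` Q. singular_relboundary p Y (topspace Y - {y}) (chain_map p f z)"
  proof clarify
    fix x assume x: "x \<in> Q"
    then have xt: "{x} \<subseteq> topspace X" using Q by blast
    show "singular_relboundary p Y (topspace Y - {f x}) (chain_map p f z)"
      using singular_relboundary_chain_map[OF _ cf im[OF xt]] loc x by simp
  qed
  ultimately have "singular_relboundary p Y (topspace Y - f ` K) (chain_map p f z)"
    using d unfolding point_detected_def by blast
  moreover have "g \<in> topspace Y - f ` K \<rightarrow> topspace X - K"
    using cg fg unfolding continuous_map_def by (auto simp: Pi_iff) (metis imageI)
  ultimately have "singular_relboundary p X (topspace X - K) (chain_map p g (chain_map p f z))"
    by (rule singular_relboundary_chain_map[OF _ cg])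
  moreover have "chain_map p g (chain_map p f z) = z"
    using chain_map_compose[of p g f] chain_map_id_gen[of p X z "g \<circ> f"] gf z
    by (simp add: singular_relcycle fun_eq_iff)
  ultimately show "singular_relboundary p X (topspace X - K) z" by simp
qed

definition euclidean_chart :: "'a topology \<Rightarrow> 'a set \<Rightarrow> ('a \<Rightarrow> 'e::euclidean_space) \<Rightarrow> bool" where
  "euclidean_chart X U \<phi> \<longleftrightarrow> openin X U \<and> open (\<phi> ` U) \<and>
     homeomorphic_map (subtopology X U) (top_of_set (\<phi> ` U)) \<phi>"

text \<open>The property travels from Euclidean space to the image of the chart, along the chart to
  its domain and from there to X. The set \<open>Q\<close> is kept general so that both
  \<open>Q = K\<close> and \<open>Q = {}\<close> are covered.\<close>

lemma point_detected_chart: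
  fixes \<phi> :: "'a \<Rightarrow> 'e::euclidean_space"
  assumes X: "Hausdorff_space X" and U: "euclidean_chart X U \<phi>"
    and K: "compactin X K" "K \<subseteq> U" and Q: "Q \<subseteq> K"
    and d: "compact (\<phi> ` K) \<Longrightarrow> point_detected p euclidean (\<phi> ` K) (\<phi> ` Q)"
  shows "point_detected p X K Q"
proof -
  have oU: "openin X U" and oW: "open (\<phi> ` U)" and h: "homeomorphic_map (subtopology X U) (top_of_set (\<phi> ` U)) \<phi>"
    using U by (auto simp: euclidean_chart_def)
  have UX: "U \<subseteq> topspace X" using oU openin_subset by blast
  have "compactin (subtopology X U) K" using K by (simp add: compactin_subtopology)
  then have "compactin (top_of_set (\<phi> ` U)) (\<phi> ` K)"
    using h homeomorphic_imp_continuous_map image_compactin by blast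
  then have c: "compact (\<phi> ` K)" by (simp add: compactin_subtopology)
  have "point_detected p (top_of_set (\<phi> ` U)) (\<phi> ` K) (\<phi> ` Q)"
    using point_detected_open_iff[of euclidean "\<phi> ` U" "\<phi> ` K" "\<phi> ` Q" p] d[OF c] oW c K Q
    by (auto simp: compact_imp_closed t1_space_euclidean)
  then have "point_detected p (subtopology X U) K Q"
    by (rule point_detected_homeomorphic[OF h, rotated 2]) (use K Q UX in auto)
  then show ?thesis
    using point_detected_open_iff[OF Hausdorff_imp_t1_space[OF X] oU _ K(2) Q] compactin_imp_closedin[OF X K(1)]
    by blast
qed

text \<open>The type argument records the model space, which the topology alone does not determine
  syntactically.\<close>

definition locally_euclidean :: "'e::euclidean_space itself \<Rightarrow> 'a topology \<Rightarrow> bool" where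
  "locally_euclidean _ X \<longleftrightarrow> (\<forall>x\<in>topspace X. \<exists>U \<phi>. x \<in> U \<and> euclidean_chart X U (\<phi> :: 'a \<Rightarrow> 'e))"

lemma locally_euclidean_vanishes_above:
  assumes X: "Hausdorff_space X" and l: "locally_euclidean TYPE('e::euclidean_space) X"
  shows "local_homology_vanishes_above DIM('e) X"
  unfolding local_homology_vanishes_above_def
proof (intro allI impI ballI)
  fix i x assume i: "DIM('e) < i" and x: "x \<in> topspace X"
  obtain U and \<phi> :: "'a \<Rightarrow> 'e" where U: "x \<in> U" "euclidean_chart X U \<phi>"
    using l x unfolding locally_euclidean_def by blast
  show "point_detected i X {x} {}"
    by (rule point_detected_chart[OF X U(2)])
      (use x U i local_homology_vanishes_above_euclidean in \<open>auto simp: local_homology_vanishes_above_def\<close>)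
qed

lemma chart_compact_neighbourhood:
  assumes "euclidean_chart X U (\<phi> :: 'a \<Rightarrow> 'e::euclidean_space)" "x \<in> U"
  obtains V C where "openin X V" "x \<in> V" "V \<subseteq> C" "C \<subseteq> U" "compactin X C"
proof -
  have oU: "openin X U" and oW: "open (\<phi> ` U)" and h: "homeomorphic_map (subtopology X U) (top_of_set (\<phi> ` U)) \<phi>"
    using assms by (auto simp: euclidean_chart_def)
  have UX: "U \<subseteq> topspace X" using oU openin_subset by blast
  obtain e where e: "e > 0" "cball (\<phi> x) e \<subseteq> \<phi> ` U" using oW assms(2) by (meson imageI open_contains_cball)
  obtain g where g: "homeomorphic_maps (subtopology X U) (top_of_set (\<phi> ` U)) \<phi> g"
    using h homeomorphic_map_maps by blast
  have cg: "continuous_map (top_of_set (\<phi> ` U)) (subtopology X U) g"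
    and gp: "\<And>x. x \<in> U \<Longrightarrow> g (\<phi> x) = x" and pg: "\<And>y. y \<in> \<phi> ` U \<Longrightarrow> \<phi> (g y) = y"
    using g UX by (auto simp: homeomorphic_maps_def)
  show thesis
  proof
    show "openin X (U \<inter> \<phi> -` ball (\<phi> x) e)"
    proof -
      have "openin (subtopology X U) {y \<in> topspace (subtopology X U). \<phi> y \<in> \<phi> ` U \<inter> ball (\<phi> x) e}"
        using openin_continuous_map_preimage[OF homeomorphic_imp_continuous_map[OF h], of "\<phi> ` U \<inter> ball (\<phi> x) e"]
        by (simp add: openin_open_Int)
      moreover have "{y \<in> topspace (subtopology X U). \<phi> y \<in> \<phi> ` U \<inter> ball (\<phi> x) e} = U \<inter> \<phi> -` ball (\<phi> x) e"
        using UX by auto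
      ultimately show ?thesis using oU openin_trans_full by metis
    qed
    show "x \<in> U \<inter> \<phi> -` ball (\<phi> x) e" using assms(2) e by auto
    show "U \<inter> \<phi> -` ball (\<phi> x) e \<subseteq> g ` cball (\<phi> x) e"
    proof clarsimp
      fix y assume y: "y \<in> U" "dist (\<phi> x) (\<phi> y) < e"
      then have "y = g (\<phi> y)" "\<phi> y \<in> cball (\<phi> x) e" using gp by auto
      then show "y \<in> g ` cball (\<phi> x) e" by blast
    qed
    have "compactin (top_of_set (\<phi> ` U)) (cball (\<phi> x) e)" using e by (simp add: compactin_subtopology)
    then have "compactin (subtopology X U) (g ` cball (\<phi> x) e)" by (rule image_compactin[OF _ cg])
    then show "g ` cball (\<phi> x) e \<subseteq> U" "compactin X (g ` cball (\<phi> x) e)"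
      by (auto simp: compactin_subtopology)
  qed
qed

text \<open>\<open>K\<close> is a finite union of compact pieces, each inside a chart domain, and
  the compact sets inside chart domains form an intersection-closed family. In degree
  \<open>DIM('e)\<close> the result is the uniqueness of the fundamental class along
  \<open>K\<close>.\<close>

theorem compactin_imp_locally_determined:
  assumes X: "Hausdorff_space X" and l: "locally_euclidean TYPE('e::euclidean_space) X" and K: "compactin X K"
  shows "locally_determined DIM('e) X K"
proof -
  define \<F> where "\<F> = {K. compactin X K \<and> (\<exists>U \<phi>. K \<subseteq> U \<and> euclidean_chart X U (\<phi> :: 'a \<Rightarrow> 'e))}"
  have "\<exists>V C. openin X V \<and> x \<in> V \<and> V \<subseteq> C \<and> C \<in> \<F>" if "x \<in> K" for x
  proof -
    have "x \<in> topspace X" using that K compactin_subset_topspace by blast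
    then obtain U and \<phi> :: "'a \<Rightarrow> 'e" where U: "x \<in> U" "euclidean_chart X U \<phi>"
      using l unfolding locally_euclidean_def by blast
    show ?thesis
      by (rule chart_compact_neighbourhood[OF U(2,1)]) (use U(2) in \<open>auto simp: \<F>_def\<close>)
  qed
  then obtain V C where V: "\<And>x. x \<in> K \<Longrightarrow> openin X (V x) \<and> x \<in> V x \<and> V x \<subseteq> C x \<and> C x \<in> \<F>"
    by metis
  have "\<exists>\<U>. finite \<U> \<and> \<U> \<subseteq> V ` K \<and> K \<subseteq> \<Union>\<U>"
    using K V unfolding compactin_def by (elim conjE allE[of _ "V ` K"]) blast
  then obtain F where F: "finite F" "F \<subseteq> K" "K \<subseteq> \<Union>(V ` F)"
    by (metis finite_subset_image)
  have inF: "K \<inter> L \<in> \<F>" if "compactin X K" "L \<in> \<F>" for K L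
    using that compact_Int_closedin[OF that(1)] compactin_imp_closedin[OF X] by (auto simp: \<F>_def)
  have "locally_determined DIM('e) X (\<Union>((\<lambda>x. K \<inter> C x) ` F))"
  proof (rule locally_determined_finite_Union[where \<F>=\<F>])
    show "closedin X L" if "L \<in> \<F>" for L using that X by (auto simp: \<F>_def compactin_imp_closedin)
    show "locally_determined DIM('e) X L" if L: "L \<in> \<F>" for L
    proof -
      obtain U and \<phi> :: "'a \<Rightarrow> 'e" where U: "L \<subseteq> U" "euclidean_chart X U \<phi>" "compactin X L"
        using L by (auto simp: \<F>_def)
      show ?thesis unfolding locally_determined_def
        using point_detected_chart[OF X U(2,3,1) order_refl] compact_imp_locally_determined[of "\<phi> ` L"]
        by (auto simp: locally_determined_def)
    qed
    show "L \<inter> L' \<in> \<F>" if "L \<in> \<F>" "L' \<in> \<F>" for L L' using that inF by (auto simp: \<F>_def)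
    show "local_homology_vanishes_above DIM('e) X" by (rule locally_euclidean_vanishes_above[OF X l])
    show "finite ((\<lambda>x. K \<inter> C x) ` F)" using F by simp
    show "(\<lambda>x. K \<inter> C x) ` F \<subseteq> \<F>" using F(2) V inF K by blast
  qed
  moreover have "\<Union>((\<lambda>x. K \<inter> C x) ` F) = K"
  proof (intro subset_antisym subsetI)
    fix x assume x: "x \<in> K"
    then obtain y where "y \<in> F" "x \<in> V y" using F(3) by blast
    then show "x \<in> \<Union>((\<lambda>x. K \<inter> C x) ` F)" using V F(2) x by blast
  qed auto
  ultimately show ?thesis by simp
qed

section \<open>Lifting singular simplices through coverings\<close>

text \<open>Convexity for points of type \<open>nat \<Rightarrow> real\<close>, in which standard
  simplices and \<open>nsphere\<close> are coordinatized.\<close>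

definition fun_convex :: "(nat \<Rightarrow> real) set \<Rightarrow> bool" where
  "fun_convex S \<longleftrightarrow> (\<forall>x\<in>S. \<forall>y\<in>S. \<forall>u. 0 \<le> u \<longrightarrow> u \<le> 1 \<longrightarrow> (\<lambda>i. (1 - u) * x i + u * y i) \<in> S)"

lemma fun_convex_imp_contractible:
  assumes "fun_convex S"
  shows "contractible_space (subtopology (powertop_real UNIV) S)"
proof (cases "S = {}")
  case False
  then obtain a where a: "a \<in> S" by blast
  let ?X = "subtopology (powertop_real UNIV) S"
  define h where "h = (\<lambda>z::real \<times> (nat \<Rightarrow> real). \<lambda>i. (1 - fst z) * snd z i + fst z * a i)"
  have "continuous_map (prod_topology (top_of_set {0..1}) ?X) euclideanreal (\<lambda>z. h z i)" for i
  proof -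
    have 1: "continuous_map (prod_topology (top_of_set {0..1::real}) ?X) euclideanreal fst"
      using continuous_map_fst continuous_map_into_fulltopology by blast
    have "continuous_map (prod_topology (top_of_set {0..1::real}) ?X) (powertop_real UNIV) snd"
      using continuous_map_snd continuous_map_into_fulltopology by blast
    then have 2: "continuous_map (prod_topology (top_of_set {0..1::real}) ?X) euclideanreal (\<lambda>z. snd z i)"
      by (simp add: continuous_map_componentwise_UNIV)
    show ?thesis unfolding h_def
      by (intro continuous_map_add continuous_map_real_mult continuous_map_diff continuous_map_const[THEN iffD2] 1 2) auto
  qed
  then have "continuous_map (prod_topology (top_of_set {0..1}) ?X) (powertop_real UNIV) h"
    by (simp add: continuous_map_componentwise_UNIV)
  moreover have "h \<in> topspace (prod_topology (top_of_set {0..1}) ?X) \<rightarrow> S"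
    using assms a by (auto simp: h_def fun_convex_def)
  ultimately have "continuous_map (prod_topology (top_of_set {0..1}) ?X) ?X h"
    by (simp add: continuous_map_in_subtopology image_subset_iff_funcset)
  moreover have "h (0, x) = x" "h (1, x) = a" for x by (auto simp: h_def)
  ultimately have "homotopic_with (\<lambda>_. True) ?X ?X id (\<lambda>_. a)"
    unfolding homotopic_with_def by (intro exI[of _ h]) auto
  then show ?thesis unfolding contractible_space_def by blast
qed (simp add: contractible_space_empty)

lemma covering_map_evenly_covered:
  assumes "covering_map Y p X" "x \<in> topspace X"
  obtains U \<V> where "x \<in> U" "openin X U" "\<Union>\<V> = {y \<in> topspace Y. p y \<in> U}"
    "\<forall>V\<in>\<V>. openin Y V" "pairwise disjnt \<V>"
    "\<forall>V\<in>\<V>. homeomorphic_map (subtopology Y V) (subtopology X U) p"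
proof -
  have "\<exists>U. x \<in> U \<and> openin X U \<and>
        (\<exists>\<V>. \<Union>\<V> = {y \<in> topspace Y. p y \<in> U} \<and>
             (\<forall>V\<in>\<V>. openin Y V) \<and> pairwise disjnt \<V> \<and>
             (\<forall>V\<in>\<V>. homeomorphic_map (subtopology Y V) (subtopology X U) p))"
    using assms unfolding covering_map_def by (elim conjE bspec)
  then show thesis
    by (elim exE conjE) (rule that; assumption)
qed

lemma covering_map_sheet:
  assumes "covering_map Y p X" "y \<in> topspace Y"
  obtains U V where "openin X U" "p y \<in> U" "openin Y V" "y \<in> V" "p ` V = U" "inj_on p V"
    "homeomorphic_map (subtopology Y V) (subtopology X U) p"
proof -
  have "p y \<in> topspace X" using assms unfolding covering_map_def by blast
  then obtain U \<V> where U: "p y \<in> U" "openin X U" and V: "\<Union>\<V> = {y \<in> topspace Y. p y \<in> U}"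
    "\<forall>V\<in>\<V>. openin Y V" "\<forall>V\<in>\<V>. homeomorphic_map (subtopology Y V) (subtopology X U) p"
    by (rule covering_map_evenly_covered[OF assms(1)]) (rule that; assumption)
  have "y \<in> \<Union>\<V>" unfolding V(1) using assms(2) U(1) by simp
  then obtain V where "V \<in> \<V>" "y \<in> V" by blast
  then have V': "openin Y V" "homeomorphic_map (subtopology Y V) (subtopology X U) p" "y \<in> V"
    using V by blast+
  have "topspace (subtopology Y V) = V" "topspace (subtopology X U) = U"
    using openin_subset[OF V'(1)] openin_subset[OF U(2)] by auto
  then have "p ` V = U" "inj_on p V"
    using homeomorphic_imp_surjective_map[OF V'(2)] homeomorphic_imp_injective_map[OF V'(2)] by auto
  then show thesis using that U V' by blast
qed

lemma covering_map_continuous: "covering_map Y p X \<Longrightarrow> continuous_map Y X p"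
  by (simp add: covering_map_def)

lemma covering_map_disjoint_sheets:
  assumes cov: "covering_map Y p X" and y: "y \<in> topspace Y" "y' \<in> topspace Y" "p y = p y'" "y \<noteq> y'"
  obtains V V' where "openin Y V" "y \<in> V" "openin Y V'" "y' \<in> V'" "V \<inter> V' = {}"
proof -
  have "p y \<in> topspace X" using assms unfolding covering_map_def by blast
  then obtain U \<V> where U: "p y \<in> U" "openin X U" and V: "\<Union>\<V> = {y \<in> topspace Y. p y \<in> U}"
    "\<forall>V\<in>\<V>. openin Y V" "pairwise disjnt \<V>"
    "\<forall>V\<in>\<V>. homeomorphic_map (subtopology Y V) (subtopology X U) p"
    by (rule covering_map_evenly_covered[OF cov]) (rule that; assumption)
  have "y \<in> \<Union>\<V>" "y' \<in> \<Union>\<V>" unfolding V(1) using y U(1) by auto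
  then obtain V V' where VV: "V \<in> \<V>" "y \<in> V" "V' \<in> \<V>" "y' \<in> V'" by blast
  have "inj_on p V"
    using homeomorphic_imp_injective_map[of "subtopology Y V" "subtopology X U" p] V VV openin_subset[of Y V]
    by (simp add: Int_absorb1)
  then have "V \<noteq> V'" using y VV by (metis inj_onD)
  then have "V \<inter> V' = {}" using V(3) VV by (auto simp: pairwise_def disjnt_def)
  then show thesis using that V(2) VV by blast
qed

text \<open>The set where the lifts agree is open because \<open>p\<close> is injective on a sheet;
  the set where they differ is open because distinct points of a fibre lie in disjoint
  sheets.\<close>

lemma lift_unique:
  assumes cov: "covering_map Y p X" and Z: "connected_space Z"
    and f: "continuous_map Z Y f" and g: "continuous_map Z Y g"
    and eq: "\<And>z. z \<in> topspace Z \<Longrightarrow> p (f z) = p (g z)"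
    and z0: "z0 \<in> topspace Z" "f z0 = g z0" and z: "z \<in> topspace Z"
  shows "f z = g z"
proof -
  let ?A = "{z \<in> topspace Z. f z = g z}" and ?B = "{z \<in> topspace Z. f z \<noteq> g z}"
  have "openin Z ?A"
  proof (subst openin_subopen, clarify)
    fix z assume z: "z \<in> topspace Z" "f z = g z"
    have "f z \<in> topspace Y" using continuous_map_image_subset_topspace[OF f] z(1) by blast
    then obtain U V where V: "openin Y V" "f z \<in> V" "inj_on p V"
      using covering_map_sheet[OF cov] by metis
    let ?W = "{z \<in> topspace Z. f z \<in> V} \<inter> {z \<in> topspace Z. g z \<in> V}"
    have "openin Z ?W" using f g V by (intro openin_Int) (auto simp: continuous_map_def)
    moreover have "z \<in> ?W" using z V by auto
    moreover have "?W \<subseteq> ?A" using eq V(3) by (auto simp: inj_on_def)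
    ultimately show "\<exists>T. openin Z T \<and> z \<in> T \<and> T \<subseteq> ?A" by blast
  qed
  moreover have "openin Z ?B"
  proof (subst openin_subopen, clarify)
    fix z assume z: "z \<in> topspace Z" "f z \<noteq> g z"
    have "f z \<in> topspace Y" "g z \<in> topspace Y" using f g z by (auto simp: continuous_map_def)
    then obtain V V' where V: "openin Y V" "f z \<in> V" "openin Y V'" "g z \<in> V'" "V \<inter> V' = {}"
      using covering_map_disjoint_sheets[OF cov _ _ eq[OF z(1)] z(2)] by metis
    let ?W = "{z \<in> topspace Z. f z \<in> V} \<inter> {z \<in> topspace Z. g z \<in> V'}"
    have "openin Z ?W" using f g V by (intro openin_Int) (auto simp: continuous_map_def)
    moreover have "z \<in> ?W" using z V by auto
    moreover have "?W \<subseteq> ?B" using V(5) by auto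
    ultimately show "\<exists>T. openin Z T \<and> z \<in> T \<and> T \<subseteq> ?B" by blast
  qed
  moreover have "?A \<inter> ?B = {}" "topspace Z \<subseteq> ?A \<union> ?B" "?A \<noteq> {}" using z0 by auto
  ultimately have "?B = {}" using Z unfolding connected_space_def by blast
  then show ?thesis using z by blast
qed

text \<open>The value may be prescribed at any point of \<open>Q\<close>: when two halves are glued,
  the lift on the second one has to start on the common slice.\<close>

definition lifts_over :: "'b topology \<Rightarrow> ('b \<Rightarrow> 'a) \<Rightarrow> ((nat \<Rightarrow> real) \<Rightarrow> 'a) \<Rightarrow> (nat \<Rightarrow> real) set \<Rightarrow> bool" where
  "lifts_over Y p \<sigma> Q \<longleftrightarrow> (\<forall>x\<in>Q. \<forall>y\<in>topspace Y. p y = \<sigma> x \<longrightarrow>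
     (\<exists>\<tau>. continuous_map (subtopology (powertop_real UNIV) Q) Y \<tau> \<and> (\<forall>s\<in>Q. p (\<tau> s) = \<sigma> s) \<and> \<tau> x = y))"

text \<open>The slice where the j-th coordinate equals m is convex, hence connected, so two lifts
  that agree at one of its points agree on all of it and can be glued.\<close>

lemma lifts_over_halves:
  assumes cov: "covering_map Y p X" and Q: "fun_convex Q"
    and 1: "lifts_over Y p \<sigma> (Q \<inter> {x. x j \<le> m})" and 2: "lifts_over Y p \<sigma> (Q \<inter> {x. m \<le> x j})"
  shows "lifts_over Y p \<sigma> Q"
proof -
  let ?P = "powertop_real UNIV :: (nat \<Rightarrow> real) topology"
  let ?A = "Q \<inter> {x. x j \<le> m}" and ?B = "Q \<inter> {x. m \<le> x j}"
  have cj: "continuous_map (subtopology ?P Q) euclideanreal (\<lambda>x. x j)"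
    by (intro continuous_map_from_subtopology continuous_map_product_projection) auto
  have "fun_convex (Q \<inter> {x. x j = m})"
    using Q by (auto simp: fun_convex_def algebra_simps)
  then have conn: "connected_space (subtopology ?P (Q \<inter> {x. x j = m}))"
    by (intro contractible_imp_connected_space fun_convex_imp_contractible)
  have glue: "\<exists>\<tau>. continuous_map (subtopology ?P Q) Y \<tau> \<and> (\<forall>s\<in>Q. p (\<tau> s) = \<sigma> s)
     \<and> (\<forall>s\<in>?A. \<tau> s = \<tau>1 s) \<and> (\<forall>s\<in>?B. \<tau> s = \<tau>2 s)"
    if t1: "continuous_map (subtopology ?P ?A) Y \<tau>1" "\<forall>s\<in>?A. p (\<tau>1 s) = \<sigma> s"
      and t2: "continuous_map (subtopology ?P ?B) Y \<tau>2" "\<forall>s\<in>?B. p (\<tau>2 s) = \<sigma> s"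
      and z0: "z0 \<in> Q" "z0 j = m" "\<tau>1 z0 = \<tau>2 z0" for \<tau>1 \<tau>2 z0
  proof -
    have eq: "\<tau>1 s = \<tau>2 s" if s: "s \<in> Q" "s j = m" for s
    proof (rule lift_unique[OF cov conn])
      show "continuous_map (subtopology ?P (Q \<inter> {x. x j = m})) Y \<tau>1"
        by (rule continuous_map_from_subtopology_mono[OF t1(1)]) auto
      show "continuous_map (subtopology ?P (Q \<inter> {x. x j = m})) Y \<tau>2"
        by (rule continuous_map_from_subtopology_mono[OF t2(1)]) auto
    qed (use s z0 t1 t2 in auto)
    have [simp]: "Q \<inter> {x \<in> Q. x j \<le> m} = ?A" "Q \<inter> {x \<in> Q. m \<le> x j} = ?B" by auto
    let ?t = "\<lambda>x. if x j \<le> m then \<tau>1 x else \<tau>2 x"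
    have "continuous_map (subtopology ?P Q) Y ?t"
      by (rule continuous_map_cases_le[OF cj])
        (use t1 t2 eq in \<open>auto simp: subtopology_subtopology\<close>)
    moreover have "\<forall>s\<in>Q. p (?t s) = \<sigma> s" using t1 t2 by auto
    moreover have "\<forall>s\<in>?A. ?t s = \<tau>1 s" "\<forall>s\<in>?B. ?t s = \<tau>2 s" using eq by auto
    ultimately show ?thesis by blast
  qed
  have mid: "\<exists>z. z \<in> Q \<and> z j = m" if x: "x \<in> Q" "x j \<le> m" and y: "y \<in> Q" "m \<le> y j" for x y
  proof (cases "x j = y j")
    case False
    define u where "u = (m - x j) / (y j - x j)"
    have "0 \<le> u" "u \<le> 1" using x y False by (auto simp: u_def field_simps)
    then have "(\<lambda>i. (1 - u) * x i + u * y i) \<in> Q" using Q x y unfolding fun_convex_def by blast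
    moreover have "u * (y j - x j) = m - x j" using False by (simp add: u_def)
    then have "(1 - u) * x j + u * y j = m" by (simp add: algebra_simps)
    ultimately show ?thesis by blast
  qed (use x y in \<open>auto intro!: exI[of _ x]\<close>)
  have tY: "\<tau> z \<in> topspace Y" if "continuous_map (subtopology ?P S) Y \<tau>" "z \<in> S" for \<tau> S z
    using that by (auto simp: continuous_map_def Pi_iff)
  show ?thesis
    unfolding lifts_over_def
  proof (intro ballI impI)
    fix x y assume x: "x \<in> Q" and y: "y \<in> topspace Y" "p y = \<sigma> x"
    \<comment> \<open>The slice may be empty only if one half is everything; otherwise a segment
      between the halves crosses it.\<close>
    consider "?A = Q" | "?B = Q" | a b where "a \<in> Q" "a j \<le> m" "b \<in> Q" "m \<le> b j"
    proof (cases "(\<forall>b\<in>Q. b j \<le> m) \<or> (\<forall>a\<in>Q. m \<le> a j)")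
      case True
      then have "?A = Q \<or> ?B = Q" by auto
      then show thesis using that(1,2) by blast
    next
      case False
      then obtain a b where "b \<in> Q" "\<not> b j \<le> m" "a \<in> Q" "\<not> m \<le> a j" by blast
      then show thesis by (intro that(3)[of a b]) auto
    qed
    then show "\<exists>\<tau>. continuous_map (subtopology ?P Q) Y \<tau> \<and> (\<forall>s\<in>Q. p (\<tau> s) = \<sigma> s) \<and> \<tau> x = y"
    proof cases
      case caseA: 1
      then show ?thesis using 1 x y unfolding lifts_over_def by metis
    next
      case caseB: 2
      then show ?thesis using 2 x y unfolding lifts_over_def by metis
    next
      case 3
      then obtain z where z: "z \<in> Q" "z j = m" using mid by blast
      show ?thesis
      proof (cases "x j \<le> m")
        case True
        then obtain \<tau>1 where t1: "continuous_map (subtopology ?P ?A) Y \<tau>1" "\<forall>s\<in>?A. p (\<tau>1 s) = \<sigma> s" "\<tau>1 x = y"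
          using 1 x y unfolding lifts_over_def by blast
        then obtain \<tau>2 where t2: "continuous_map (subtopology ?P ?B) Y \<tau>2" "\<forall>s\<in>?B. p (\<tau>2 s) = \<sigma> s" "\<tau>2 z = \<tau>1 z"
          using 2 z tY[OF t1(1), of z] unfolding lifts_over_def by (metis Int_iff mem_Collect_eq order_refl)
        then show ?thesis using glue[OF t1(1,2) t2(1,2) z] t1(3) True x by auto
      next
        case False
        then obtain \<tau>2 where t2: "continuous_map (subtopology ?P ?B) Y \<tau>2" "\<forall>s\<in>?B. p (\<tau>2 s) = \<sigma> s" "\<tau>2 x = y"
          using 2 x y unfolding lifts_over_def by (metis Int_iff linear mem_Collect_eq)
        then obtain \<tau>1 where t1: "continuous_map (subtopology ?P ?A) Y \<tau>1" "\<forall>s\<in>?A. p (\<tau>1 s) = \<sigma> s" "\<tau>1 z = \<tau>2 z"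
          using 1 z tY[OF t2(1), of z] unfolding lifts_over_def by (metis Int_iff mem_Collect_eq order_refl)
        then show ?thesis using glue[OF t1(1,2) t2(1,2) z] t2(3) False x by auto
      qed
    qed
  qed
qed

lemma lifts_over_evenly_covered:
  assumes \<sigma>: "continuous_map (subtopology (powertop_real UNIV) Q) X \<sigma>" and im: "\<sigma> ` Q \<subseteq> U"
    and U: "openin X U" and V: "\<Union>\<V> = {y \<in> topspace Y. p y \<in> U}"
    and h: "\<And>V. V \<in> \<V> \<Longrightarrow> homeomorphic_map (subtopology Y V) (subtopology X U) p"
  shows "lifts_over Y p \<sigma> Q"
  unfolding lifts_over_def
proof (intro ballI impI)
  fix x y assume x: "x \<in> Q" and y: "y \<in> topspace Y" "p y = \<sigma> x"
  then obtain V where V': "V \<in> \<V>" "y \<in> V" using V im by blast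
  have VY: "V \<subseteq> topspace Y" using V V' by blast
  have UX: "U \<subseteq> topspace X" using U openin_subset by blast
  obtain g where g: "homeomorphic_maps (subtopology Y V) (subtopology X U) p g"
    using h[OF V'(1)] homeomorphic_map_maps by blast
  have cg: "continuous_map (subtopology X U) (subtopology Y V) g"
    and gp: "\<And>y. y \<in> V \<Longrightarrow> g (p y) = y" and pg: "\<And>x. x \<in> U \<Longrightarrow> p (g x) = x"
    using g VY UX by (auto simp: homeomorphic_maps_def)
  have "continuous_map (subtopology (powertop_real UNIV) Q) (subtopology X U) \<sigma>"
    using \<sigma> im by (auto simp: continuous_map_in_subtopology)
  then have "continuous_map (subtopology (powertop_real UNIV) Q) Y (g \<circ> \<sigma>)"
    using continuous_map_compose cg continuous_map_into_fulltopology by blast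
  moreover have "\<forall>s\<in>Q. p ((g \<circ> \<sigma>) s) = \<sigma> s" using pg im by auto
  moreover have "(g \<circ> \<sigma>) x = y" using gp[OF V'(2)] y by simp
  ultimately show "\<exists>\<tau>. continuous_map (subtopology (powertop_real UNIV) Q) Y \<tau> \<and> (\<forall>s\<in>Q. p (\<tau> s) = \<sigma> s) \<and> \<tau> x = y"
    by blast
qed

definition simplex_box :: "nat \<Rightarrow> (nat \<Rightarrow> real) \<Rightarrow> (nat \<Rightarrow> real) \<Rightarrow> (nat \<Rightarrow> real) set" where
  "simplex_box n l u = {x \<in> standard_simplex n. \<forall>i\<le>n. l i \<le> x i \<and> x i \<le> u i}"

lemma fun_convex_simplex_box: "fun_convex (simplex_box n l u)"
proof -
  have "l i \<le> (1 - t) * x i + t * y i \<and> (1 - t) * x i + t * y i \<le> u i"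
    if "l i \<le> x i" "x i \<le> u i" "l i \<le> y i" "y i \<le> u i" "0 \<le> t" "t \<le> 1" for i x y and t :: real
  proof -
    have "(1 - t) * l i + t * l i \<le> (1 - t) * x i + t * y i"
      using that by (intro add_mono mult_left_mono) auto
    moreover have "(1 - t) * x i + t * y i \<le> (1 - t) * u i + t * u i"
      using that by (intro add_mono mult_left_mono) auto
    ultimately show ?thesis by (simp add: algebra_simps)
  qed
  then show ?thesis
    by (auto simp: fun_convex_def simplex_box_def convex_standard_simplex)
qed

text \<open>Boxes are halved until they are so small that they are mapped into evenly covered sets.\<close>

lemma lifts_over_simplex:
  assumes cov: "covering_map Y p X" and \<sigma>: "singular_simplex n X \<sigma>"
  shows "lifts_over Y p \<sigma> (standard_simplex n)"
proof -
  let ?P = "powertop_real UNIV :: (nat \<Rightarrow> real) topology"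
  have c\<sigma>: "continuous_map (subtopology ?P (standard_simplex n)) X \<sigma>"
    using \<sigma> by (simp add: singular_simplex_def)
  define ev where "ev U \<longleftrightarrow> openin X U \<and> (\<exists>\<V>. \<Union>\<V> = {y \<in> topspace Y. p y \<in> U} \<and>
     (\<forall>V\<in>\<V>. homeomorphic_map (subtopology Y V) (subtopology X U) p))" for U
  define \<C> where "\<C> = {W. openin ?P W \<and> (\<exists>U. ev U \<and> \<sigma> ` (W \<inter> standard_simplex n) \<subseteq> U)}"
  have "standard_simplex n \<subseteq> \<Union>\<C>"
  proof
    fix s assume s: "s \<in> standard_simplex n"
    then have "\<sigma> s \<in> topspace X" using c\<sigma> by (auto simp: continuous_map_def)
    then obtain U where U: "\<sigma> s \<in> U" "ev U"
      by (rule covering_map_evenly_covered[OF cov]) (rule that, assumption, auto simp: ev_def)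
    have "openin (subtopology ?P (standard_simplex n)) {s \<in> standard_simplex n. \<sigma> s \<in> U}"
      using openin_continuous_map_preimage[OF c\<sigma>, of U] U by (simp add: ev_def)
    then obtain W where W: "openin ?P W" "{s \<in> standard_simplex n. \<sigma> s \<in> U} = W \<inter> standard_simplex n"
      unfolding openin_subtopology by blast
    then have "s \<in> W" "\<sigma> ` (W \<inter> standard_simplex n) \<subseteq> U" using s U(1) by blast+
    then show "s \<in> \<Union>\<C>" using W(1) U(2) by (auto simp: \<C>_def)
  qed
  \<comment> \<open>\<open>d\<close> is a Lebesgue number for the open cover of the simplex by sets
    that \<sigma> maps into evenly covered sets.\<close>
  then obtain d where d: "0 < d" "\<And>K. \<lbrakk>K \<subseteq> standard_simplex n;
        \<And>x y i. \<lbrakk>i \<le> n; x \<in> K; y \<in> K\<rbrakk> \<Longrightarrow> \<bar>x i - y i\<bar> \<le> d\<rbrakk> \<Longrightarrow> \<exists>U. U \<in> \<C> \<and> K \<subseteq> U"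
    by (rule llemma) (auto simp: \<C>_def)
  \<comment> \<open>The induction measure counts, for each side of the box, the slabs of width
    \<open>d\<close> that are needed to fill it.\<close>
  have "lifts_over Y p \<sigma> (simplex_box n l u)"
    if "(\<Sum>i\<le>n. nat \<lceil>(u i - l i) / d\<rceil>) = m" for m l u
    using that
  proof (induction m arbitrary: l u rule: less_induct)
    case (less m)
    have sub: "simplex_box n l u \<subseteq> standard_simplex n" by (auto simp: simplex_box_def)
    show ?case
    proof (cases "\<forall>i\<le>n. u i - l i \<le> d")
      case True
      have "\<exists>W. W \<in> \<C> \<and> simplex_box n l u \<subseteq> W"
      proof (rule d(2)[OF sub])
        fix x y i assume i: "i \<le> n" and "x \<in> simplex_box n l u" "y \<in> simplex_box n l u"
        then have "l i \<le> x i" "x i \<le> u i" "l i \<le> y i" "y i \<le> u i" "u i - l i \<le> d"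
          using True by (auto simp: simplex_box_def)
        then show "\<bar>x i - y i\<bar> \<le> d" by linarith
      qed
      then obtain W U where W: "simplex_box n l u \<subseteq> W" "ev U" "\<sigma> ` (W \<inter> standard_simplex n) \<subseteq> U"
        by (auto simp: \<C>_def)
      then have oU: "openin X U" and "\<exists>\<V>. \<Union>\<V> = {y \<in> topspace Y. p y \<in> U} \<and>
          (\<forall>V\<in>\<V>. homeomorphic_map (subtopology Y V) (subtopology X U) p)"
        by (simp_all add: ev_def)
      then obtain \<V> where V: "\<Union>\<V> = {y \<in> topspace Y. p y \<in> U}"
        "\<forall>V\<in>\<V>. homeomorphic_map (subtopology Y V) (subtopology X U) p"
        by (elim exE conjE) (rule that; assumption)
      show ?thesis
        by (rule lifts_over_evenly_covered[OF _ _ oU V(1) bspec[OF V(2)]])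
          (use W sub in \<open>auto intro: continuous_map_from_subtopology_mono[OF c\<sigma>]\<close>)
    next
      case False
      then obtain j where j: "j \<le> n" "u j - l j > d" by force
      \<comment> \<open>The cut is not in the middle: a slab of width exactly \<open>d\<close> is
        removed. Its count in direction \<open>j\<close> is 1, the count of the rest drops by one,
        and before the cut the count was at least 2.\<close>
      define c where "c = l j + d"
      have less': "(\<Sum>i\<le>n. nat \<lceil>(u' i - l' i) / d\<rceil>) < m"
        if e: "\<And>i. i \<noteq> j \<Longrightarrow> u' i - l' i = u i - l i"
          and lt: "nat \<lceil>(u' j - l' j) / d\<rceil> < nat \<lceil>(u j - l j) / d\<rceil>" for u' l'
      proof -
        have "(\<Sum>i\<le>n. nat \<lceil>(u' i - l' i) / d\<rceil>) < (\<Sum>i\<le>n. nat \<lceil>(u i - l i) / d\<rceil>)"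
        proof (rule sum_strict_mono_ex1)
          show "\<forall>i\<in>{..n}. nat \<lceil>(u' i - l' i) / d\<rceil> \<le> nat \<lceil>(u i - l i) / d\<rceil>"
          proof
            fix i show "nat \<lceil>(u' i - l' i) / d\<rceil> \<le> nat \<lceil>(u i - l i) / d\<rceil>"
            proof (cases "i = j")
              case True
              then show ?thesis using less_imp_le[OF lt] by metis
            qed (simp add: e)
          qed
        qed (use j lt in auto)
        then show ?thesis using less.prems by simp
      qed
      have gt1: "(u j - l j) / d > 1" using j d(1) by (simp add: field_simps)
      have 1: "lifts_over Y p \<sigma> (simplex_box n l (u(j := c)))"
      proof (rule less.IH[OF less' refl])
        have "(c - l j) / d = 1" using d(1) by (simp add: c_def)
        then show "nat \<lceil>((u(j := c)) j - l j) / d\<rceil> < nat \<lceil>(u j - l j) / d\<rceil>" using gt1 by simp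
      qed auto
      have 2: "lifts_over Y p \<sigma> (simplex_box n (l(j := c)) u)"
      proof (rule less.IH[OF less' refl])
        have "(u j - c) / d = (u j - l j) / d - 1" using d(1) by (simp add: c_def field_simps)
        then show "nat \<lceil>(u j - (l(j := c)) j) / d\<rceil> < nat \<lceil>(u j - l j) / d\<rceil>" using gt1 by simp
      qed auto
      have c: "l j \<le> c" "c \<le> u j" using j d(1) by (auto simp: c_def)
      have "(\<forall>i\<le>n. l i \<le> x i \<and> x i \<le> (u(j := c)) i) \<longleftrightarrow> (\<forall>i\<le>n. l i \<le> x i \<and> x i \<le> u i) \<and> x j \<le> c"
        (is "?L \<longleftrightarrow> ?R") for x
      proof
        assume L: ?L
        have "x i \<le> u i" if "i \<le> n" for i using L that c(2) by (cases "i = j") (force dest: spec[of _ i])+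
        then show ?R using L j(1) by (auto dest: spec[of _ j])
      qed auto
      moreover have "(\<forall>i\<le>n. (l(j := c)) i \<le> x i \<and> x i \<le> u i) \<longleftrightarrow> (\<forall>i\<le>n. l i \<le> x i \<and> x i \<le> u i) \<and> c \<le> x j"
        (is "?L \<longleftrightarrow> ?R") for x
      proof
        assume L: ?L
        have "l i \<le> x i" if "i \<le> n" for i using L that c(1) by (cases "i = j") (force dest: spec[of _ i])+
        then show ?R using L j(1) by (auto dest: spec[of _ j])
      qed auto
      ultimately have "simplex_box n l (u(j := c)) = simplex_box n l u \<inter> {x. x j \<le> c}"
        "simplex_box n (l(j := c)) u = simplex_box n l u \<inter> {x. c \<le> x j}"
        unfolding simplex_box_def by blast+
      then show ?thesis
        using lifts_over_halves[OF cov fun_convex_simplex_box, of \<sigma> n l u j c] 1 2 by simp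
    qed
  qed
  then have "lifts_over Y p \<sigma> (simplex_box n (\<lambda>_. 0) (\<lambda>_. 1))" by blast
  moreover have "simplex_box n (\<lambda>_. 0) (\<lambda>_. 1) = standard_simplex n"
    by (auto simp: simplex_box_def standard_simplex_def)
  ultimately show ?thesis by simp
qed

section \<open>Lifts of simplices and of their faces\<close>

definition simplex_lifts :: "nat \<Rightarrow> 'b topology \<Rightarrow> ('b \<Rightarrow> 'a) \<Rightarrow> ((nat \<Rightarrow> real) \<Rightarrow> 'a) \<Rightarrow> ((nat \<Rightarrow> real) \<Rightarrow> 'b) set" where
  "simplex_lifts n Y p \<sigma> = {\<tau>. singular_simplex n Y \<tau> \<and> simplex_map n p \<tau> = \<sigma>}"

lemma simplex_lift_exists:
  assumes "covering_map Y p X" "singular_simplex n X \<sigma>" "s \<in> standard_simplex n" "y \<in> topspace Y" "p y = \<sigma> s"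
  obtains \<tau> where "\<tau> \<in> simplex_lifts n Y p \<sigma>" "\<tau> s = y"
proof -
  obtain \<tau> where t: "continuous_map (subtopology (powertop_real UNIV) (standard_simplex n)) Y \<tau>"
     "\<forall>s\<in>standard_simplex n. p (\<tau> s) = \<sigma> s" "\<tau> s = y"
    using lifts_over_simplex[OF assms(1,2)] assms(3-5) unfolding lifts_over_def by blast
  show thesis
  proof
    have "continuous_map (subtopology (powertop_real UNIV) (standard_simplex n)) Y (restrict \<tau> (standard_simplex n))"
      by (rule continuous_map_eq[OF t(1)]) auto
    moreover have "restrict (p \<circ> restrict \<tau> (standard_simplex n)) (standard_simplex n) = \<sigma>"
      using t(2) assms(2) by (auto simp: singular_simplex_def fun_eq_iff extensional_def)
    ultimately show "restrict \<tau> (standard_simplex n) \<in> simplex_lifts n Y p \<sigma>"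
      by (simp add: simplex_lifts_def singular_simplex_def simplex_map_def)
    show "restrict \<tau> (standard_simplex n) s = y" using t(3) assms(3) by simp
  qed
qed

lemma simplex_lift_unique:
  assumes cov: "covering_map Y p X" and t: "\<tau> \<in> simplex_lifts n Y p \<sigma>" "\<tau>' \<in> simplex_lifts n Y p \<sigma>"
    and s: "s \<in> standard_simplex n" "\<tau> s = \<tau>' s"
  shows "\<tau> = \<tau>'"
proof
  fix x
  let ?Z = "subtopology (powertop_real UNIV) (standard_simplex n)"
  have st: "singular_simplex n Y \<tau>" "singular_simplex n Y \<tau>'" and eq: "simplex_map n p \<tau> = simplex_map n p \<tau>'"
    using t by (auto simp: simplex_lifts_def)
  show "\<tau> x = \<tau>' x"
  proof (cases "x \<in> standard_simplex n")
    case True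
    show ?thesis
    proof (rule lift_unique[OF cov, of ?Z])
      show "connected_space ?Z" using connectedin_standard_simplex by (simp add: connectedin_def)
      show "p (\<tau> z) = p (\<tau>' z)" if "z \<in> topspace ?Z" for z
        using that fun_cong[OF eq, of z] by (simp add: simplex_map_def)
    qed (use st s True in \<open>auto simp: singular_simplex_def\<close>)
  next
    case False
    then show ?thesis using st by (auto simp: singular_simplex_def extensional_def)
  qed
qed

lemma singular_face_lift:
  assumes "\<tau> \<in> simplex_lifts n Y p \<sigma>" "n \<noteq> 0" "k \<le> n"
  shows "singular_face n k \<tau> \<in> simplex_lifts (n - 1) Y p (singular_face n k \<sigma>)"
proof -
  have t: "singular_simplex n Y \<tau>" "\<sigma> = simplex_map n p \<tau>" using assms(1) by (auto simp: simplex_lifts_def)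
  have "simplex_map (n - 1) p (singular_face n k \<tau>) = singular_face n k \<sigma>"
    unfolding t(2) using assms by (subst singular_face_simplex_map) (auto simp: simplex_map_def singular_face_def fun_eq_iff)
  then show ?thesis
    using singular_simplex_singular_face[OF t(1), of k] assms by (auto simp: simplex_lifts_def)
qed

text \<open>A lift is determined by its value at a single point, which may be taken on the face;
  conversely a lift of the face prescribes such a value. This bijection is the reason why the
  transfer is compatible with boundaries.\<close>

lemma bij_betw_singular_face_lifts:
  assumes cov: "covering_map Y p X" and \<sigma>: "singular_simplex n X \<sigma>" and n: "n \<noteq> 0" "k \<le> n"
  shows "bij_betw (singular_face n k) (simplex_lifts n Y p \<sigma>) (simplex_lifts (n - 1) Y p (singular_face n k \<sigma>))"
  unfolding bij_betw_def
proof (intro conjI inj_onI equalityI subsetI)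
  obtain v where v: "v \<in> standard_simplex (n - 1)" using nonempty_standard_simplex by blast
  have fv: "simplical_face k v \<in> standard_simplex n"
    using simplical_face_in_standard_simplex[of n k v] v n by auto
  have face: "singular_face n k f v = f (simplical_face k v)" for f :: "(nat \<Rightarrow> real) \<Rightarrow> 'c"
    using v by (simp add: singular_face_def)
  show "\<tau> = \<tau>'" if "\<tau> \<in> simplex_lifts n Y p \<sigma>" "\<tau>' \<in> simplex_lifts n Y p \<sigma>"
    "singular_face n k \<tau> = singular_face n k \<tau>'" for \<tau> \<tau>'
    using simplex_lift_unique[OF cov that(1,2) fv] face that(3) by metis
  show "\<rho> \<in> simplex_lifts (n - 1) Y p (singular_face n k \<sigma>)"
    if "\<rho> \<in> singular_face n k ` simplex_lifts n Y p \<sigma>" for \<rho>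
    using that singular_face_lift n by blast
  fix \<rho> assume r: "\<rho> \<in> simplex_lifts (n - 1) Y p (singular_face n k \<sigma>)"
  have "\<rho> v \<in> topspace Y"
    using r v by (auto simp: simplex_lifts_def singular_simplex_def continuous_map_def)
  moreover have "p (\<rho> v) = \<sigma> (simplical_face k v)"
  proof -
    have "simplex_map (n - 1) p \<rho> v = singular_face n k \<sigma> v" using r by (auto simp: simplex_lifts_def)
    then show ?thesis using v face by (simp add: simplex_map_def)
  qed
  ultimately obtain \<tau> where t: "\<tau> \<in> simplex_lifts n Y p \<sigma>" "\<tau> (simplical_face k v) = \<rho> v"
    using simplex_lift_exists[OF cov \<sigma> fv] by metis
  have "singular_face n k \<tau> = \<rho>"
    by (rule simplex_lift_unique[OF cov singular_face_lift[OF t(1) n] r v]) (simp add: face t)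
  then show "\<rho> \<in> singular_face n k ` simplex_lifts n Y p \<sigma>" using t(1) by blast
qed

section \<open>Principal bundles and the transfer\<close>

lemma principal_bundleD:
  assumes "principal_bundle G act Y p X"
  shows "covering_map Y p X" "group_action G (topspace Y) act"
    "\<And>g. g \<in> carrier G \<Longrightarrow> continuous_map Y Y (act g)"
    "\<And>g y. g \<in> carrier G \<Longrightarrow> y \<in> topspace Y \<Longrightarrow> p (act g y) = p y"
    "\<And>y y'. y \<in> topspace Y \<Longrightarrow> y' \<in> topspace Y \<Longrightarrow> p y = p y' \<Longrightarrow> \<exists>!g. g \<in> carrier G \<and> act g y = y'"
    "\<And>g y. g \<in> carrier G \<Longrightarrow> y \<in> topspace Y \<Longrightarrow> act g y \<in> topspace Y"
proof -
  show ga: "group_action G (topspace Y) act" using assms by (simp add: principal_bundle_def)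
  show "\<And>g y. g \<in> carrier G \<Longrightarrow> y \<in> topspace Y \<Longrightarrow> act g y \<in> topspace Y"
    using group_action.element_image[OF ga] by blast
qed (use assms in \<open>auto simp: principal_bundle_def\<close>)

text \<open>Points over different points of X are separated by preimages of disjoint open sets, and
  no translate meets both. Points of one fibre are translates of each other by a unique element, and
  on a small sheet only that element contributes.\<close>

lemma principal_bundle_locally_proper:
  assumes pb: "principal_bundle G act Y p X" and X: "Hausdorff_space X"
    and x: "x \<in> topspace Y" and y: "y \<in> topspace Y"
  obtains U V where "openin Y U" "x \<in> U" "openin Y V" "y \<in> V"
    "finite {g \<in> carrier G. act g ` U \<inter> V \<noteq> {}}"
proof (cases "p x = p y")
  case False
  note D = principal_bundleD[OF pb]
  have cp: "continuous_map Y X p" using D(1) by (rule covering_map_continuous)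
  have "p x \<in> topspace X" "p y \<in> topspace X"
    using x y continuous_map_image_subset_topspace[OF cp] by auto
  then obtain A B where AB: "openin X A" "openin X B" "p x \<in> A" "p y \<in> B" "disjnt A B"
    using X False unfolding Hausdorff_space_def by metis
  let ?U = "{z \<in> topspace Y. p z \<in> A}" and ?V = "{z \<in> topspace Y. p z \<in> B}"
  have "{g \<in> carrier G. act g ` ?U \<inter> ?V \<noteq> {}} = {}"
    using AB(5) D(4) by (fastforce simp: disjnt_def)
  then have fin: "finite {g \<in> carrier G. act g ` ?U \<inter> ?V \<noteq> {}}" by (metis finite.emptyI)
  have "openin Y ?U" "openin Y ?V" using AB cp openin_continuous_map_preimage by blast+
  then show thesis using that[OF _ _ _ _ fin] x y AB by simp
next
  case True
  note D = principal_bundleD[OF pb]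
  interpret group_action G "topspace Y" act by (rule D(2))
  obtain h where h: "h \<in> carrier G" "act h x = y" using D(5)[OF x y True] by blast
  obtain U where U: "openin Y U" "x \<in> U" "inj_on p U"
    using covering_map_sheet[OF D(1) x] by metis
  have UY: "U \<subseteq> topspace Y" using U openin_subset by blast
  have grp: "group G" using group_hom by (simp add: group_hom_def)
  have hi: "inv\<^bsub>G\<^esub> h \<in> carrier G" by (rule group.inv_closed[OF grp h(1)])
  \<comment> \<open>This is the translate of U by \<open>h\<close>. If g u lies in it, then u and
    its translate by h^{-1} g are points of U in one fibre, hence equal, and
    \<open>g = h\<close>.\<close>
  let ?V = "{z \<in> topspace Y. act (inv\<^bsub>G\<^esub> h) z \<in> U}"
  have "openin Y ?V" using D(3)[OF hi] U(1) openin_continuous_map_preimage by blast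
  moreover have "y \<in> ?V" using orbit_sym_aux[OF h(1) x h(2)] U(2) y by simp
  moreover have sub: "{g \<in> carrier G. act g ` U \<inter> ?V \<noteq> {}} \<subseteq> {h}"
  proof (intro subsetI, rule ccontr)
    fix g assume "g \<in> {g \<in> carrier G. act g ` U \<inter> ?V \<noteq> {}}" "g \<notin> {h}"
    then obtain u where g: "g \<in> carrier G" "g \<noteq> h" and
      u: "u \<in> U" "act g u \<in> topspace Y" "act (inv\<^bsub>G\<^esub> h) (act g u) \<in> U" by blast
    have uY: "u \<in> topspace Y" using u UY by blast
    have "p (act (inv\<^bsub>G\<^esub> h) (act g u)) = p u" using D(4) hi g u uY by simp
    then have eq: "act (inv\<^bsub>G\<^esub> h) (act g u) = u" using U(3) u by (auto simp: inj_on_def)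
    have "act (inv\<^bsub>G\<^esub> (inv\<^bsub>G\<^esub> h)) u = act g u" by (rule orbit_sym_aux[OF hi u(2) eq])
    then have "act h u = act g u" using group.inv_inv[OF grp h(1)] by simp
    moreover have "\<exists>!k. k \<in> carrier G \<and> act k u = act g u"
      using D(5)[OF uY u(2)] D(4)[OF g(1) uY] by simp
    ultimately show False using g h(1) by blast
  qed
  ultimately show thesis using that[OF U(1,2) _ _ finite_subset[OF sub]] by blast
qed

text \<open>Compactness is used twice: a cover of K for each fixed x yields a neighbourhood of x
  that works for all of K, and finitely many of these neighbourhoods cover L.\<close>

lemma principal_bundle_proper:
  assumes pb: "principal_bundle G act Y p X" and X: "Hausdorff_space X"
    and L: "compactin Y L" and K: "compactin Y K"
  shows "finite {g \<in> carrier G. act g ` L \<inter> K \<noteq> {}}"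
proof -
  have LY: "L \<subseteq> topspace Y" and KY: "K \<subseteq> topspace Y" using L K compactin_subset_topspace by blast+
  define R where "R x U \<longleftrightarrow> openin Y U \<and> x \<in> U \<and> finite {g \<in> carrier G. act g ` U \<inter> K \<noteq> {}}" for x U
  have "\<exists>U. R x U" if x: "x \<in> L" for x
  proof -
    define P where "P y U V \<longleftrightarrow> openin Y U \<and> x \<in> U \<and> openin Y V \<and> y \<in> V \<and>
      finite {g \<in> carrier G. act g ` U \<inter> V \<noteq> {}}" for y U V
    have "\<exists>U V. P y U V" if "y \<in> K" for y
    proof -
      have xy: "x \<in> topspace Y" "y \<in> topspace Y" using x that LY KY by auto
      show ?thesis unfolding P_def by (rule principal_bundle_locally_proper[OF pb X xy]) blast
    qed
    then obtain U V where "\<And>y. y \<in> K \<Longrightarrow> P y (U y) (V y)" by metis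
    then have UV: "\<And>y. y \<in> K \<Longrightarrow> openin Y (U y) \<and> x \<in> U y \<and> openin Y (V y) \<and> y \<in> V y \<and>
      finite {g \<in> carrier G. act g ` U y \<inter> V y \<noteq> {}}" unfolding P_def .
    have "\<exists>\<F>. finite \<F> \<and> \<F> \<subseteq> V ` K \<and> K \<subseteq> \<Union>\<F>"
      using K UV unfolding compactin_def by (elim conjE allE[of _ "V ` K"]) blast
    then obtain F where F: "finite F" "F \<subseteq> K" "K \<subseteq> \<Union>(V ` F)"
      by (metis finite_subset_image)
    \<comment> \<open>The factor \<open>topspace Y\<close> makes this an open set also when K, and
      with it F, is empty.\<close>
    define W where "W = topspace Y \<inter> (\<Inter>y\<in>F. U y)"
    have "openin Y W" unfolding W_def
    proof (cases "F = {}")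
      case False
      then have "openin Y (\<Inter>(U ` F))" using F UV by (intro openin_Inter) auto
      then show "openin Y (topspace Y \<inter> (\<Inter>y\<in>F. U y))" by blast
    qed simp
    moreover have "x \<in> W" using F UV x LY by (auto simp: W_def)
    moreover have "{g \<in> carrier G. act g ` W \<inter> K \<noteq> {}} \<subseteq> (\<Union>y\<in>F. {g \<in> carrier G. act g ` U y \<inter> V y \<noteq> {}})"
      using F(3) by (fastforce simp: W_def)
    then have "finite {g \<in> carrier G. act g ` W \<inter> K \<noteq> {}}"
      by (rule finite_subset) (use F UV in auto)
    ultimately show ?thesis unfolding R_def by blast
  qed
  then obtain U where "\<And>x. x \<in> L \<Longrightarrow> R x (U x)" by metis
  then have U: "\<And>x. x \<in> L \<Longrightarrow> openin Y (U x) \<and> x \<in> U x \<and> finite {g \<in> carrier G. act g ` U x \<inter> K \<noteq> {}}"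
    unfolding R_def .
  have "\<exists>\<F>. finite \<F> \<and> \<F> \<subseteq> U ` L \<and> L \<subseteq> \<Union>\<F>"
    using L U unfolding compactin_def by (elim conjE allE[of _ "U ` L"]) blast
  then obtain F where F: "finite F" "F \<subseteq> L" "L \<subseteq> \<Union>(U ` F)"
    by (metis finite_subset_image)
  have "{g \<in> carrier G. act g ` L \<inter> K \<noteq> {}} \<subseteq> (\<Union>x\<in>F. {g \<in> carrier G. act g ` U x \<inter> K \<noteq> {}})"
    using F(3) by fastforce
  then show ?thesis by (rule finite_subset) (use F U in auto)
qed

text \<open>A fibre is a single orbit and a lift is determined by one value. So a bound that is
  uniform over translates has to be checked only for one lift of each simplex.\<close>

lemma simplex_lifts_orbit:
  assumes pb: "principal_bundle G act Y p X" and t: "\<tau> \<in> simplex_lifts n Y p \<sigma>"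
  shows "simplex_lifts n Y p \<sigma> = (\<lambda>g. simplex_map n (act g) \<tau>) ` carrier G"
proof (intro equalityI subsetI)
  note D = principal_bundleD[OF pb]
  have st: "singular_simplex n Y \<tau>" "simplex_map n p \<tau> = \<sigma>" using t by (auto simp: simplex_lifts_def)
  have tY: "\<tau> s \<in> topspace Y" if "s \<in> standard_simplex n" for s
    using st that by (auto simp: singular_simplex_def continuous_map_def)
  have move: "simplex_map n (act g) \<tau> \<in> simplex_lifts n Y p \<sigma>" if g: "g \<in> carrier G" for g
  proof -
    have "simplex_map n p (simplex_map n (act g) \<tau>) = simplex_map n p \<tau>"
      using tY D(4)[OF g] by (auto simp: simplex_map_def fun_eq_iff)
    then show ?thesis using singular_simplex_simplex_map[OF st(1) D(3)[OF g]] st(2) by (simp add: simplex_lifts_def)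
  qed
  then show "\<rho> \<in> simplex_lifts n Y p \<sigma>" if "\<rho> \<in> (\<lambda>g. simplex_map n (act g) \<tau>) ` carrier G" for \<rho>
    using that by blast
  fix \<rho> assume r: "\<rho> \<in> simplex_lifts n Y p \<sigma>"
  obtain v where v: "v \<in> standard_simplex n" using nonempty_standard_simplex by blast
  have rv: "\<rho> v \<in> topspace Y"
    using r v by (auto simp: simplex_lifts_def singular_simplex_def continuous_map_def)
  have "simplex_map n p \<tau> v = simplex_map n p \<rho> v" using r t by (simp add: simplex_lifts_def)
  then have "p (\<tau> v) = p (\<rho> v)" using v by (simp add: simplex_map_def)
  then obtain g where g: "g \<in> carrier G" "act g (\<tau> v) = \<rho> v" using D(5)[OF tY[OF v] rv] by blast
  have "simplex_map n (act g) \<tau> = \<rho>"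
    by (rule simplex_lift_unique[OF D(1) move[OF g(1)] r v]) (use g v in \<open>simp add: simplex_map_def\<close>)
  then show "\<rho> \<in> (\<lambda>g. simplex_map n (act g) \<tau>) ` carrier G" using g by blast
qed

text \<open>The image of one lift is compact and the other lifts are its translates, so properness
  of the action bounds their number.\<close>

lemma finite_lifts_meeting_compact:
  assumes pb: "principal_bundle G act Y p X" and X: "Hausdorff_space X" and K: "compactin Y K"
  shows "finite {\<tau> \<in> simplex_lifts n Y p \<sigma>. \<tau> ` standard_simplex n \<inter> K \<noteq> {}}"
proof (cases "simplex_lifts n Y p \<sigma> = {}")
  case False
  then obtain \<tau> where t: "\<tau> \<in> simplex_lifts n Y p \<sigma>" by blast
  have "singular_chain n Y (frag_of \<tau>)" using t by (simp add: singular_chain_of simplex_lifts_def)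
  then have L: "compactin Y (\<tau> ` standard_simplex n)"
    using compactin_chain_support[of n Y "frag_of \<tau>"] by (simp add: chain_support_def)
  have "{\<tau> \<in> simplex_lifts n Y p \<sigma>. \<tau> ` standard_simplex n \<inter> K \<noteq> {}} \<subseteq>
     (\<lambda>g. simplex_map n (act g) \<tau>) ` {g \<in> carrier G. act g ` (\<tau> ` standard_simplex n) \<inter> K \<noteq> {}}"
  proof
    fix \<rho> assume "\<rho> \<in> {\<tau> \<in> simplex_lifts n Y p \<sigma>. \<tau> ` standard_simplex n \<inter> K \<noteq> {}}"
    then obtain s where r: "\<rho> \<in> simplex_lifts n Y p \<sigma>" and s: "s \<in> standard_simplex n" "\<rho> s \<in> K"
      by blast
    then obtain g where g: "g \<in> carrier G" "\<rho> = simplex_map n (act g) \<tau>"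
      using simplex_lifts_orbit[OF pb t] by blast
    then have "act g (\<tau> s) \<in> K" using s by (simp add: simplex_map_def)
    then show "\<rho> \<in> (\<lambda>g. simplex_map n (act g) \<tau>) ` {g \<in> carrier G. act g ` (\<tau> ` standard_simplex n) \<inter> K \<noteq> {}}"
      using g s by blast
  qed
  then show ?thesis
    by (rule finite_subset) (intro finite_imageI principal_bundle_proper[OF pb X L K])
qed simp

text \<open>
  The predicate \<open>T\<close> truncates the sum over all lifts of a simplex, which may be infinite. The transfer
  is a chain map only modulo simplices that violate \<open>T\<close>, provided that a simplex satisfies \<open>T\<close> as soon as
  one of its faces does.
\<close>

definition transfer :: "nat \<Rightarrow> 'b topology \<Rightarrow> ('b \<Rightarrow> 'a) \<Rightarrow> (((nat \<Rightarrow> real) \<Rightarrow> 'b) \<Rightarrow> bool) \<Rightarrow> 'a chain \<Rightarrow> 'b chain" where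
  "transfer n Y p T = frag_extend (\<lambda>\<sigma>. \<Sum>\<tau>\<in>{\<tau> \<in> simplex_lifts n Y p \<sigma>. T \<tau>}. frag_of \<tau>)"

lemma transfer_of: "transfer n Y p T (frag_of \<sigma>) = (\<Sum>\<tau>\<in>{\<tau> \<in> simplex_lifts n Y p \<sigma>. T \<tau>}. frag_of \<tau>)"
  by (simp add: transfer_def)

lemma transfer_0 [simp]: "transfer n Y p T 0 = 0"
  by (simp add: transfer_def)

lemma transfer_diff: "transfer n Y p T (a - b) = transfer n Y p T a - transfer n Y p T b"
  by (simp add: transfer_def frag_extend_diff)

lemma transfer_add: "transfer n Y p T (a + b) = transfer n Y p T a + transfer n Y p T b"
  by (simp add: transfer_def frag_extend_add)

lemma transfer_cmul: "transfer n Y p T (frag_cmul k a) = frag_cmul k (transfer n Y p T a)"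
  by (simp add: transfer_def frag_extend_cmul)

lemma transfer_sum: "finite I \<Longrightarrow> transfer n Y p T (\<Sum>i\<in>I. f i) = (\<Sum>i\<in>I. transfer n Y p T (f i))"
  by (simp add: transfer_def frag_extend_sum comp_def)

lemma keys_sum_frag_of: "Poly_Mapping.keys (\<Sum>x\<in>A. frag_of (f x)) \<subseteq> f ` A"
  by (rule order_trans[OF keys_sum]) auto

lemma keys_transfer: "Poly_Mapping.keys (transfer n Y p T c) \<subseteq> {\<tau>. singular_simplex n Y \<tau> \<and> T \<tau>}"
  unfolding transfer_def
  by (rule order_trans[OF keys_frag_extend], rule UN_least, rule order_trans[OF keys_sum_frag_of])
    (auto simp: simplex_lifts_def)

lemma singular_chain_transfer: "singular_chain n Y (transfer n Y p T c)"
  using keys_transfer unfolding singular_chain_def by blast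

lemma keys_diff_sum_frag_of:
  assumes "finite A" "finite B"
  shows "Poly_Mapping.keys ((\<Sum>x\<in>A. frag_of x) - (\<Sum>x\<in>B. frag_of x)) \<subseteq> (A - B) \<union> (B - A)"
proof -
  have "(\<Sum>x\<in>A. frag_of x) = (\<Sum>x\<in>A - B. frag_of x) + (\<Sum>x\<in>A \<inter> B. frag_of x)"
    using assms by (metis sum.Int_Diff add.commute)
  moreover have "(\<Sum>x\<in>B. frag_of x) = (\<Sum>x\<in>B - A. frag_of x) + (\<Sum>x\<in>A \<inter> B. frag_of x)"
    using assms by (metis sum.Int_Diff add.commute Int_commute)
  ultimately have "(\<Sum>x\<in>A. frag_of x) - (\<Sum>x\<in>B. frag_of x) = (\<Sum>x\<in>A - B. frag_of x) - (\<Sum>x\<in>B - A. frag_of x)"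
    by simp
  then show ?thesis
    using keys_diff[of "\<Sum>x\<in>A - B. frag_of x" "\<Sum>x\<in>B - A. frag_of x"]
      keys_sum_frag_of[of "\<lambda>x. x" "A - B"] keys_sum_frag_of[of "\<lambda>x. x" "B - A"] by auto
qed

lemma keys_diff_trans:
  fixes a b :: "'a \<Rightarrow>\<^sub>0 int"
  assumes "Poly_Mapping.keys a \<subseteq> S" "Poly_Mapping.keys b \<subseteq> S"
  shows "Poly_Mapping.keys (a - b) \<subseteq> S"
  using assms keys_diff[of a b] by blast

text \<open>Lifts that satisfy both truncation predicates cancel. The finiteness premises matter: a
  sum over an infinite set is 0 by convention, and the truncations could then not be
  compared.\<close>

lemma keys_transfer_diff_subset:
  assumes c: "singular_chain n X c"
    and fin: "\<And>\<sigma>. singular_simplex n X \<sigma> \<Longrightarrow> finite {\<tau> \<in> simplex_lifts n Y p \<sigma>. T \<tau>}"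
      "\<And>\<sigma>. singular_simplex n X \<sigma> \<Longrightarrow> finite {\<tau> \<in> simplex_lifts n Y p \<sigma>. T' \<tau>}"
  shows "Poly_Mapping.keys (transfer n Y p T c - transfer n Y p T' c)
     \<subseteq> {\<tau>. singular_simplex n Y \<tau> \<and> T \<tau> \<noteq> T' \<tau>}"
  using c unfolding singular_chain_def
proof (induction c rule: frag_induction)
  case (one \<sigma>)
  then have "singular_simplex n X \<sigma>" by simp
  from keys_diff_sum_frag_of[OF fin[OF this]] show ?case
    unfolding transfer_of by (rule order_trans) (auto simp: simplex_lifts_def)
next
  case (diff a b)
  have "transfer n Y p T (a - b) - transfer n Y p T' (a - b) =
     (transfer n Y p T a - transfer n Y p T' a) - (transfer n Y p T b - transfer n Y p T' b)"
    by (simp add: transfer_diff)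
  then show ?case using keys_diff_trans[OF diff] by simp
qed auto

text \<open>For each index k the faces of the selected lifts of a simplex are lifts of its k-th
  face, without repetition. By \<open>up\<close> they include all the selected ones, so the error
  consists of faces that violate \<open>T\<close> although the simplex satisfies it.\<close>

lemma keys_transfer_boundary:
  assumes cov: "covering_map Y p X" and c: "singular_chain n X c" and n: "n \<noteq> 0"
    and fin: "\<And>m \<sigma>. singular_simplex m X \<sigma> \<Longrightarrow> finite {\<tau> \<in> simplex_lifts m Y p \<sigma>. T m \<tau>}"
    and up: "\<And>\<tau> k. singular_simplex n Y \<tau> \<Longrightarrow> k \<le> n \<Longrightarrow> T (n - 1) (singular_face n k \<tau>) \<Longrightarrow> T n \<tau>"
  shows "Poly_Mapping.keys (chain_boundary n (transfer n Y p (T n) c) - transfer (n - 1) Y p (T (n - 1)) (chain_boundary n c))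
     \<subseteq> {\<rho>. singular_simplex (n - 1) Y \<rho> \<and> \<not> T (n - 1) \<rho>}"
  using c unfolding singular_chain_def
proof (induction c rule: frag_induction)
  case (one \<sigma>)
  then have \<sigma>: "singular_simplex n X \<sigma>" by simp
  let ?L = "simplex_lifts n Y p \<sigma>"
  let ?A = "{\<tau> \<in> ?L. T n \<tau>}"
  have finA: "finite ?A" using fin \<sigma> by blast
  define D where "D k = (\<Sum>\<tau>\<in>?A. frag_of (singular_face n k \<tau>))
      - (\<Sum>\<rho>\<in>{\<rho> \<in> simplex_lifts (n - 1) Y p (singular_face n k \<sigma>). T (n - 1) \<rho>}. frag_of \<rho>)" for k
  have "chain_boundary n (transfer n Y p (T n) (frag_of \<sigma>)) =
     (\<Sum>\<tau>\<in>?A. \<Sum>k\<le>n. frag_cmul ((-1) ^ k) (frag_of (singular_face n k \<tau>)))"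
    unfolding transfer_of chain_boundary_sum by (simp add: chain_boundary_of n)
  also have "\<dots> = (\<Sum>k\<le>n. frag_cmul ((-1) ^ k) (\<Sum>\<tau>\<in>?A. frag_of (singular_face n k \<tau>)))"
    by (subst sum.swap) (simp add: frag_cmul_sum)
  finally have 1: "chain_boundary n (transfer n Y p (T n) (frag_of \<sigma>)) =
     (\<Sum>k\<le>n. frag_cmul ((-1) ^ k) (\<Sum>\<tau>\<in>?A. frag_of (singular_face n k \<tau>)))" .
  have 2: "transfer (n - 1) Y p (T (n - 1)) (chain_boundary n (frag_of \<sigma>)) =
     (\<Sum>k\<le>n. frag_cmul ((-1) ^ k) (\<Sum>\<rho>\<in>{\<rho> \<in> simplex_lifts (n - 1) Y p (singular_face n k \<sigma>). T (n - 1) \<rho>}. frag_of \<rho>))"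
    by (simp add: chain_boundary_of n transfer_sum transfer_cmul transfer_of)
  have 3: "chain_boundary n (transfer n Y p (T n) (frag_of \<sigma>)) - transfer (n - 1) Y p (T (n - 1)) (chain_boundary n (frag_of \<sigma>))
     = (\<Sum>k\<le>n. frag_cmul ((-1) ^ k) (D k))"
    unfolding 1 2 D_def sum_subtractf[symmetric]
    by (rule sum.cong[OF refl]) (metis (no_types, lifting) add_diff_cancel_right' diff_add_cancel frag_cmul_distrib2)
  have "Poly_Mapping.keys (D k) \<subseteq> {\<rho>. singular_simplex (n - 1) Y \<rho> \<and> \<not> T (n - 1) \<rho>}" if k: "k \<le> n" for k
  proof -
    have bij: "bij_betw (singular_face n k) ?L (simplex_lifts (n - 1) Y p (singular_face n k \<sigma>))"
      by (rule bij_betw_singular_face_lifts[OF cov \<sigma> n k])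
    then have inj: "inj_on (singular_face n k) ?A"
      using inj_on_subset[of "singular_face n k" ?L ?A] by (auto simp: bij_betw_def)
    have Leq: "singular_face n k ` ?L = simplex_lifts (n - 1) Y p (singular_face n k \<sigma>)"
      using bij by (simp add: bij_betw_def)
    \<comment> \<open>A selected lift of the face extends to a lift of the simplex, which is
      selected by \<open>up\<close>; hence the difference of the two sums is a sum over a difference
      of sets.\<close>
    have sub: "{\<rho> \<in> simplex_lifts (n - 1) Y p (singular_face n k \<sigma>). T (n - 1) \<rho>} \<subseteq> singular_face n k ` ?A"
      using up k unfolding Leq[symmetric] by (auto simp: simplex_lifts_def)
    have "D k = (\<Sum>\<rho>\<in>singular_face n k ` ?A. frag_of \<rho>)
      - (\<Sum>\<rho>\<in>{\<rho> \<in> simplex_lifts (n - 1) Y p (singular_face n k \<sigma>). T (n - 1) \<rho>}. frag_of \<rho>)"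
      unfolding D_def by (simp add: sum.reindex[OF inj])
    also have "\<dots> = (\<Sum>\<rho>\<in>singular_face n k ` ?A - {\<rho> \<in> simplex_lifts (n - 1) Y p (singular_face n k \<sigma>). T (n - 1) \<rho>}. frag_of \<rho>)"
      using sub finA by (simp add: sum_diff)
    finally have Dk: "D k = (\<Sum>\<rho>\<in>singular_face n k ` ?A - {\<rho> \<in> simplex_lifts (n - 1) Y p (singular_face n k \<sigma>). T (n - 1) \<rho>}. frag_of \<rho>)"
      (is "_ = (\<Sum>\<rho>\<in>?R. _)") .
    have "Poly_Mapping.keys (D k) \<subseteq> ?R"
      unfolding Dk using keys_sum_frag_of[of "\<lambda>x. x" ?R] by simp
    also have "\<dots> \<subseteq> {\<rho>. singular_simplex (n - 1) Y \<rho> \<and> \<not> T (n - 1) \<rho>}"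
      using Leq by (auto simp: simplex_lifts_def)
    finally show ?thesis .
  qed
  then have "Poly_Mapping.keys (\<Sum>k\<le>n. frag_cmul ((-1) ^ k) (D k)) \<subseteq> {\<rho>. singular_simplex (n - 1) Y \<rho> \<and> \<not> T (n - 1) \<rho>}"
    by (intro order_trans[OF keys_sum] UN_least order_trans[OF keys_cmul]) auto
  then show ?case unfolding 3 .
next
  case (diff a b)
  have "chain_boundary n (transfer n Y p (T n) (a - b)) - transfer (n - 1) Y p (T (n - 1)) (chain_boundary n (a - b)) =
     (chain_boundary n (transfer n Y p (T n) a) - transfer (n - 1) Y p (T (n - 1)) (chain_boundary n a))
     - (chain_boundary n (transfer n Y p (T n) b) - transfer (n - 1) Y p (T (n - 1)) (chain_boundary n b))"
    by (simp add: transfer_diff chain_boundary_diff)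
  then show ?case using keys_diff_trans[OF diff] by simp
qed auto

lemma singular_chain_avoiding:
  assumes "Poly_Mapping.keys c \<subseteq> {\<tau>. singular_simplex n Y \<tau> \<and> \<tau> ` standard_simplex n \<inter> K = {}}"
  shows "singular_chain n (subtopology Y (topspace Y - K)) c"
  unfolding singular_chain_def
proof
    fix \<tau> assume "\<tau> \<in> Poly_Mapping.keys c"
    then have t: "singular_simplex n Y \<tau>" "\<tau> ` standard_simplex n \<inter> K = {}" using assms by auto
    then have "\<tau> ` standard_simplex n \<subseteq> topspace Y"
      by (auto simp: singular_simplex_def continuous_map_def)
    then show "\<tau> \<in> singular_simplex_set n (subtopology Y (topspace Y - K))"
      using t by (auto simp: singular_simplex_subtopology)
qed

definition meets :: "'b set \<Rightarrow> nat \<Rightarrow> ((nat \<Rightarrow> real) \<Rightarrow> 'b) \<Rightarrow> bool" where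
  "meets K m \<tau> \<longleftrightarrow> \<tau> ` standard_simplex m \<inter> K \<noteq> {}"

lemma meets_face:
  assumes "n \<noteq> 0" "k \<le> n" "meets K (n - 1) (singular_face n k \<tau>)"
  shows "meets K n \<tau>"
  using assms simplical_face_in_standard_simplex[of n k] by (fastforce simp: meets_def singular_face_def)

lemma transfer_meets_boundary:
  assumes pb: "principal_bundle G act Y p X" and X: "Hausdorff_space X" and K: "compactin Y K"
    and c: "singular_chain n X c" and n: "n \<noteq> 0"
  shows "singular_chain (n - 1) (subtopology Y (topspace Y - K))
    (chain_boundary n (transfer n Y p (meets K n) c) - transfer (n - 1) Y p (meets K (n - 1)) (chain_boundary n c))"
proof (rule singular_chain_avoiding)
  show "Poly_Mapping.keys (chain_boundary n (transfer n Y p (meets K n) c) - transfer (n - 1) Y p (meets K (n - 1)) (chain_boundary n c))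
    \<subseteq> {\<tau>. singular_simplex (n - 1) Y \<tau> \<and> \<tau> ` standard_simplex (n - 1) \<inter> K = {}}"
  proof (rule order_trans[OF keys_transfer_boundary[where T="meets K", OF principal_bundleD(1)[OF pb] c n]])
    show "finite {\<tau> \<in> simplex_lifts m Y p \<sigma>. meets K m \<tau>}" for m \<sigma>
      unfolding meets_def by (rule finite_lifts_meeting_compact[OF pb X K])
    show "meets K n \<tau>" if "k \<le> n" "meets K (n - 1) (singular_face n k \<tau>)" for \<tau> k
      using meets_face[OF n that] .
  qed (auto simp: meets_def)
qed

lemma relcycle_transfer_meets:
  assumes pb: "principal_bundle G act Y p X" and X: "Hausdorff_space X" and K: "compactin Y K"
    and z: "singular_relcycle n X {} z" and n: "n \<noteq> 0"
  shows "singular_relcycle n Y (topspace Y - K) (transfer n Y p (meets K n) z)"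
  using transfer_meets_boundary[OF pb X K _ n, of z] z singular_chain_transfer
  by (simp add: singular_relcycle singular_cycle singular_chain_empty)

text \<open>Since \<open>p\<close> is injective on V, a lift of the image of a simplex in V that
  passes through y meets that simplex at y and therefore equals it. So near y the transfer inverts
  the chain map of \<open>p\<close>.\<close>

lemma transfer_through_point_section:
  assumes cov: "covering_map Y p X"
    and V: "openin Y V" "y \<in> V" "inj_on p V" and b: "singular_chain m (subtopology Y V) b"
  shows "singular_chain m (subtopology Y (topspace Y - {y})) (transfer m Y p (meets {y} m) (chain_map m p b) - b)"
proof (rule singular_chain_avoiding)
  show "Poly_Mapping.keys (transfer m Y p (meets {y} m) (chain_map m p b) - b)
    \<subseteq> {\<tau>. singular_simplex m Y \<tau> \<and> \<tau> ` standard_simplex m \<inter> {y} = {}}" (is "_ \<subseteq> ?N")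
    using b unfolding singular_chain_def
  proof (induction b rule: frag_induction)
    case (one \<beta>)
    then have \<beta>: "singular_simplex m Y \<beta>" "\<beta> ` standard_simplex m \<subseteq> V"
      by (auto simp: singular_simplex_subtopology)
    have through: "\<exists>s\<in>standard_simplex m. \<tau> s = y \<and> \<beta> s = y"
      if t: "\<tau> \<in> simplex_lifts m Y p (simplex_map m p \<beta>)" "meets {y} m \<tau>" for \<tau>
    proof -
      obtain s where s: "s \<in> standard_simplex m" "\<tau> s = y" using t(2) by (auto simp: meets_def)
      have "simplex_map m p \<tau> s = simplex_map m p \<beta> s" using t(1) by (simp add: simplex_lifts_def)
      then have "p y = p (\<beta> s)" using s by (simp add: simplex_map_def)
      then have "\<beta> s = y" using V \<beta>(2) s(1) by (metis image_subset_iff inj_onD)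
      then show ?thesis using s by blast
    qed
    show ?case
    proof (cases "meets {y} m \<beta>")
      case False
      then have empty: "{\<tau> \<in> simplex_lifts m Y p (simplex_map m p \<beta>). meets {y} m \<tau>} = {}"
        using through by (fastforce simp: meets_def)
      have eq: "transfer m Y p (meets {y} m) (chain_map m p (frag_of \<beta>)) = 0"
        unfolding chain_map_of transfer_of empty by simp
      have "Poly_Mapping.keys (frag_of \<beta>) \<subseteq> ?N" using \<beta>(1) False by (auto simp: meets_def)
      then show ?thesis unfolding eq by (simp add: keys_minus)
    next
      case True
      have \<beta>l: "\<beta> \<in> simplex_lifts m Y p (simplex_map m p \<beta>)" using \<beta>(1) by (simp add: simplex_lifts_def)
      have "\<tau> = \<beta>" if t: "\<tau> \<in> simplex_lifts m Y p (simplex_map m p \<beta>)" "meets {y} m \<tau>" for \<tau>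
        using through[OF t] simplex_lift_unique[OF cov t(1) \<beta>l] by metis
      then have single: "{\<tau> \<in> simplex_lifts m Y p (simplex_map m p \<beta>). meets {y} m \<tau>} = {\<beta>}"
        using \<beta>l True by blast
      have "transfer m Y p (meets {y} m) (chain_map m p (frag_of \<beta>)) = frag_of \<beta>"
        unfolding chain_map_of transfer_of single by simp
      then show ?thesis by simp
    qed
  next
    case (diff a b)
    have eq: "transfer m Y p (meets {y} m) (chain_map m p (a - b)) - (a - b) =
      (transfer m Y p (meets {y} m) (chain_map m p a) - a) - (transfer m Y p (meets {y} m) (chain_map m p b) - b)"
      by (simp add: transfer_diff chain_map_diff)
    show ?case unfolding eq by (rule keys_diff_trans[OF diff])
  qed auto
qed


text \<open>At a point y of K only lifts through y matter, so the truncation by K may be replaced by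
  that by {y}. The latter is a chain map modulo simplices that miss y, and on chains coming from the
  sheet V it is inverse to \<open>p\<close>.\<close>

lemma transfer_local:
  assumes pb: "principal_bundle G act Y p X" and X: "Hausdorff_space X" and K: "compactin Y K"
    and n: "n \<noteq> 0" and y: "y \<in> K" and V: "openin Y V" "y \<in> V" "inj_on p V"
    and b: "singular_chain n (subtopology Y V) b" and z: "singular_chain n X z"
    and eq: "homologous_rel n X (topspace X - {p y}) z (chain_map n p b)"
  shows "homologous_rel n Y (topspace Y - {y}) (transfer n Y p (meets K n) z) b"
proof -
  note D = principal_bundleD[OF pb]
  let ?t = "\<lambda>m. transfer m Y p (meets {y} m)"
  let ?C = "\<lambda>m. singular_chain m (subtopology Y (topspace Y - {y}))"
  have yY: "y \<in> topspace Y" using V openin_subset by blast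
  have Ky: "compactin Y {y}" using yY by simp
  have fin: "finite {\<tau> \<in> simplex_lifts m Y p \<sigma>. meets K' m \<tau>}" if "compactin Y K'" for K' m \<sigma>
    using finite_lifts_meeting_compact[OF pb X that] by (simp add: meets_def)
  obtain u a where u: "singular_chain (Suc n) X u" and a: "singular_chain n (subtopology X (topspace X - {p y})) a"
    and ua: "chain_boundary (Suc n) u + a = z - chain_map n p b"
    using eq unfolding homologous_rel_def singular_relboundary by blast
  have 1: "?C n (transfer n Y p (meets K n) z - ?t n z)"
  proof (rule singular_chain_avoiding)
    show "Poly_Mapping.keys (transfer n Y p (meets K n) z - ?t n z)
      \<subseteq> {\<tau>. singular_simplex n Y \<tau> \<and> \<tau> ` standard_simplex n \<inter> {y} = {}}"
      by (rule order_trans[OF keys_transfer_diff_subset[OF z fin[OF K] fin[OF Ky]]]) (use y in \<open>auto simp: meets_def\<close>)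
  qed
  have 2: "?C n (?t n (chain_map n p b) - b)"
    by (rule transfer_through_point_section[OF D(1) V b])
  \<comment> \<open>The simplices of \<open>a\<close> miss the point \<open>p y\<close>, so none of
    their lifts passes through y.\<close>
  have 3: "?t n a = 0"
    unfolding transfer_def
  proof (rule frag_extend_eq_0)
    fix \<sigma> assume "\<sigma> \<in> Poly_Mapping.keys a"
    then have s: "\<sigma> ` standard_simplex n \<subseteq> topspace X - {p y}"
      using a unfolding singular_chain_subtopology by blast
    have "\<not> meets {y} n \<tau>" if "\<tau> \<in> simplex_lifts n Y p \<sigma>" for \<tau>
    proof
      assume "meets {y} n \<tau>"
      then obtain x where x: "x \<in> standard_simplex n" "\<tau> x = y" by (auto simp: meets_def)
      then have "\<sigma> x = p y" using that by (auto simp: simplex_lifts_def simplex_map_def)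
      then show False using s x by blast
    qed
    then have "{\<tau> \<in> simplex_lifts n Y p \<sigma>. meets {y} n \<tau>} = {}" by blast
    then show "(\<Sum>\<tau>\<in>{\<tau> \<in> simplex_lifts n Y p \<sigma>. meets {y} n \<tau>}. frag_of \<tau>) = 0" by (metis sum.empty)
  qed
  have 4: "?C n (chain_boundary (Suc n) (?t (Suc n) u) - ?t n (chain_boundary (Suc n) u))"
    using transfer_meets_boundary[OF pb X Ky u] by simp
  have "?t n (chain_boundary (Suc n) u) = ?t n z - ?t n (chain_map n p b)"
    using arg_cong[OF ua, of "?t n"] 3 by (simp add: transfer_add transfer_diff)
  then have "transfer n Y p (meets K n) z - b = chain_boundary (Suc n) (?t (Suc n) u)
     + ((transfer n Y p (meets K n) z - ?t n z) + (?t n (chain_map n p b) - b)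
     - (chain_boundary (Suc n) (?t (Suc n) u) - ?t n (chain_boundary (Suc n) u)))"
    by (simp add: algebra_simps)
  moreover have "?C n ((transfer n Y p (meets K n) z - ?t n z) + (?t n (chain_map n p b) - b)
     - (chain_boundary (Suc n) (?t (Suc n) u) - ?t n (chain_boundary (Suc n) u)))"
    by (intro singular_chain_diff singular_chain_add 1 2 4)
  ultimately show ?thesis
    unfolding homologous_rel_def singular_relboundary using singular_chain_transfer by metis
qed

section \<open>Acyclic carriers\<close>

lemma frag_cmul_diff_right: "frag_cmul k (a - b) = frag_cmul k a - frag_cmul k b"
  by (metis add_diff_cancel_right' diff_add_cancel frag_cmul_distrib2)

text \<open>More general than \<open>chain_map\<close>: straightening is defined simplex by simplex
  from the vertices and is not composition with a map of spaces.\<close>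

definition chain_of_simplex_map :: "(((nat \<Rightarrow> real) \<Rightarrow> 'a) \<Rightarrow> ((nat \<Rightarrow> real) \<Rightarrow> 'b)) \<Rightarrow> 'a chain \<Rightarrow> 'b chain" where
  "chain_of_simplex_map F = frag_extend (\<lambda>\<tau>. frag_of (F \<tau>))"

lemma chain_of_simplex_map_of [simp]: "chain_of_simplex_map F (frag_of \<tau>) = frag_of (F \<tau>)"
  by (simp add: chain_of_simplex_map_def)

lemma chain_of_simplex_map_0 [simp]: "chain_of_simplex_map F 0 = 0"
  by (simp add: chain_of_simplex_map_def)

lemma chain_of_simplex_map_diff: "chain_of_simplex_map F (a - b) = chain_of_simplex_map F a - chain_of_simplex_map F b"
  by (simp add: chain_of_simplex_map_def frag_extend_diff)

lemma chain_of_simplex_map_cmul: "chain_of_simplex_map F (frag_cmul k a) = frag_cmul k (chain_of_simplex_map F a)"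
  by (simp add: chain_of_simplex_map_def frag_extend_cmul)

lemma chain_map_eq_chain_of_simplex_map: "chain_map m f = chain_of_simplex_map (simplex_map m f)"
  by (simp add: fun_eq_iff chain_map_def chain_of_simplex_map_def comp_def)

lemma singular_chain_chain_of_simplex_map:
  assumes "\<And>\<tau>. \<tau> \<in> Poly_Mapping.keys c \<Longrightarrow> singular_simplex m X (F \<tau>)"
  shows "singular_chain m X (chain_of_simplex_map F c)"
  unfolding chain_of_simplex_map_def using assms
  by (intro singular_chain_extend) (simp add: singular_chain_of)

lemma chain_boundary_of_eq:
  "m \<noteq> 0 \<Longrightarrow> chain_boundary m (frag_of \<tau>) = (\<Sum>k\<le>m. frag_cmul ((-1) ^ k) (frag_of (singular_face m k \<tau>)))"
  by (simp add: chain_boundary_of)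

lemma chain_boundary_chain_of_simplex_map:
  assumes "m \<noteq> 0" and c: "Poly_Mapping.keys c \<subseteq> S"
    and F: "\<And>\<tau> k. \<tau> \<in> S \<Longrightarrow> k \<le> m \<Longrightarrow> F' (singular_face m k \<tau>) = singular_face m k (F \<tau>)"
  shows "chain_boundary m (chain_of_simplex_map F c) = chain_of_simplex_map F' (chain_boundary m c)"
  using c
proof (induction c rule: frag_induction)
  case (one \<tau>)
  then show ?case using F assms(1)
    by (simp add: chain_boundary_of_eq chain_of_simplex_map_def frag_extend_sum comp_def frag_extend_cmul)
qed (simp_all add: chain_boundary_diff chain_of_simplex_map_diff)

text \<open>The setting of the acyclic carrier theorem for two simplexwise maps \<open>F\<close> and
  \<open>G\<close> that commute with faces and share contractible carriers \<open>N\<close>. The set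
  \<S> collects the simplices that possess carriers; that they are singular simplices ensures that
  the boundary of a boundary is zero.\<close>

locale acyclic_carriers =
  fixes T :: "'b topology"
    and \<S> :: "nat \<Rightarrow> ((nat \<Rightarrow> real) \<Rightarrow> 'a) set"
    and N :: "nat \<Rightarrow> ((nat \<Rightarrow> real) \<Rightarrow> 'a) \<Rightarrow> 'b set"
    and F G :: "nat \<Rightarrow> ((nat \<Rightarrow> real) \<Rightarrow> 'a) \<Rightarrow> ((nat \<Rightarrow> real) \<Rightarrow> 'b)"
  assumes simplices: "\<And>m \<tau>. \<tau> \<in> \<S> m \<Longrightarrow> \<exists>X. singular_simplex m X \<tau>"
    and face: "\<And>m \<tau> k. \<tau> \<in> \<S> (Suc m) \<Longrightarrow> k \<le> Suc m \<Longrightarrow> singular_face (Suc m) k \<tau> \<in> \<S> m"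
    and carrier_face: "\<And>m \<tau> k. \<tau> \<in> \<S> (Suc m) \<Longrightarrow> k \<le> Suc m \<Longrightarrow> N m (singular_face (Suc m) k \<tau>) \<subseteq> N (Suc m) \<tau>"
    and contractible: "\<And>m \<tau>. \<tau> \<in> \<S> m \<Longrightarrow> contractible_space (subtopology T (N m \<tau>))"
    and F: "\<And>m \<tau>. \<tau> \<in> \<S> m \<Longrightarrow> singular_simplex m (subtopology T (N m \<tau>)) (F m \<tau>)"
    and G: "\<And>m \<tau>. \<tau> \<in> \<S> m \<Longrightarrow> singular_simplex m (subtopology T (N m \<tau>)) (G m \<tau>)"
    and F_face: "\<And>m \<tau> k. \<tau> \<in> \<S> (Suc m) \<Longrightarrow> k \<le> Suc m \<Longrightarrow> F m (singular_face (Suc m) k \<tau>) = singular_face (Suc m) k (F (Suc m) \<tau>)"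
    and G_face: "\<And>m \<tau> k. \<tau> \<in> \<S> (Suc m) \<Longrightarrow> k \<le> Suc m \<Longrightarrow> G m (singular_face (Suc m) k \<tau>) = singular_face (Suc m) k (G (Suc m) \<tau>)"
begin

abbreviation "FC m \<equiv> chain_of_simplex_map (F m)"
abbreviation "GC m \<equiv> chain_of_simplex_map (G m)"

lemma keys_boundary_faces:
  "Poly_Mapping.keys (chain_boundary (Suc m) (frag_of \<tau>)) \<subseteq> (\<lambda>k. singular_face (Suc m) k \<tau>) ` {..Suc m}"
  unfolding chain_boundary_of_eq[OF nat.simps(3)]
  by (rule order_trans[OF keys_sum], rule UN_least, rule order_trans[OF keys_cmul]) auto

text \<open>The homotopy is built degree by degree: once it exists on the faces of a simplex, G - F
  - D \<partial> is a cycle in the contractible carrier of that simplex and bounds there.\<close>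

lemma homotopy_exists:
  "\<exists>D. \<forall>m. (\<forall>\<tau>\<in>\<S> m. singular_chain (Suc m) (subtopology T (N m \<tau>)) (D m \<tau>)) \<and>
     (\<forall>\<tau>\<in>\<S> (Suc m). chain_boundary (Suc (Suc m)) (D (Suc m) \<tau>) =
        frag_of (G (Suc m) \<tau>) - frag_of (F (Suc m) \<tau>) - frag_extend (D m) (chain_boundary (Suc m) (frag_of \<tau>)))"
proof -
  \<comment> \<open>The second clause says that the chain to be filled in the next degree is a
    cycle. It is the invariant that lets the dependent choice continue; \<open>Q\<close> links
    consecutive choices.\<close>
  define P where "P m D \<longleftrightarrow> (\<forall>\<tau>\<in>\<S> m. singular_chain (Suc m) (subtopology T (N m \<tau>)) (D \<tau>)) \<and>
     (\<forall>\<tau>\<in>\<S> (Suc m). chain_boundary (Suc m) (frag_extend D (chain_boundary (Suc m) (frag_of \<tau>))) =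
        chain_boundary (Suc m) (frag_of (G (Suc m) \<tau>)) - chain_boundary (Suc m) (frag_of (F (Suc m) \<tau>)))" for m D
  define Q where "Q m D D' \<longleftrightarrow> (\<forall>\<tau>\<in>\<S> (Suc m). chain_boundary (Suc (Suc m)) (D' \<tau>) =
        frag_of (G (Suc m) \<tau>) - frag_of (F (Suc m) \<tau>) - frag_extend D (chain_boundary (Suc m) (frag_of \<tau>)))" for m D D'
  have bd_ext: "chain_boundary (Suc m) (frag_extend D (chain_boundary (Suc m) (frag_of \<tau>))) =
      frag_extend (\<lambda>\<rho>. chain_boundary (Suc m) (D \<rho>)) (chain_boundary (Suc m) (frag_of \<tau>))" for m D \<tau>
    by (simp add: frag_extend_def chain_boundary_sum comp_def chain_boundary_cmul)
  have ext_bd: "frag_extend (\<lambda>\<rho>. frag_extend D (chain_boundary m (frag_of \<rho>))) b = frag_extend D (chain_boundary m b)"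
    for m b and D :: "_ \<Rightarrow> 'b chain"
    using subset_UNIV[of "Poly_Mapping.keys b"]
    by (induction b rule: frag_induction) (auto simp: frag_extend_diff chain_boundary_diff)
  have FGb: "frag_extend (\<lambda>\<rho>. frag_of (G m \<rho>) - frag_of (F m \<rho>)) (chain_boundary (Suc m) (frag_of \<tau>)) =
      chain_boundary (Suc m) (frag_of (G (Suc m) \<tau>)) - chain_boundary (Suc m) (frag_of (F (Suc m) \<tau>))"
    if t: "\<tau> \<in> \<S> (Suc m)" for m \<tau>
    using F_face[OF t] G_face[OF t]
    by (simp add: chain_boundary_of_eq frag_extend_sum comp_def frag_extend_cmul sum_subtractf[symmetric] frag_cmul_diff_right
      del: sum.atMost_Suc)
  have "\<exists>D. \<forall>m. P m (D m) \<and> Q m (D m) (D (Suc m))"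
  proof (rule dependent_nat_choice)
    \<comment> \<open>In degree 0 every chain is a cycle, and path-connectedness of the carrier
      takes the place of vanishing homology.\<close>
    have "\<exists>d. singular_chain 1 (subtopology T (N 0 \<tau>)) d \<and> chain_boundary 1 d = frag_of (G 0 \<tau>) - frag_of (F 0 \<tau>)"
      if t: "\<tau> \<in> \<S> 0" for \<tau>
      using iso_integer_zeroth_homology_group_aux[OF contractible_imp_path_connected_space[OF contractible[OF t]] G[OF t] F[OF t]]
      by (simp add: homologous_rel_def singular_boundary)
    then obtain D where D: "\<And>\<tau>. \<tau> \<in> \<S> 0 \<Longrightarrow> singular_chain 1 (subtopology T (N 0 \<tau>)) (D \<tau>)"
       "\<And>\<tau>. \<tau> \<in> \<S> 0 \<Longrightarrow> chain_boundary 1 (D \<tau>) = frag_of (G 0 \<tau>) - frag_of (F 0 \<tau>)" by metis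
    have "chain_boundary (Suc 0) (frag_extend D (chain_boundary (Suc 0) (frag_of \<tau>))) =
        chain_boundary (Suc 0) (frag_of (G (Suc 0) \<tau>)) - chain_boundary (Suc 0) (frag_of (F (Suc 0) \<tau>))" if t: "\<tau> \<in> \<S> (Suc 0)" for \<tau>
      unfolding bd_ext FGb[OF t, symmetric]
      by (rule frag_extend_eq) (use keys_boundary_faces[of 0 \<tau>] face[OF t] D(2) in force)
    then show "\<exists>D. P 0 D" unfolding P_def using D(1) by auto
  next
    fix D m assume P: "P m D"
    have "\<exists>d. singular_chain (Suc (Suc m)) (subtopology T (N (Suc m) \<tau>)) d \<and> chain_boundary (Suc (Suc m)) d =
        frag_of (G (Suc m) \<tau>) - frag_of (F (Suc m) \<tau>) - frag_extend D (chain_boundary (Suc m) (frag_of \<tau>))"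
      if t: "\<tau> \<in> \<S> (Suc m)" for \<tau>
    proof -
      have "singular_chain (Suc m) (subtopology T (N (Suc m) \<tau>)) (frag_extend D (chain_boundary (Suc m) (frag_of \<tau>)))"
      proof (rule singular_chain_extend)
        fix \<rho> assume "\<rho> \<in> Poly_Mapping.keys (chain_boundary (Suc m) (frag_of \<tau>))"
        then obtain k where k: "k \<le> Suc m" "\<rho> = singular_face (Suc m) k \<tau>" using keys_boundary_faces by blast
        then have "singular_chain (Suc m) (subtopology T (N m \<rho>)) (D \<rho>)" using P face[OF t] by (simp add: P_def)
        then show "singular_chain (Suc m) (subtopology T (N (Suc m) \<tau>)) (D \<rho>)"
          using carrier_face[OF t k(1)] k(2) singular_chain_mono by blast
      qed
      then have "singular_relcycle (Suc m) (subtopology T (N (Suc m) \<tau>)) {}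
         (frag_of (G (Suc m) \<tau>) - frag_of (F (Suc m) \<tau>) - frag_extend D (chain_boundary (Suc m) (frag_of \<tau>)))"
        using P t F[OF t] G[OF t] unfolding singular_cycle P_def
        by (auto simp: chain_boundary_diff singular_chain_of intro!: singular_chain_diff)
      then show ?thesis
        using contractible_cycle_imp_boundary[OF contractible[OF t]] by (simp add: singular_boundary)
    qed
    then obtain D' where D': "\<And>\<tau>. \<tau> \<in> \<S> (Suc m) \<Longrightarrow> singular_chain (Suc (Suc m)) (subtopology T (N (Suc m) \<tau>)) (D' \<tau>)"
      and bD': "\<And>\<tau>. \<tau> \<in> \<S> (Suc m) \<Longrightarrow> chain_boundary (Suc (Suc m)) (D' \<tau>) =
        frag_of (G (Suc m) \<tau>) - frag_of (F (Suc m) \<tau>) - frag_extend D (chain_boundary (Suc m) (frag_of \<tau>))" by metis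
    have "chain_boundary (Suc (Suc m)) (frag_extend D' (chain_boundary (Suc (Suc m)) (frag_of \<tau>))) =
        chain_boundary (Suc (Suc m)) (frag_of (G (Suc (Suc m)) \<tau>)) - chain_boundary (Suc (Suc m)) (frag_of (F (Suc (Suc m)) \<tau>))"
      if t: "\<tau> \<in> \<S> (Suc (Suc m))" for \<tau>
    proof -
      let ?b = "chain_boundary (Suc (Suc m)) (frag_of \<tau>)"
      obtain X where "singular_simplex (Suc (Suc m)) X \<tau>" using simplices[OF t] by blast
      \<comment> \<open>The boundary of the boundary vanishes, which removes the term that involves
        the previous stage \<open>D\<close> and yields the invariant for the next degree.\<close>
      then have bb: "chain_boundary (Suc m) ?b = 0"
        using chain_boundary_boundary_alt[of "Suc m" X "frag_of \<tau>"] by (simp add: singular_chain_of)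
      have "frag_extend (\<lambda>\<rho>. chain_boundary (Suc (Suc m)) (D' \<rho>)) ?b =
        frag_extend (\<lambda>\<rho>. (frag_of (G (Suc m) \<rho>) - frag_of (F (Suc m) \<rho>)) - frag_extend D (chain_boundary (Suc m) (frag_of \<rho>))) ?b"
        by (rule frag_extend_eq) (use keys_boundary_faces[of "Suc m" \<tau>] face[OF t] bD' in force)
      also have "\<dots> = frag_extend (\<lambda>\<rho>. frag_of (G (Suc m) \<rho>) - frag_of (F (Suc m) \<rho>)) ?b
          - frag_extend (\<lambda>\<rho>. frag_extend D (chain_boundary (Suc m) (frag_of \<rho>))) ?b"
        by (simp add: frag_extend_def frag_cmul_diff_right sum_subtractf)
      also have "frag_extend (\<lambda>\<rho>. frag_extend D (chain_boundary (Suc m) (frag_of \<rho>))) ?b = frag_extend D (chain_boundary (Suc m) ?b)"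
        by (rule ext_bd)
      finally show ?thesis unfolding bd_ext FGb[OF t] bb by simp
    qed
    then have "P (Suc m) D'" unfolding P_def using D' by blast
    moreover have "Q m D D'" unfolding Q_def using bD' by blast
    ultimately show "\<exists>D'. P (Suc m) D' \<and> Q m D D'" by blast
  qed
  then obtain D where "\<And>m. P m (D m)" "\<And>m. Q m (D m) (D (Suc m))" by blast
  then show ?thesis unfolding P_def Q_def by (intro exI[of _ D]) blast
qed

text \<open>
  The homotopy on \<open>\<tau>\<close> stays in \<open>N \<tau>\<close>, so it contributes nothing modulo \<open>A\<close> on the part of the boundary
  whose carriers lie in \<open>A\<close>.
\<close>

theorem simplex_maps_homologous:
  assumes c: "Poly_Mapping.keys c \<subseteq> \<S> (Suc m)"
    and bc: "Poly_Mapping.keys (chain_boundary (Suc m) c) \<subseteq> {\<rho> \<in> \<S> m. N m \<rho> \<subseteq> A}"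
  shows "homologous_rel (Suc m) T A (GC (Suc m) c) (FC (Suc m) c)"
proof -
  obtain D where D: "\<And>m \<tau>. \<tau> \<in> \<S> m \<Longrightarrow> singular_chain (Suc m) (subtopology T (N m \<tau>)) (D m \<tau>)"
     and bD: "\<And>m \<tau>. \<tau> \<in> \<S> (Suc m) \<Longrightarrow> chain_boundary (Suc (Suc m)) (D (Suc m) \<tau>) =
        frag_of (G (Suc m) \<tau>) - frag_of (F (Suc m) \<tau>) - frag_extend (D m) (chain_boundary (Suc m) (frag_of \<tau>))"
    using homotopy_exists by blast
  have eq: "chain_boundary (Suc (Suc m)) (frag_extend (D (Suc m)) c) =
     GC (Suc m) c - FC (Suc m) c - frag_extend (D m) (chain_boundary (Suc m) c)"
    using c by (induction c rule: frag_induction)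
      (auto simp: bD frag_extend_diff chain_boundary_diff chain_of_simplex_map_diff)
  have "singular_chain (Suc (Suc m)) T (frag_extend (D (Suc m)) c)"
    by (rule singular_chain_extend) (use D c in \<open>auto simp: singular_chain_subtopology\<close>)
  moreover have "singular_chain (Suc m) (subtopology T A) (frag_extend (D m) (chain_boundary (Suc m) c))"
  proof (rule singular_chain_extend)
    fix \<rho> assume "\<rho> \<in> Poly_Mapping.keys (chain_boundary (Suc m) c)"
    then have "\<rho> \<in> \<S> m" "N m \<rho> \<subseteq> A" using bc by auto
    then show "singular_chain (Suc m) (subtopology T A) (D m \<rho>)" using D singular_chain_mono by blast
  qed
  moreover have "chain_boundary (Suc (Suc m)) (frag_extend (D (Suc m)) c) + frag_extend (D m) (chain_boundary (Suc m) c)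
    = GC (Suc m) c - FC (Suc m) c" unfolding eq by simp
  ultimately show ?thesis unfolding homologous_rel_def singular_relboundary by blast
qed

end

section \<open>Convex carriers and affine simplices\<close>

lemma fun_convex_UNIV: "fun_convex UNIV" by (simp add: fun_convex_def)

lemma fun_convex_Inter: "(\<And>C. C \<in> \<C> \<Longrightarrow> fun_convex C) \<Longrightarrow> fun_convex (\<Inter>\<C>)"
  unfolding fun_convex_def by blast

lemma fun_convex_hull: "fun_convex (fun_convex hull S)"
  by (rule hull_in, rule fun_convex_Inter, blast)

lemma fun_convex_singleton: "fun_convex {a}"
  by (auto simp: fun_convex_def algebra_simps)

text \<open>The last barycentric coordinate t is split off and the others are rescaled by 1 / (1 -
  t), which leaves the vertex t = 1 as a separate case.\<close>

lemma fun_convex_combination: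
  assumes C: "fun_convex C" and l: "\<And>j. j \<le> m \<Longrightarrow> l j \<in> C" and x: "x \<in> standard_simplex m"
  shows "(\<lambda>i. \<Sum>j\<le>m. l j i * x j) \<in> C"
  using l x
proof (induction m arbitrary: x)
  case 0
  then have "x 0 = 1" by (simp add: standard_simplex_def)
  then show ?case using 0 by simp
next
  case (Suc m)
  define t where "t = x (Suc m)"
  have x: "\<And>i. 0 \<le> x i" "\<And>i. i > Suc m \<Longrightarrow> x i = 0" "(\<Sum>i\<le>m. x i) = 1 - t" "0 \<le> t" "t \<le> 1"
    using Suc.prems(2) by (auto simp: standard_simplex_def t_def)
  show ?case
  proof (cases "t = 1")
    case True
    then have "\<forall>i\<in>{..m}. x i = 0" using x sum_nonneg_eq_0_iff[of "{..m}" x] by simp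
    then have "(\<lambda>i. \<Sum>j\<le>Suc m. l j i * x j) = l (Suc m)" using True by (simp add: t_def)
    then show ?thesis using Suc.prems(1) by simp
  next
    case False
    define y where "y = (\<lambda>j. if j \<le> m then x j / (1 - t) else 0)"
    have ysum: "(\<Sum>i\<le>m. y i) = 1"
      using x(3) False by (simp add: y_def sum_divide_distrib[symmetric])
    have ynn: "0 \<le> y i" for i using x False by (simp add: y_def)
    have "y i \<le> 1" for i
    proof (cases "i \<le> m")
      case True
      then have "y i \<le> (\<Sum>i\<le>m. y i)" by (intro member_le_sum) (use ynn in auto)
      then show ?thesis using ysum by simp
    qed (simp add: y_def)
    then have "y \<in> standard_simplex m" using ynn ysum by (auto simp: standard_simplex_def y_def)
    then have "(\<lambda>i. \<Sum>j\<le>m. l j i * y j) \<in> C" using Suc by simp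
    then have "(\<lambda>i. (1 - t) * (\<Sum>j\<le>m. l j i * y j) + t * l (Suc m) i) \<in> C"
      using C[unfolded fun_convex_def, rule_format, of _ "l (Suc m)" t] Suc.prems(1)[of "Suc m"] x(4,5) by simp
    moreover have "(1 - t) * (\<Sum>j\<le>m. l j i * y j) = (\<Sum>j\<le>m. l j i * x j)" for i
      using False by (simp add: sum_distrib_left y_def)
    ultimately show ?thesis by (simp add: t_def mult.commute)
  qed
qed

lemma singular_simplex_oriented_simplex:
  assumes "fun_convex C" "\<And>j. j \<le> m \<Longrightarrow> l j \<in> C"
  shows "singular_simplex m (subtopology (powertop_real UNIV) C) (oriented_simplex m l)"
proof -
  have "simplicial_simplex m C (oriented_simplex m l)"
    unfolding simplicial_simplex_oriented_simplex
    using fun_convex_combination[of C m l, OF assms] by blast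
  then show ?thesis by (rule simplicial_imp_singular_simplex)
qed

text \<open>The inclusion of the k-th face numbers the vertices so that the index k is
  skipped.\<close>

lemma simplical_face_vertex:
  "simplical_face k (\<lambda>i. if i = j then 1 else 0) = (\<lambda>i. if i = (if j < k then j else Suc j) then 1 else (0::real))"
  by (auto simp: simplical_face_def fun_eq_iff)

lemma simplicial_vertex_singular_face:
  assumes "j \<le> m"
  shows "simplicial_vertex j (singular_face (Suc m) k \<tau>) = simplicial_vertex (if j < k then j else Suc j) \<tau>"
  using assms by (simp add: simplicial_vertex_def singular_face_def simplical_face_vertex)

text \<open>The affine simplex depends on the vertices of \<tau> only, so straightening commutes
  with faces for any function \<open>h\<close>, continuous or not.\<close>

lemma singular_face_oriented_vertices:
  assumes "k \<le> Suc m"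
  shows "oriented_simplex m (\<lambda>j. h (simplicial_vertex j (singular_face (Suc m) k \<tau>))) =
    singular_face (Suc m) k (oriented_simplex (Suc m) (\<lambda>j. h (simplicial_vertex j \<tau>)))"
  using assms by (subst singular_face_oriented_simplex) (auto simp: oriented_simplex_eq simplicial_vertex_singular_face)

lemma simplex_map_singular_face:
  "k \<le> Suc m \<Longrightarrow> simplex_map m h (singular_face (Suc m) k \<tau>) = singular_face (Suc m) k (simplex_map (Suc m) h \<tau>)"
  by (subst singular_face_simplex_map) (auto simp: simplex_map_def singular_face_def fun_eq_iff)

lemma simplicial_vertex_simplex_map:
  "j \<le> m \<Longrightarrow> simplicial_vertex j (simplex_map m g \<tau>) = g (simplicial_vertex j \<tau>)"
  by (simp add: simplicial_vertex_def simplex_map_def)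

section \<open>Riemannian distance on a covering\<close>

lemma pullback_atlas_cover:
  assumes A: "smooth_atlas M A" and cov: "covering_map M' p M" and x: "x \<in> topspace M'"
  shows "\<exists>c. c \<in> pullback_atlas M' p A \<and> x \<in> fst c"
proof -
  have px: "p x \<in> topspace M" using cov x by (auto simp: covering_map_def)
  then obtain d where d: "d \<in> A" "p x \<in> fst d" using A unfolding smooth_atlas_def by blast
  obtain U V where V: "openin M' V" "x \<in> V" "inj_on p V" using covering_map_sheet[OF cov x] by metis
  have od: "openin M (fst d)" using A d(1) unfolding smooth_atlas_def by fastforce
  let ?V = "V \<inter> {y \<in> topspace M'. p y \<in> fst d}"
  have "openin M' {y \<in> topspace M'. p y \<in> fst d}"
    by (rule openin_continuous_map_preimage[OF covering_map_continuous[OF cov] od])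
  then have "openin M' ?V" using V by blast
  moreover have "inj_on p ?V" using V(3) by (rule inj_on_subset) auto
  ultimately have "(?V, snd d \<circ> p) \<in> pullback_atlas M' p A"
    unfolding pullback_atlas_def using d(1) by blast
  then show ?thesis using V(2) x d(2) by (intro exI[of _ "(?V, snd d \<circ> p)"]) auto
qed

lemma smooth_atlasD:
  assumes "smooth_atlas X A" "c \<in> A"
  shows "openin X (fst c)" "open (snd c ` fst c)" "homeomorphic_map (subtopology X (fst c)) (top_of_set (snd c ` fst c)) (snd c)"
    "inj_on (snd c) (fst c)" "fst c \<subseteq> topspace X"
proof -
  show 1: "openin X (fst c)" and "open (snd c ` fst c)"
    and h: "homeomorphic_map (subtopology X (fst c)) (top_of_set (snd c ` fst c)) (snd c)"
    using assms unfolding smooth_atlas_def by fastforce+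
  show 2: "fst c \<subseteq> topspace X" using 1 openin_subset by blast
  show "inj_on (snd c) (fst c)"
    using homeomorphic_imp_injective_map[OF h] 2 by (simp add: Int_absorb1)
qed

lemma chart_image_open:
  assumes "smooth_atlas X A" "c \<in> A" "openin X O'" "O' \<subseteq> fst c"
  shows "open (snd c ` O')"
proof -
  note D = smooth_atlasD[OF assms(1,2)]
  have "openin (subtopology X (fst c)) O'" using assms(3,4) openin_open_subtopology[OF D(1)] by blast
  then have "openin (top_of_set (snd c ` fst c)) (snd c ` O')"
    using homeomorphic_imp_open_map[OF D(3)] by (simp add: open_map_def)
  then show ?thesis using D(2) openin_open_trans by blast
qed

lemma smooth_on_continuous: "smooth_on S f \<Longrightarrow> continuous_on S f"
  unfolding smooth_on_def by (metis Ck_on.simps(1))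

lemma smooth_on_differentiable: "smooth_on S f \<Longrightarrow> x \<in> S \<Longrightarrow> f differentiable (at x)"
  unfolding smooth_on_def by (metis Ck_on.simps(2))

lemma smooth_on_derivative_continuous: "smooth_on S f \<Longrightarrow> continuous_on S (\<lambda>x. frechet_derivative f (at x) v)"
  unfolding smooth_on_def by (metis Ck_on.simps)

locale covered_riemannian =
  fixes M :: "'a topology" and A :: "('a, 'e::euclidean_space) chart set"
    and g :: "('a, 'e) metric_tensor" and M' :: "'b topology" and p :: "'b \<Rightarrow> 'a"
  assumes atlas: "smooth_atlas M A" and metric: "riemannian_metric A g" and cov: "covering_map M' p M"
begin

abbreviation "A' \<equiv> pullback_atlas M' p A"
abbreviation "g' \<equiv> pullback_metric p A g"

lemma chart_change_smooth: "c \<in> A \<Longrightarrow> d \<in> A \<Longrightarrow> smooth_on (snd c ` (fst c \<inter> fst d)) (chart_change c d)"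
  using atlas unfolding smooth_atlas_def by blast

lemma metric_nonneg: "c \<in> A \<Longrightarrow> x \<in> fst c \<Longrightarrow> 0 \<le> g c x v v"
proof (cases "v = 0")
  case True
  assume "c \<in> A" "x \<in> fst c"
  then have "bilinear (g c x)" using metric unfolding riemannian_metric_def by blast
  then show ?thesis using True by (simp add: bilinear_lzero)
next
  case False
  assume "c \<in> A" "x \<in> fst c"
  then show ?thesis using metric False unfolding riemannian_metric_def by (meson less_imp_le)
qed

lemma metric_change:
  assumes "c \<in> A" "d \<in> A" "x \<in> fst c \<inter> fst d"
  shows "g c x v v = g d x (frechet_derivative (chart_change c d) (at (snd c x)) v) (frechet_derivative (chart_change c d) (at (snd c x)) v)"
  using metric assms unfolding riemannian_metric_def Let_def by blast

lemma pullback_atlasD: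
  assumes "c \<in> A'"
  obtains V d where "c = (V, snd d \<circ> p)" "openin M' V" "inj_on p V" "d \<in> A" "p ` V \<subseteq> fst d"
  using assms unfolding pullback_atlas_def by blast

lemma open_map_p: "open_map M' M p"
  unfolding open_map_def
proof (intro allI impI)
  fix W assume W: "openin M' W"
  show "openin M (p ` W)"
  proof (subst openin_subopen, clarify)
    fix x assume x: "x \<in> W"
    then have "x \<in> topspace M'" using W openin_subset by blast
    then obtain U V where UV: "openin M U" "openin M' V" "x \<in> V" "homeomorphic_map (subtopology M' V) (subtopology M U) p"
      using covering_map_sheet[OF cov] by metis
    have "openin (subtopology M' V) (V \<inter> W)" using W by (simp add: openin_subtopology_Int2)
    then have "openin (subtopology M U) (p ` (V \<inter> W))"
      using homeomorphic_imp_open_map[OF UV(4)] by (simp add: open_map_def)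
    then have "openin M (p ` (V \<inter> W))" using UV(1) openin_trans_full by blast
    then show "\<exists>T. openin M T \<and> p x \<in> T \<and> T \<subseteq> p ` W" using x UV(3) by blast
  qed
qed

text \<open>The pulled back metric is defined through an arbitrarily chosen chart of the base. The
  transformation rule of the metric tensor permits replacing it by the chart \<open>d\<close> from
  which the chart upstairs was made; the diagonal values suffice for speeds.\<close>

lemma pullback_metric_eq:
  assumes V: "openin M' V" "inj_on p V" and d: "d \<in> A" "p ` V \<subseteq> fst d" and x: "x \<in> V"
  shows "g' (V, snd d \<circ> p) x v v = g d (p x) v v"
proof -
  define d1 where "d1 = (SOME d. d \<in> A \<and> p x \<in> fst d)"
  have d1: "d1 \<in> A" "p x \<in> fst d1"
    using someI[of "\<lambda>d. d \<in> A \<and> p x \<in> fst d" d] d x by (auto simp: d1_def)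
  let ?S = "snd d ` (p ` V)"
  have oS: "open ?S"
    by (rule chart_image_open[OF atlas d(1) _ d(2)]) (use open_map_p V in \<open>simp add: open_map_def\<close>)
  have zS: "snd d (p x) \<in> ?S" using x by blast
  have inj: "inj_on (snd d \<circ> p) V"
    using V(2) d smooth_atlasD(4)[OF atlas d(1)] by (intro comp_inj_on) (auto intro: inj_on_subset)
  \<comment> \<open>On the open set \<open>?S\<close> the map differentiated in the definition is
    the change of charts from \<open>d\<close> to the chosen chart \<open>d1\<close>, so the
    derivatives agree.\<close>
  have eq: "(snd d1 \<circ> p \<circ> inv_into V (snd d \<circ> p)) z = chart_change d d1 z" if z: "z \<in> ?S" for z
  proof -
    obtain y where y: "y \<in> V" "z = snd d (p y)" using z by blast
    have "inv_into V (snd d \<circ> p) z = y" using inv_into_f_f[OF inj y(1)] y(2) by simp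
    moreover have "inv_into (fst d) (snd d) z = p y"
      using inv_into_f_f[OF smooth_atlasD(4)[OF atlas d(1)], of "p y"] y d(2) by auto
    ultimately show ?thesis by (simp add: chart_change_def)
  qed
  have dd: "chart_change d d1 differentiable (at (snd d (p x)))"
    using smooth_on_differentiable[OF chart_change_smooth[OF d(1) d1(1)]] x d d1 by blast
  have "(chart_change d d1 has_derivative frechet_derivative (chart_change d d1) (at (snd d (p x)))) (at (snd d (p x)))"
    using dd frechet_derivative_works by blast
  then have "((snd d1 \<circ> p \<circ> inv_into V (snd d \<circ> p)) has_derivative frechet_derivative (chart_change d d1) (at (snd d (p x)))) (at (snd d (p x)))"
    by (rule has_derivative_transform_within_open[OF _ oS zS]) (simp add: eq[symmetric])
  then have L: "frechet_derivative (snd d1 \<circ> p \<circ> inv_into V (snd d \<circ> p)) (at (snd d (p x))) = frechet_derivative (chart_change d d1) (at (snd d (p x)))"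
    using frechet_derivative_at by metis
  show ?thesis
    unfolding pullback_metric_def Let_def d1_def[symmetric] fst_conv snd_conv comp_apply[of "snd d" p x] L
    using metric_change[OF d(1) d1(1), of "p x" v] x d d1 by auto
qed

lemma curve_speed_nonneg:
  assumes "\<gamma> t \<in> topspace M'"
  shows "0 \<le> curve_speed A' g' \<gamma> t"
proof -
  define c where "c = (SOME c. c \<in> A' \<and> \<gamma> t \<in> fst c)"
  have "c \<in> A'" and c: "\<gamma> t \<in> fst c"
    using someI_ex[OF pullback_atlas_cover[OF atlas cov assms]] by (simp_all add: c_def)
  then obtain V d where V: "c = (V, snd d \<circ> p)" "openin M' V" "inj_on p V" "d \<in> A" "p ` V \<subseteq> fst d"
    using pullback_atlasD by metis
  have "0 \<le> g' c (\<gamma> t) v v" for v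
    unfolding V(1) using pullback_metric_eq[OF V(2-5)] metric_nonneg[OF V(4)] c V(1,5) by auto
  then show ?thesis unfolding curve_speed_def Let_def c_def[symmetric] by simp
qed

lemma curve_length_nonneg:
  assumes "pathin M' \<gamma>"
  shows "0 \<le> curve_length A' g' \<gamma>"
proof (cases "curve_speed A' g' \<gamma> integrable_on {0..1}")
  case True
  have "\<gamma> t \<in> topspace M'" if "t \<in> {0..1}" for t
    using assms that by (auto simp: pathin_def continuous_map_def)
  then show ?thesis unfolding curve_length_def
    by (intro integral_nonneg True) (simp add: curve_speed_nonneg)
qed (simp add: curve_length_def not_integrable_integral)

lemma riemannian_dist_le_length:
  assumes "piecewise_C1_curve M' A' \<gamma>"
  shows "riemannian_dist M' A' g' (\<gamma> 0) (\<gamma> 1) \<le> curve_length A' g' \<gamma>"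
  unfolding riemannian_dist_def
proof (rule cInf_lower)
  \<comment> \<open>A member of the set bounds the real infimum from above only if the set is
    bounded below; lengths are nonnegative.\<close>
  show "bdd_below {curve_length A' g' \<delta> |\<delta>. piecewise_C1_curve M' A' \<delta> \<and> \<delta> 0 = \<gamma> 0 \<and> \<delta> 1 = \<gamma> 1}"
    by (rule bdd_belowI[of _ 0]) (auto simp: piecewise_C1_curve_def intro: curve_length_nonneg)
qed (use assms in blast)

text \<open>The coefficients of the metric in the standard basis are continuous, hence bounded on C;
  B is the sum of the absolute values of these bounds.\<close>

lemma metric_bound:
  assumes d: "d \<in> A" and C: "compact C" "C \<subseteq> snd d ` fst d"
  obtains B where "B \<ge> 0" "\<And>y w. y \<in> C \<Longrightarrow> g d (inv_into (fst d) (snd d) y) w w \<le> B * (norm w)\<^sup>2"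
proof -
  let ?\<psi> = "inv_into (fst d) (snd d)"
  have "\<exists>B. \<forall>y\<in>C. \<bar>g d (?\<psi> y) b b'\<bar> \<le> B" for b b'
  proof -
    have "continuous_on (snd d ` fst d) (\<lambda>y. g d (?\<psi> y) b b')"
      using metric d unfolding riemannian_metric_def by (blast intro: smooth_on_continuous)
    then have "compact ((\<lambda>y. g d (?\<psi> y) b b') ` C)"
      using C continuous_on_subset compact_continuous_image by blast
    then have "bounded ((\<lambda>y. g d (?\<psi> y) b b') ` C)" by (rule compact_imp_bounded)
    then show ?thesis unfolding bounded_iff by auto
  qed
  then obtain B where B: "\<And>b b' y. y \<in> C \<Longrightarrow> \<bar>g d (?\<psi> y) b b'\<bar> \<le> B b b'" by metis
  show thesis
  proof
    show "(\<Sum>b\<in>Basis. \<Sum>b'\<in>Basis. \<bar>B b b'\<bar>) \<ge> 0" by (intro sum_nonneg) auto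
    fix y and w :: 'e assume y: "y \<in> C"
    have "?\<psi> y \<in> fst d" using y C(2) by (metis inv_into_into subsetD)
    then have bl: "bilinear (g d (?\<psi> y))" using metric d unfolding riemannian_metric_def by blast
    have "g d (?\<psi> y) w w = g d (?\<psi> y) (\<Sum>b\<in>Basis. (w \<bullet> b) *\<^sub>R b) (\<Sum>b\<in>Basis. (w \<bullet> b) *\<^sub>R b)"
      by (simp add: euclidean_representation)
    also have "\<dots> = (\<Sum>b\<in>Basis. \<Sum>b'\<in>Basis. (w \<bullet> b) * ((w \<bullet> b') * g d (?\<psi> y) b b'))"
      using bl by (simp add: bilinear_sum sum.cartesian_product[symmetric] bilinear_lmul bilinear_rmul)
    also have "\<dots> \<le> (\<Sum>b\<in>Basis. \<Sum>b'\<in>Basis. \<bar>B b b'\<bar> * (norm w)\<^sup>2)"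
    proof (intro sum_mono)
      fix b b' :: 'e assume b: "b \<in> Basis" "b' \<in> Basis"
      have "(w \<bullet> b) * ((w \<bullet> b') * g d (?\<psi> y) b b') \<le> \<bar>w \<bullet> b\<bar> * (\<bar>w \<bullet> b'\<bar> * \<bar>g d (?\<psi> y) b b'\<bar>)"
        by (metis abs_ge_self abs_mult)
      also have "\<dots> \<le> norm w * (norm w * \<bar>B b b'\<bar>)"
        using b B[OF y, of b b'] by (intro mult_mono) (auto simp: Basis_le_norm)
      finally show "(w \<bullet> b) * ((w \<bullet> b') * g d (?\<psi> y) b b') \<le> \<bar>B b b'\<bar> * (norm w)\<^sup>2"
        by (simp add: power2_eq_square mult_ac)
    qed
    finally show "g d (?\<psi> y) w w \<le> (\<Sum>b\<in>Basis. \<Sum>b'\<in>Basis. \<bar>B b b'\<bar>) * (norm w)\<^sup>2"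
      by (simp add: sum_distrib_right)
  qed
qed

text \<open>A section lifts a coordinate segment to a curve upstairs, and its speed for the pulled
  back metric is that of the segment downstairs. Hence \<open>R\<close> can be chosen before the
  section \<open>s\<close>, so that one bound serves all translates of a sheet.\<close>

lemma dist_bound_on_sections:
  assumes m: "m \<in> topspace M" and O': "openin M O'" "m \<in> O'"
  obtains U R where "openin M U" "m \<in> U" "U \<subseteq> O'" "R \<ge> 0"
    "\<And>s u u'. continuous_map (subtopology M U) M' s \<Longrightarrow> (\<And>x. x \<in> U \<Longrightarrow> p (s x) = x) \<Longrightarrow> u \<in> U \<Longrightarrow> u' \<in> U
       \<Longrightarrow> riemannian_dist M' A' g' (s u) (s u') \<le> R"
proof -
  obtain d0 where d0: "d0 \<in> A" "m \<in> fst d0" using atlas m unfolding smooth_atlas_def by blast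
  define \<phi> where "\<phi> = snd d0"
  define D where "D = fst d0"
  define \<psi> where "\<psi> = inv_into D \<phi>"
  note D = smooth_atlasD[OF atlas d0(1), folded \<phi>_def D_def]
  have \<psi>\<phi>: "\<psi> (\<phi> x) = x" if "x \<in> D" for x using inv_into_f_f[OF D(4) that] by (simp add: \<psi>_def)
  have \<phi>\<psi>: "\<phi> (\<psi> y) = y" "\<psi> y \<in> D" if "y \<in> \<phi> ` D" for y using that \<psi>\<phi> by auto
  have "open (\<phi> ` (O' \<inter> D))"
    using chart_image_open[OF atlas d0(1), of "O' \<inter> D"] O' D(1) by (simp add: \<phi>_def D_def openin_Int)
  then obtain r where r: "r > 0" "cball (\<phi> m) r \<subseteq> \<phi> ` (O' \<inter> D)"
    using O' d0(2) unfolding D_def open_contains_cball by blast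
  have rD: "cball (\<phi> m) r \<subseteq> \<phi> ` D" using r(2) by blast
  obtain B where B: "B \<ge> 0" "\<And>y w. y \<in> cball (\<phi> m) r \<Longrightarrow> g d0 (\<psi> y) w w \<le> B * (norm w)\<^sup>2"
    using metric_bound[OF d0(1) compact_cball, of "\<phi> m" r] rD unfolding \<phi>_def D_def \<psi>_def by blast
  \<comment> \<open>Two points of the coordinate ball of radius r are less than 2 r apart, so this
    bounds the speed, and on the unit interval the length, of every lifted segment.\<close>
  define R where "R = sqrt (B * (2 * r)\<^sup>2)"
  define U where "U = {x \<in> D. \<phi> x \<in> ball (\<phi> m) r}"
  have Ub: "\<phi> ` U = ball (\<phi> m) r"
  proof (intro subset_antisym subsetI)
    fix y assume y: "y \<in> ball (\<phi> m) r"
    then obtain x where "x \<in> D" "y = \<phi> x" using rD ball_subset_cball by blast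
    then show "y \<in> \<phi> ` U" using y by (auto simp: U_def)
  qed (auto simp: U_def)
  have cont\<phi>: "continuous_map (subtopology M D) euclidean \<phi>"
    using homeomorphic_imp_continuous_map[OF D(3)] continuous_map_into_fulltopology by blast
  have "openin (subtopology M D) {x \<in> topspace (subtopology M D). \<phi> x \<in> ball (\<phi> m) r}"
    by (rule openin_continuous_map_preimage[OF cont\<phi>]) auto
  moreover have "{x \<in> topspace (subtopology M D). \<phi> x \<in> ball (\<phi> m) r} = U" using D(5) by (auto simp: U_def)
  ultimately have oU: "openin M U" using D(1) openin_trans_full by metis
  have UD: "U \<subseteq> D" by (auto simp: U_def)
  have cont\<psi>: "continuous_map (top_of_set (ball (\<phi> m) r)) (subtopology M U) \<psi>"
  proof -
    obtain h where h: "homeomorphic_maps (subtopology M D) (top_of_set (\<phi> ` D)) \<phi> h"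
      using D(3) homeomorphic_map_maps by blast
    then have ch: "continuous_map (top_of_set (\<phi> ` D)) (subtopology M D) h"
      and hp: "\<And>x. x \<in> D \<Longrightarrow> h (\<phi> x) = x" using D(5) by (auto simp: homeomorphic_maps_def)
    have "continuous_map (top_of_set (\<phi> ` D)) (subtopology M D) \<psi>"
      by (rule continuous_map_eq[OF ch]) (use hp \<psi>\<phi> in auto)
    then have "continuous_map (top_of_set (ball (\<phi> m) r)) M \<psi>"
      using continuous_map_from_subtopology_mono continuous_map_into_fulltopology rD ball_subset_cball by (metis order_trans)
    moreover have "\<psi> y \<in> U" if "y \<in> ball (\<phi> m) r" for y
      using that Ub \<psi>\<phi> UD by (metis imageE subsetD)
    ultimately show ?thesis by (simp add: continuous_map_in_subtopology image_subset_iff_funcset Pi_iff)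
  qed
  have main: "riemannian_dist M' A' g' (s u) (s u') \<le> R"
    if s: "continuous_map (subtopology M U) M' s" and ps: "\<And>x. x \<in> U \<Longrightarrow> p (s x) = x"
      and u: "u \<in> U" "u' \<in> U" for s u u'
  proof -
    define w where "w = \<phi> u' - \<phi> u"
    define l where "l t = \<phi> u + t *\<^sub>R w" for t
    \<comment> \<open>The lift by the section \<open>s\<close> of the segment that joins the
      coordinates of u and u'.\<close>
    define \<gamma> where "\<gamma> t = s (\<psi> (l t))" for t
    have lb: "l t \<in> ball (\<phi> m) r" if "t \<in> {0..1}" for t
    proof -
      have "(1 - t) *\<^sub>R \<phi> u + t *\<^sub>R \<phi> u' \<in> ball (\<phi> m) r"
      proof (rule convexD[OF convex_ball])
        show "\<phi> u \<in> ball (\<phi> m) r" "\<phi> u' \<in> ball (\<phi> m) r" using u Ub by blast+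
      qed (use that in auto)
      then show ?thesis by (simp add: l_def w_def algebra_simps)
    qed
    have lU: "\<psi> (l t) \<in> U" "\<phi> (\<psi> (l t)) = l t" if "l t \<in> ball (\<phi> m) r" for t
      using that Ub \<psi>\<phi> UD by (metis imageE subsetD)+
    have contl: "continuous_on S l" for S unfolding l_def by (intro continuous_intros)
    have ol: "open (l -` ball (\<phi> m) r)" by (rule open_vimage[OF open_ball contl])
    have deriv: "((snd c \<circ> \<gamma>) has_vector_derivative frechet_derivative (chart_change d0 d) (at (l t)) w) (at t)"
      and gd: "g' c (\<gamma> t) v v = g d (\<psi> (l t)) v v"
      if c: "c = (V, snd d \<circ> p)" "openin M' V" "inj_on p V" "d \<in> A" "p ` V \<subseteq> fst d" and t: "t \<in> {0..1}" and \<gamma>t: "\<gamma> t \<in> V"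
      for c V d t v
    proof -
      have pg: "p (\<gamma> \<tau>) = \<psi> (l \<tau>)" if "l \<tau> \<in> ball (\<phi> m) r" for \<tau>
        unfolding \<gamma>_def using ps lU(1)[OF that] by blast
      show "g' c (\<gamma> t) v v = g d (\<psi> (l t)) v v"
        using pullback_metric_eq[OF c(2-5) \<gamma>t] pg[OF lb[OF t]] c(1) by simp
      have "\<psi> (l t) \<in> D \<inter> fst d" using pg[OF lb[OF t]] \<gamma>t c(5) lU(1)[OF lb[OF t]] UD by auto
      then have "l t \<in> \<phi> ` (D \<inter> fst d)" using lU(2)[OF lb[OF t]] by (metis imageI)
      then have "chart_change d0 d differentiable (at (l t))"
        using smooth_on_differentiable[OF chart_change_smooth[OF d0(1) c(4)]] by (simp add: D_def \<phi>_def)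
      then have "(chart_change d0 d has_derivative frechet_derivative (chart_change d0 d) (at (l t))) (at (l t))"
        using frechet_derivative_works by blast
      then have 2: "(chart_change d0 d has_derivative frechet_derivative (chart_change d0 d) (at (l t))) (at (l t) within range l)"
        by (rule has_derivative_at_withinI)
      have 1: "(l has_vector_derivative w) (at t within UNIV)" unfolding l_def
        by (auto intro!: derivative_eq_intros)
      have "((chart_change d0 d \<circ> l) has_vector_derivative frechet_derivative (chart_change d0 d) (at (l t)) w) (at t)"
        by (rule vector_derivative_diff_chain_within[OF 1 2])
      then show "((snd c \<circ> \<gamma>) has_vector_derivative frechet_derivative (chart_change d0 d) (at (l t)) w) (at t)"
      proof (rule has_vector_derivative_transform_within_open[OF _ ol])
        show "t \<in> l -` ball (\<phi> m) r" using lb[OF t] by simp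
        show "(chart_change d0 d \<circ> l) \<tau> = (snd c \<circ> \<gamma>) \<tau>" if "\<tau> \<in> l -` ball (\<phi> m) r" for \<tau>
          using pg[of \<tau>] that c(1) by (simp add: chart_change_def \<psi>_def \<phi>_def D_def)
      qed
    qed
    have path: "pathin M' \<gamma>"
    proof -
      have "continuous_map (top_of_set {0..1}) (top_of_set (ball (\<phi> m) r)) l" using contl lb by auto
      then have "continuous_map (top_of_set {0..1}) M' (s \<circ> (\<psi> \<circ> l))"
        by (rule continuous_map_compose[OF continuous_map_compose[OF _ cont\<psi>] s])
      moreover have "\<gamma> = s \<circ> (\<psi> \<circ> l)" by (simp add: \<gamma>_def fun_eq_iff)
      ultimately show ?thesis by (simp add: pathin_def)
    qed
    have "C1_curve_on A' {0..1} \<gamma>"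
      unfolding C1_curve_on_def
    proof
      fix c assume "c \<in> A'"
      then obtain V d where c: "c = (V, snd d \<circ> p)" "openin M' V" "inj_on p V" "d \<in> A" "p ` V \<subseteq> fst d"
        using pullback_atlasD by metis
      let ?D = "\<lambda>t. frechet_derivative (chart_change d0 d) (at (l t)) w"
      have "l ` {t \<in> {0..1}. \<gamma> t \<in> fst c} \<subseteq> \<phi> ` (D \<inter> fst d)"
      proof clarify
        fix t assume t: "t \<in> {0..1::real}" "\<gamma> t \<in> fst c"
        have "p (\<gamma> t) = \<psi> (l t)" unfolding \<gamma>_def using ps lU(1)[OF lb[OF t(1)]] by blast
        then have "\<psi> (l t) \<in> D \<inter> fst d" using t c(1,5) lU(1)[OF lb[OF t(1)]] UD by auto
        then show "l t \<in> \<phi> ` (D \<inter> fst d)" using lU(2)[OF lb[OF t(1)]] by (metis imageI)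
      qed
      then have "continuous_on {t \<in> {0..1}. \<gamma> t \<in> fst c} ?D"
        using continuous_on_compose2[OF smooth_on_derivative_continuous[OF chart_change_smooth[OF d0(1) c(4)]] contl]
        by (simp add: D_def \<phi>_def)
      moreover have "((snd c \<circ> \<gamma>) has_vector_derivative ?D t) (at t within {0..1})" if "t \<in> {0..1}" "\<gamma> t \<in> fst c" for t
        using deriv[OF c that(1)] that(2) c(1) by (auto intro: has_vector_derivative_at_within)
      ultimately show "\<exists>D. continuous_on {t \<in> {0..1}. \<gamma> t \<in> fst c} D \<and>
        (\<forall>t\<in>{0..1}. \<gamma> t \<in> fst c \<longrightarrow> ((snd c \<circ> \<gamma>) has_vector_derivative D t) (at t within {0..1}))" by blast
    qed
    \<comment> \<open>One piece suffices: the subdivision is \<open>real\<close>, which has the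
      values 0 at 0 and 1 at 1.\<close>
    then have pw: "piecewise_C1_curve M' A' \<gamma>"
      unfolding piecewise_C1_curve_def using path by (intro conjI exI[of _ "1::nat"] exI[of _ real]) auto
    have speed: "curve_speed A' g' \<gamma> t \<le> R" if t: "t \<in> {0..1}" for t
    proof -
      have "\<gamma> t \<in> topspace M'" using path t by (auto simp: pathin_def continuous_map_def)
      define c where "c = (SOME c. c \<in> A' \<and> \<gamma> t \<in> fst c)"
      have "c \<in> A'" and ct: "\<gamma> t \<in> fst c"
        using someI_ex[OF pullback_atlas_cover[OF atlas cov \<open>\<gamma> t \<in> topspace M'\<close>]] by (simp_all add: c_def)
      then obtain V d where c: "c = (V, snd d \<circ> p)" "openin M' V" "inj_on p V" "d \<in> A" "p ` V \<subseteq> fst d"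
        using pullback_atlasD by metis
      have \<gamma>V: "\<gamma> t \<in> V" using ct c(1) by simp
      let ?L = "frechet_derivative (chart_change d0 d) (at (l t))"
      have vd: "vector_derivative (snd c \<circ> \<gamma>) (at t) = ?L w"
        using deriv[OF c t \<gamma>V] by (rule vector_derivative_at)
      have "p (\<gamma> t) = \<psi> (l t)" unfolding \<gamma>_def using ps lU(1)[OF lb[OF t]] by blast
      then have "\<psi> (l t) \<in> fst d0 \<inter> fst d" using \<gamma>V c(5) lU(1)[OF lb[OF t]] UD by (auto simp: D_def)
      from metric_change[OF d0(1) c(4) this, of w]
      have "g d (\<psi> (l t)) (?L w) (?L w) = g d0 (\<psi> (l t)) w w"
        using lU(2)[OF lb[OF t]] by (simp add: \<phi>_def)
      then have "curve_speed A' g' \<gamma> t = sqrt (g d0 (\<psi> (l t)) w w)"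
        unfolding curve_speed_def Let_def c_def[symmetric] vd gd[OF c t \<gamma>V] by simp
      moreover have "g d0 (\<psi> (l t)) w w \<le> B * (2 * r)\<^sup>2"
      proof -
        have "norm w \<le> 2 * r"
        proof -
          have "dist (\<phi> m) (\<phi> u) < r" "dist (\<phi> m) (\<phi> u') < r" using u by (auto simp: U_def)
          then show ?thesis unfolding w_def using dist_triangle3[of "\<phi> u'" "\<phi> u" "\<phi> m"] by (simp add: dist_norm)
        qed
        then have "B * (norm w)\<^sup>2 \<le> B * (2 * r)\<^sup>2" using B(1) by (intro mult_left_mono power_mono) auto
        then show ?thesis using B(2)[of "l t" w] lb[OF t] by simp
      qed
      ultimately show ?thesis by (simp add: R_def)
    qed
    have "curve_length A' g' \<gamma> \<le> R"
    \<comment> \<open>If the speed is not integrable, its integral is 0 by convention, and the bound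
      holds trivially.\<close>
    proof (cases "curve_speed A' g' \<gamma> integrable_on {0..1}")
      case True
      have "integral {0..1} (curve_speed A' g' \<gamma>) \<le> integral {0..1} (\<lambda>_::real. R)"
        by (rule integral_le[OF True]) (use speed in auto)
      then show ?thesis by (simp add: curve_length_def)
    qed (use B(1) in \<open>simp add: curve_length_def not_integrable_integral R_def\<close>)
    moreover have "\<gamma> 0 = s u" "\<gamma> 1 = s u'" using \<psi>\<phi> u UD by (auto simp: \<gamma>_def l_def w_def)
    ultimately show ?thesis using riemannian_dist_le_length[OF pw] by simp
  qed
  show thesis
  proof (rule that[OF oU _ _ _ main])
    show "m \<in> U" using d0(2) r(1) by (simp add: U_def D_def)
    show "U \<subseteq> O'"
    proof
      fix x assume x: "x \<in> U"
      then obtain y where "y \<in> O' \<inter> D" "\<phi> x = \<phi> y" using r(2) ball_subset_cball by (force simp: U_def)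
      then show "x \<in> O'" using D(4) x UD by (metis IntE inj_onD subsetD)
    qed
    show "R \<ge> 0" using B(1) by (simp add: R_def)
  qed
qed

text \<open>
  Distances are compared only through the images under Lipschitz maps, where the triangle inequality
  is that of the Euclidean norm; it is not needed for \<^const>\<open>riemannian_dist\<close>. The quantification over \<open>h\<close>
  makes the bound uniform over all translates.
\<close>

definition bundle_close :: "'g monoid \<Rightarrow> ('g \<Rightarrow> 'b \<Rightarrow> 'b) \<Rightarrow> nat \<Rightarrow> real \<Rightarrow> 'b \<Rightarrow> 'b \<Rightarrow> bool" where
  "bundle_close G act n R x y \<longleftrightarrow>
     (\<forall>h\<in>carrier G. \<forall>\<epsilon>>0. \<forall>f. continuous_map M' (nsphere n) f \<longrightarrow>
        (\<forall>x\<in>topspace M'. \<forall>y\<in>topspace M'. sphere_dist n (f x) (f y) \<le> \<epsilon> * riemannian_dist M' A' g' x y) \<longrightarrow>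
        L2_set (\<lambda>i. f (act h x) i - f (act h y) i) {..n} \<le> \<epsilon> * R)"

end

text \<open>Both parts come from expanding |u - v|^2 and |u + v|^2 for unit vectors; nonnegativity
  of these gives the Cauchy-Schwarz bound.\<close>

lemma nsphere_dot_bounds:
  assumes "u \<in> topspace (nsphere n)" "v \<in> topspace (nsphere n)"
  shows "(L2_set (\<lambda>i. u i - v i) {..n})\<^sup>2 = 2 - 2 * (\<Sum>i\<le>n. u i * v i)" "\<bar>\<Sum>i\<le>n. u i * v i\<bar> \<le> 1"
proof -
  have 1: "(\<Sum>i\<le>n. (u i)\<^sup>2) = 1" "(\<Sum>i\<le>n. (v i)\<^sup>2) = 1" using assms by (auto simp: nsphere)
  have "(\<Sum>i\<le>n. (u i - v i)\<^sup>2) = (\<Sum>i\<le>n. (u i)\<^sup>2) + (\<Sum>i\<le>n. (v i)\<^sup>2) - 2 * (\<Sum>i\<le>n. u i * v i)"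
    by (simp add: power2_diff sum.distrib sum_subtractf sum_distrib_left mult.assoc)
  then have 2: "(\<Sum>i\<le>n. (u i - v i)\<^sup>2) = 2 - 2 * (\<Sum>i\<le>n. u i * v i)" using 1 by simp
  have "(L2_set (\<lambda>i. u i - v i) {..n})\<^sup>2 = (\<Sum>i\<le>n. (u i - v i)\<^sup>2)"
    by (simp add: L2_set_def sum_nonneg)
  then show "(L2_set (\<lambda>i. u i - v i) {..n})\<^sup>2 = 2 - 2 * (\<Sum>i\<le>n. u i * v i)"
    unfolding 2 .
  have "(\<Sum>i\<le>n. (u i + v i)\<^sup>2) = (\<Sum>i\<le>n. (u i)\<^sup>2) + (\<Sum>i\<le>n. (v i)\<^sup>2) + 2 * (\<Sum>i\<le>n. u i * v i)"
    by (simp add: power2_sum sum.distrib sum_distrib_left mult.assoc)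
  then have 3: "(\<Sum>i\<le>n. (u i + v i)\<^sup>2) = 2 + 2 * (\<Sum>i\<le>n. u i * v i)" using 1 by simp
  have "0 \<le> 2 + 2 * (\<Sum>i\<le>n. u i * v i)" "0 \<le> 2 - 2 * (\<Sum>i\<le>n. u i * v i)"
    unfolding 2[symmetric] 3[symmetric] by (simp_all add: sum_nonneg)
  then show "\<bar>\<Sum>i\<le>n. u i * v i\<bar> \<le> 1" by linarith
qed

text \<open>A chord that subtends the angle t has length 2 sin(t / 2), which is at most t.\<close>

lemma chord_le_sphere_dist:
  assumes "u \<in> topspace (nsphere n)" "v \<in> topspace (nsphere n)"
  shows "L2_set (\<lambda>i. u i - v i) {..n} \<le> sphere_dist n u v"
proof -
  let ?\<theta> = "sphere_dist n u v"
  note b = nsphere_dot_bounds[OF assms]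
  have c: "cos ?\<theta> = (\<Sum>i\<le>n. u i * v i)" using b(2) by (simp add: sphere_dist_def cos_arccos_abs)
  have nn: "0 \<le> ?\<theta>" using b(2) by (simp add: sphere_dist_def arccos_lbound abs_le_iff)
  have "cos ?\<theta> = 1 - 2 * (sin (?\<theta> / 2))\<^sup>2" using cos_double_sin[of "?\<theta> / 2"] by simp
  then have "(L2_set (\<lambda>i. u i - v i) {..n})\<^sup>2 = 4 * (sin (?\<theta> / 2))\<^sup>2" using b(1) c by simp
  also have "\<dots> \<le> 4 * (?\<theta> / 2)\<^sup>2"
    using abs_sin_x_le_abs_x[of "?\<theta> / 2"] unfolding abs_le_square_iff by (rule mult_left_mono) simp
  also have "\<dots> = ?\<theta>\<^sup>2" by (simp add: power_divide)
  finally show ?thesis using nn by (rule power2_le_imp_le)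
qed

context covered_riemannian
begin

lemma bundle_close_trans:
  assumes "bundle_close G act n R x y" "bundle_close G act n R' y z"
  shows "bundle_close G act n (R + R') x z"
  unfolding bundle_close_def
proof (intro ballI allI impI)
  fix h \<epsilon> f assume a: "h \<in> carrier G" "(\<epsilon>::real) > 0" "continuous_map M' (nsphere n) f"
    "\<forall>x\<in>topspace M'. \<forall>y\<in>topspace M'. sphere_dist n (f x) (f y) \<le> \<epsilon> * riemannian_dist M' A' g' x y"
  have "L2_set (\<lambda>i. (f (act h x) i - f (act h y) i) + (f (act h y) i - f (act h z) i)) {..n} \<le>
     L2_set (\<lambda>i. f (act h x) i - f (act h y) i) {..n} + L2_set (\<lambda>i. f (act h y) i - f (act h z) i) {..n}"
    by (rule L2_set_triangle_ineq)
  also have "\<dots> \<le> \<epsilon> * R + \<epsilon> * R'" using assms a unfolding bundle_close_def by (intro add_mono) blast+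
  finally show "L2_set (\<lambda>i. f (act h x) i - f (act h z) i) {..n} \<le> \<epsilon> * (R + R')" by (simp add: algebra_simps)
qed

lemma bundle_close_sym:
  assumes "bundle_close G act n R x y"
  shows "bundle_close G act n R y x"
  unfolding bundle_close_def
proof (intro ballI allI impI)
  fix h \<epsilon> f assume "h \<in> carrier G" "(\<epsilon>::real) > 0" "continuous_map M' (nsphere n) f"
    "\<forall>x\<in>topspace M'. \<forall>y\<in>topspace M'. sphere_dist n (f x) (f y) \<le> \<epsilon> * riemannian_dist M' A' g' x y"
  then have "L2_set (\<lambda>i. f (act h x) i - f (act h y) i) {..n} \<le> \<epsilon> * R"
    using assms unfolding bundle_close_def by blast
  then show "L2_set (\<lambda>i. f (act h y) i - f (act h x) i) {..n} \<le> \<epsilon> * R"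
    by (simp add: L2_set_def power2_commute)
qed

text \<open>A sheet over a small neighbourhood is the image of a section s, and
  \<open>act h \<circ> s\<close> is again a section over the same neighbourhood for every h. The
  bound for sections is uniform in the section and thus covers all translates.\<close>

lemma bundle_close_local:
  assumes pb: "principal_bundle G act M' p M" and x: "x \<in> topspace M'"
  shows "\<exists>V R. openin M' V \<and> x \<in> V \<and> R \<ge> 0 \<and> (\<forall>y\<in>V. \<forall>y'\<in>V. bundle_close G act n R y y')"
proof -
  have act: "continuous_map M' M' (act h)" "\<And>y. y \<in> topspace M' \<Longrightarrow> p (act h y) = p y"
    "\<And>y. y \<in> topspace M' \<Longrightarrow> act h y \<in> topspace M'" if "h \<in> carrier G" for h
  proof -
    show "continuous_map M' M' (act h)" "\<And>y. y \<in> topspace M' \<Longrightarrow> p (act h y) = p y"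
      using pb that by (auto simp: principal_bundle_def)
    then show "\<And>y. y \<in> topspace M' \<Longrightarrow> act h y \<in> topspace M'"
      using continuous_map_image_subset_topspace by blast
  qed
  obtain U0 V0 where UV: "openin M U0" "p x \<in> U0" "openin M' V0" "x \<in> V0" "p ` V0 = U0"
     "homeomorphic_map (subtopology M' V0) (subtopology M U0) p"
    using covering_map_sheet[OF cov x] by metis
  have VY: "V0 \<subseteq> topspace M'" and UX: "U0 \<subseteq> topspace M" using UV openin_subset by blast+
  have px: "p x \<in> topspace M" using UX UV(2) by blast
  obtain s where s: "homeomorphic_maps (subtopology M' V0) (subtopology M U0) p s"
    using UV(6) homeomorphic_map_maps by blast
  have cs: "continuous_map (subtopology M U0) (subtopology M' V0) s"
    and sp: "\<And>y. y \<in> V0 \<Longrightarrow> s (p y) = y" and ps: "\<And>u. u \<in> U0 \<Longrightarrow> p (s u) = u"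
    using s VY UX by (auto simp: homeomorphic_maps_def)
  obtain U R where U: "openin M U" "p x \<in> U" "U \<subseteq> U0" "R \<ge> 0"
    and bound: "\<And>s u u'. continuous_map (subtopology M U) M' s \<Longrightarrow> (\<And>x. x \<in> U \<Longrightarrow> p (s x) = x) \<Longrightarrow> u \<in> U \<Longrightarrow> u' \<in> U
       \<Longrightarrow> riemannian_dist M' A' g' (s u) (s u') \<le> R"
    using dist_bound_on_sections[OF px UV(1,2)] by metis
  have csU: "continuous_map (subtopology M U) M' s"
    using continuous_map_from_subtopology_mono[OF continuous_map_into_fulltopology[OF cs] U(3)] .
  have sV: "s u \<in> V0" if "u \<in> U" for u
  proof -
    have "u \<in> U0" using U(3) that by blast
    then obtain y where "y \<in> V0" "u = p y" using UV(5) by blast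
    then show ?thesis using sp by simp
  qed
  let ?V = "V0 \<inter> {y \<in> topspace M'. p y \<in> U}"
  have "openin M' ?V" using UV(3) openin_continuous_map_preimage[OF covering_map_continuous[OF cov] U(1)] by blast
  moreover have "x \<in> ?V" using UV(4) x U(2) by blast
  moreover have "bundle_close G act n R y y'" if y: "y \<in> ?V" "y' \<in> ?V" for y y'
    unfolding bundle_close_def
  proof (intro ballI allI impI)
    fix h \<epsilon> f assume h: "h \<in> carrier G" and e: "(\<epsilon>::real) > 0" and f: "continuous_map M' (nsphere n) f"
      and lip: "\<forall>x\<in>topspace M'. \<forall>y\<in>topspace M'. sphere_dist n (f x) (f y) \<le> \<epsilon> * riemannian_dist M' A' g' x y"
    have "riemannian_dist M' A' g' ((act h \<circ> s) (p y)) ((act h \<circ> s) (p y')) \<le> R"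
    proof (rule bound)
      show "continuous_map (subtopology M U) M' (act h \<circ> s)" by (rule continuous_map_compose[OF csU act(1)[OF h]])
      show "p ((act h \<circ> s) u) = u" if "u \<in> U" for u
      proof -
        have "s u \<in> topspace M'" "u \<in> U0" using sV[OF that] VY U(3) that by blast+
        then show ?thesis using act(2)[OF h] ps by simp
      qed
    qed (use y in auto)
    then have d: "riemannian_dist M' A' g' (act h y) (act h y') \<le> R" using sp y by simp
    have t: "act h y \<in> topspace M'" "act h y' \<in> topspace M'" using act(3)[OF h] y by auto
    have "f (act h y) \<in> topspace (nsphere n)" "f (act h y') \<in> topspace (nsphere n)"
      using t continuous_map_image_subset_topspace[OF f] by blast+
    then have "L2_set (\<lambda>i. f (act h y) i - f (act h y') i) {..n} \<le> sphere_dist n (f (act h y)) (f (act h y'))"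
      by (rule chord_le_sphere_dist)
    also have "\<dots> \<le> \<epsilon> * riemannian_dist M' A' g' (act h y) (act h y')" using lip t by blast
    also have "\<dots> \<le> \<epsilon> * R" using d e by simp
    finally show "L2_set (\<lambda>i. f (act h y) i - f (act h y') i) {..n} \<le> \<epsilon> * R" .
  qed
  ultimately show ?thesis using U(4) by blast
qed

text \<open>The points that are close to a base point x0 for some R form a set that is open and
  closed, so connectedness reaches all of \<open>M'\<close>; compactness of L then makes R
  uniform.\<close>

theorem bundle_close_compact:
  assumes pb: "principal_bundle G act M' p M" and conn: "connected_space M'" and L: "compactin M' L"
  shows "\<exists>R\<ge>0. \<forall>x\<in>L. \<forall>y\<in>L. bundle_close G act n R x y"
proof (cases "L = {}")
  case False
  then obtain x0 where x0: "x0 \<in> L" by blast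
  have LM: "L \<subseteq> topspace M'" using L compactin_subset_topspace by blast
  have x0M: "x0 \<in> topspace M'" using x0 LM by blast
  let ?B = "bundle_close G act n"
  have loc: "\<exists>V R. openin M' V \<and> x \<in> V \<and> R \<ge> 0 \<and> (\<forall>y\<in>V. \<forall>y'\<in>V. ?B R y y')" if "x \<in> topspace M'" for x
    by (rule bundle_close_local[OF pb that])
  let ?S = "{x \<in> topspace M'. \<exists>R\<ge>0. ?B R x0 x}" and ?T = "{x \<in> topspace M'. \<not> (\<exists>R\<ge>0. ?B R x0 x)}"
  have "openin M' ?S"
  proof (subst openin_subopen, clarify)
    fix x R assume x: "x \<in> topspace M'" "(R::real) \<ge> 0" "?B R x0 x"
    obtain V R' where V: "openin M' V" "x \<in> V" "R' \<ge> 0" "\<forall>y\<in>V. \<forall>y'\<in>V. ?B R' y y'" using loc[OF x(1)] by blast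
    have "V \<subseteq> ?S"
    proof
      fix y assume y: "y \<in> V"
      then have "?B (R + R') x0 y" using bundle_close_trans[OF x(3)] V by blast
      then show "y \<in> ?S" using y V(1,3) x(2) openin_subset by (auto intro!: exI[of _ "R + R'"])
    qed
    then show "\<exists>T. openin M' T \<and> x \<in> T \<and> T \<subseteq> ?S" using V by blast
  qed
  moreover have "openin M' ?T"
  proof (subst openin_subopen, intro ballI)
    fix x assume x: "x \<in> ?T"
    then have xM: "x \<in> topspace M'" by simp
    obtain V R' where V: "openin M' V" "x \<in> V" "R' \<ge> 0" "\<forall>y\<in>V. \<forall>y'\<in>V. ?B R' y y'" using loc[OF xM] by blast
    have "V \<subseteq> ?T"
    proof
      fix y assume y: "y \<in> V"
      have "\<not> ?B R x0 y" if "R \<ge> 0" for R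
      proof
        assume "?B R x0 y"
        then have "?B (R + R') x0 x" using bundle_close_trans V(2,4) y by blast
        then show False using x that V(3) by (auto dest: spec[of _ "R + R'"])
      qed
      then show "y \<in> ?T" using y V(1) openin_subset by blast
    qed
    then show "\<exists>T. openin M' T \<and> x \<in> T \<and> T \<subseteq> ?T" using V by blast
  qed
  moreover have "x0 \<in> ?S"
  proof -
    obtain V R where "x0 \<in> V" "R \<ge> 0" "\<forall>y\<in>V. \<forall>y'\<in>V. ?B R y y'" using loc[OF x0M] by blast
    then show ?thesis using x0M by blast
  qed
  moreover have "?S \<inter> ?T = {}" "topspace M' \<subseteq> ?S \<union> ?T" by blast+
  ultimately have "?T = {}" using conn unfolding connected_space_def by (metis (no_types, lifting) empty_iff)
  then have all: "\<exists>R\<ge>0. ?B R x0 x" if "x \<in> topspace M'" for x using that by blast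
  define W where "W x V R \<longleftrightarrow> openin M' V \<and> x \<in> V \<and> R \<ge> 0 \<and> (\<forall>y\<in>V. ?B R x0 y)" for x V R
  have "\<exists>V R. W x V R" if x: "x \<in> topspace M'" for x
  proof -
    obtain R where R: "R \<ge> 0" "?B R x0 x" using all[OF x] by blast
    obtain V R' where V: "openin M' V" "x \<in> V" "R' \<ge> 0" "\<forall>y\<in>V. \<forall>y'\<in>V. ?B R' y y'" using loc[OF x] by blast
    have "W x V (R + R')" unfolding W_def using R V bundle_close_trans[OF R(2)] by simp
    then show ?thesis by blast
  qed
  then obtain V R where VR: "\<And>x. x \<in> topspace M' \<Longrightarrow> W x (V x) (R x)" by metis
  have "\<exists>\<F>. finite \<F> \<and> \<F> \<subseteq> V ` L \<and> L \<subseteq> \<Union>\<F>"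
    using L VR LM unfolding compactin_def W_def by (elim conjE allE[of _ "V ` L"]) blast
  then obtain F where F: "finite F" "F \<subseteq> L" "L \<subseteq> \<Union>(V ` F)" by (metis finite_subset_image)
  \<comment> \<open>The sum serves as a common bound for the distances to x0. Two points of L are
    compared through x0, whence S + S.\<close>
  define S where "S = (\<Sum>x\<in>F. R x)"
  have Rnn: "R x \<ge> 0" if "x \<in> F" for x using VR[of x] that F(2) LM unfolding W_def by blast
  have mono: "?B r' x y" if "?B r x y" "r \<le> r'" for r r' x y
    using that unfolding bundle_close_def by (meson mult_left_mono less_imp_le order_trans)
  have "?B S x0 y" if y: "y \<in> L" for y
  proof -
    obtain x where x: "x \<in> F" "y \<in> V x" using F(3) y by blast
    then have "?B (R x) x0 y" using VR[of x] F(2) LM unfolding W_def by blast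
    moreover have "R x \<le> S" unfolding S_def using x Rnn F(1) by (intro member_le_sum) auto
    ultimately show ?thesis by (rule mono)
  qed
  then have "\<forall>x\<in>L. \<forall>y\<in>L. ?B (S + S) x y"
    by (intro ballI bundle_close_trans[OF bundle_close_sym])
  moreover have "S \<ge> 0" unfolding S_def using Rnn by (rule sum_nonneg)
  ultimately show ?thesis by (intro exI[of _ "S + S"]) simp
qed auto

end

section \<open>Clearing denominators\<close>

text \<open>Integrality is expressed by the floor function, so that the integral chain can be
  defined by an explicit formula from the rational one.\<close>

lemma finite_common_denominator:
  assumes "finite (S :: rat set)"
  shows "\<exists>k::nat. k \<noteq> 0 \<and> (\<forall>q\<in>S. of_int \<lfloor>of_nat k * q\<rfloor> = of_nat k * q)"
  using assms
proof induction
  case empty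
  then show ?case by (intro exI[of _ 1]) simp
next
  case (insert q S)
  then obtain k :: nat where k: "k \<noteq> 0" "\<forall>q\<in>S. of_int \<lfloor>of_nat k * q\<rfloor> = of_nat k * q" by blast
  obtain a b where q: "q = Fract a b" "b > 0" by (metis Rat_cases)
  have qb: "q = of_int a / of_int b" using q by (simp add: Fract_of_int_quotient)
  have nb: "of_nat (nat b) = (of_int b :: rat)" using q(2) by simp
  have "of_nat (nat b) * q = of_int a" using q(2) by (simp add: qb nb)
  then have "of_nat (k * nat b) * q = of_int (int k * a)" by (simp add: mult.assoc)
  then have 1: "of_int \<lfloor>of_nat (k * nat b) * q\<rfloor> = of_nat (k * nat b) * q" by (simp only: floor_of_int)
  have 2: "of_int \<lfloor>of_nat (k * nat b) * r\<rfloor> = of_nat (k * nat b) * r" if "r \<in> S" for r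
  proof -
    have "of_nat (k * nat b) * r = of_int b * (of_nat k * r)" using nb by simp
    also have "of_nat k * r = of_int \<lfloor>of_nat k * r\<rfloor>" by (rule bspec[OF k(2) that, symmetric])
    also have "of_int b * of_int \<lfloor>of_nat k * r\<rfloor> = of_int (b * \<lfloor>of_nat k * r\<rfloor>)" by simp
    finally show ?thesis by (simp only: floor_of_int)
  qed
  show ?case using 1 2 k(1) q(2) by (intro exI[of _ "k * nat b"]) auto
qed

lemma lookup_frag_of': "Poly_Mapping.lookup (frag_of x) t = (if x = t then 1 else 0)"
  by auto

lemma lookup_rat_chain_boundary:
  assumes "p \<noteq> 0"
  shows "Poly_Mapping.lookup (rat_chain_boundary p c) t =
     (\<Sum>s\<in>Poly_Mapping.keys c. \<Sum>k\<le>p. if singular_face p k s = t then (-1) ^ k * Poly_Mapping.lookup c s else 0)"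
  using assms by (simp add: rat_chain_boundary_def Poly_Mapping.lookup_sum Poly_Mapping.lookup_single when_def)

lemma lookup_chain_boundary:
  assumes "p \<noteq> 0" and S: "finite S" "Poly_Mapping.keys c \<subseteq> S"
  shows "Poly_Mapping.lookup (chain_boundary p c) t =
     (\<Sum>s\<in>S. \<Sum>k\<le>p. if singular_face p k s = t then (-1) ^ k * Poly_Mapping.lookup c s else 0)"
proof -
  have "Poly_Mapping.lookup (chain_boundary p c) t =
    (\<Sum>s\<in>Poly_Mapping.keys c. Poly_Mapping.lookup c s * (\<Sum>k\<le>p. (-1) ^ k * (if singular_face p k s = t then 1 else 0)))"
    using assms(1) by (simp add: chain_boundary_def frag_extend_def Poly_Mapping.lookup_sum lookup_frag_of' del: lookup_frag_of)
  also have "\<dots> = (\<Sum>s\<in>S. Poly_Mapping.lookup c s * (\<Sum>k\<le>p. (-1) ^ k * (if singular_face p k s = t then 1 else 0)))"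
    by (rule sum.mono_neutral_left) (use S in \<open>auto simp: in_keys_iff\<close>)
  also have "\<dots> = (\<Sum>s\<in>S. \<Sum>k\<le>p. if singular_face p k s = t then (-1) ^ k * Poly_Mapping.lookup c s else 0)"
    by (simp add: sum_distrib_left if_distrib mult.commute cong: if_cong)
  finally show ?thesis .
qed

lemma lookup_rat_chain_map:
  "Poly_Mapping.lookup (rat_chain_map p f c) t =
     (\<Sum>s\<in>Poly_Mapping.keys c. if simplex_map p f s = t then Poly_Mapping.lookup c s else 0)"
  by (simp add: rat_chain_map_def Poly_Mapping.lookup_sum Poly_Mapping.lookup_single when_def)

lemma lookup_chain_map:
  "Poly_Mapping.lookup (chain_map p f c) t =
     (\<Sum>s\<in>Poly_Mapping.keys c. if simplex_map p f s = t then Poly_Mapping.lookup c s else 0)"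
  by (simp add: chain_map_def frag_extend_def Poly_Mapping.lookup_sum comp_def if_distrib lookup_frag_of'
    del: lookup_frag_of cong: if_cong)

lemma keys_map_of_int: "Poly_Mapping.keys (Poly_Mapping.map rat_of_int z) = Poly_Mapping.keys z"
  by (auto simp: in_keys_iff Poly_Mapping.map.rep_eq when_def)

lemma lookup_map_of_int: "Poly_Mapping.lookup (Poly_Mapping.map rat_of_int z) s = of_int (Poly_Mapping.lookup z s)"
  by (simp add: Poly_Mapping.map.rep_eq when_def)

text \<open>Multiplying \<open>c\<close> by a common denominator k of its finitely many coefficients
  gives the integral chain d; the two boundaries are compared coefficientwise in the
  rationals.\<close>

lemma rat_boundary_imp_multiple_boundary:
  assumes b: "c \<in> rat_chains (Suc p) X" and eq: "rat_chain_boundary (Suc p) c = Poly_Mapping.map rat_of_int w"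
  obtains k :: nat and d where "k \<noteq> 0" "singular_chain (Suc p) X d" "chain_boundary (Suc p) d = frag_cmul (int k) w"
proof -
  obtain k :: nat where k: "k \<noteq> 0"
    "\<forall>q\<in>Poly_Mapping.lookup c ` Poly_Mapping.keys c. of_int \<lfloor>of_nat k * q\<rfloor> = of_nat k * q"
    using finite_common_denominator[of "Poly_Mapping.lookup c ` Poly_Mapping.keys c"] by auto
  define d where "d = Poly_Mapping.map (\<lambda>q. \<lfloor>of_nat k * q\<rfloor>) c"
  have ld: "of_int (Poly_Mapping.lookup d s) = of_nat k * Poly_Mapping.lookup c s" for s
    using k(2) by (cases "s \<in> Poly_Mapping.keys c") (auto simp: d_def Poly_Mapping.map.rep_eq when_def in_keys_iff)
  have kd: "Poly_Mapping.keys d \<subseteq> Poly_Mapping.keys c"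
    by (auto simp: d_def in_keys_iff Poly_Mapping.map.rep_eq when_def)
  have "Poly_Mapping.lookup (chain_boundary (Suc p) d) t = Poly_Mapping.lookup (frag_cmul (int k) w) t" for t
  proof -
    have "(of_int (Poly_Mapping.lookup (chain_boundary (Suc p) d) t) :: rat) =
       (\<Sum>s\<in>Poly_Mapping.keys c. \<Sum>i\<le>Suc p. if singular_face (Suc p) i s = t then (-1) ^ i * of_int (Poly_Mapping.lookup d s) else 0)"
      by (subst lookup_chain_boundary[OF _ finite_keys kd]) (auto simp: of_int_sum if_distrib simp del: sum.atMost_Suc cong: if_cong intro!: sum.cong)
    also have "\<dots> = of_nat k * Poly_Mapping.lookup (rat_chain_boundary (Suc p) c) t"
      by (subst lookup_rat_chain_boundary) (auto simp: ld sum_distrib_left if_distrib mult.left_commute simp del: sum.atMost_Suc cong: if_cong intro!: sum.cong)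
    also have "\<dots> = of_int (Poly_Mapping.lookup (frag_cmul (int k) w) t)"
      unfolding eq lookup_map_of_int by simp
    finally show ?thesis by (simp only: of_int_eq_iff)
  qed
  then have "chain_boundary (Suc p) d = frag_cmul (int k) w" by (rule poly_mapping_eqI)
  moreover have "singular_chain (Suc p) X d" using b kd by (auto simp: rat_chains_def singular_chain_def)
  ultimately show thesis using that k(1) by blast
qed

text \<open>The maps on classes are unions over representatives, so the image of the representative
  \<open>z\<close> belongs to the resulting set, which by assumption is the set of
  boundaries.\<close>

lemma rat_hom_induced_trivial_imp_multiple_boundary:
  assumes "rat_hom_induced p X Y f (rationalize p X (homologous_rel_set p X {} z)) = \<one>\<^bsub>rat_homology_group p Y\<^esub>"
  obtains k :: nat and d where "k \<noteq> 0" "singular_chain (Suc p) Y d"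
    "chain_boundary (Suc p) d = frag_cmul (int k) (chain_map p f z)"
proof -
  have zero: "0 \<in> rat_boundaries p Z" for Z :: "'z topology"
    unfolding rat_boundaries_def by (rule image_eqI[of _ _ 0]) (auto simp: rat_chain_boundary_def rat_chains_def)
  have self: "w \<in> rat_homology_class p Z w" for Z :: "'z topology" and w
    unfolding rat_homology_class_def r_coset_def using zero[of Z] by (auto simp: rat_cycle_group_def)
  let ?z = "Poly_Mapping.map rat_of_int z"
  have "?z \<in> rationalize p X (homologous_rel_set p X {} z)"
    unfolding rationalize_def using self[of ?z X] by (intro UN_I[of z]) auto
  then have "rat_chain_map p f ?z \<in> rat_hom_induced p X Y f (rationalize p X (homologous_rel_set p X {} z))"
    unfolding rat_hom_induced_def using self[of "rat_chain_map p f ?z" Y] by blast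
  also have "\<dots> = rat_boundaries p Y" using assms by (simp add: rat_homology_group_def FactGroup_def)
  finally obtain c where c: "c \<in> rat_chains (Suc p) Y" "rat_chain_boundary (Suc p) c = rat_chain_map p f ?z"
    unfolding rat_boundaries_def by auto
  have "rat_chain_map p f ?z = Poly_Mapping.map rat_of_int (chain_map p f z)"
  proof (rule poly_mapping_eqI)
    fix t
    show "Poly_Mapping.lookup (rat_chain_map p f ?z) t = Poly_Mapping.lookup (Poly_Mapping.map rat_of_int (chain_map p f z)) t"
      by (simp add: lookup_rat_chain_map lookup_map_of_int lookup_chain_map keys_map_of_int of_int_sum if_distrib cong: if_cong)
  qed
  then show thesis using rat_boundary_imp_multiple_boundary[OF c(1)] c(2) that by metis
qed

section \<open>Straightening along the classifying map\<close>

lemma simplicial_vertex_in_topspace: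
  assumes "singular_simplex m X \<tau>" "j \<le> m"
  shows "simplicial_vertex j \<tau> \<in> topspace X"
  using assms by (auto simp: simplicial_vertex_def singular_simplex_def continuous_map_def Pi_iff)

lemma simplex_lifts_nonempty:
  assumes cov: "covering_map Y p X" and \<sigma>: "singular_simplex n X \<sigma>"
  shows "\<exists>\<tau>. \<tau> \<in> simplex_lifts n Y p \<sigma>"
proof -
  obtain v where v: "v \<in> standard_simplex n" using nonempty_standard_simplex by blast
  have "\<sigma> v \<in> topspace X" using \<sigma> v by (auto simp: singular_simplex_def continuous_map_def)
  then have "\<sigma> v \<in> p ` topspace Y" using cov by (simp add: covering_map_def)
  then obtain y where "y \<in> topspace Y" "p y = \<sigma> v" by auto
  then show ?thesis using simplex_lift_exists[OF cov \<sigma> v] by metis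
qed

lemma keys_transfer_lifts:
  assumes "\<tau> \<in> Poly_Mapping.keys (transfer n Y p T c)"
  obtains \<sigma> where "\<sigma> \<in> Poly_Mapping.keys c" "\<tau> \<in> simplex_lifts n Y p \<sigma>" "T \<tau>"
proof -
  have "Poly_Mapping.keys (transfer n Y p T c) \<subseteq> (\<Union>\<sigma>\<in>Poly_Mapping.keys c. {\<tau> \<in> simplex_lifts n Y p \<sigma>. T \<tau>})"
    unfolding transfer_def
    by (rule order_trans[OF keys_frag_extend], rule UN_mono[OF subset_refl], rule order_trans[OF keys_sum_frag_of]) simp
  then show thesis using assms that by blast
qed

lemma chain_of_simplex_map_chain_map:
  "chain_of_simplex_map F (chain_map m g x) = chain_of_simplex_map (F \<circ> simplex_map m g) x"
  unfolding chain_of_simplex_map_def chain_map_def using frag_extend_compose[of "\<lambda>\<tau>. frag_of (F \<tau>)"]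
  by (simp add: comp_def)

definition open_halfspace :: "nat \<Rightarrow> (nat \<Rightarrow> real) \<Rightarrow> (nat \<Rightarrow> real) set" where
  "open_halfspace n a = {x. (\<forall>i>n. x i = 0) \<and> (\<Sum>i\<le>n. x i * a i) > 0}"

text \<open>This is R^{n+1} without the origin, in the coordinates of \<open>nsphere n\<close>:
  indices up to \<open>n\<close> are used and all others vanish.\<close>

definition punctured_space :: "nat \<Rightarrow> (nat \<Rightarrow> real) topology" where
  "punctured_space n = subtopology (powertop_real UNIV) {x. (\<forall>i>n. x i = 0) \<and> (\<exists>i\<le>n. x i \<noteq> 0)}"

lemma fun_convex_open_halfspace: "fun_convex (open_halfspace n a)"
  unfolding fun_convex_def
proof (intro ballI allI impI)
  fix x y and u :: real assume x: "x \<in> open_halfspace n a" and y: "y \<in> open_halfspace n a" and u: "0 \<le> u" "u \<le> 1"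
  have "(\<Sum>i\<le>n. ((1 - u) * x i + u * y i) * a i) = (\<Sum>i\<le>n. (1 - u) * (x i * a i) + u * (y i * a i))"
    by (rule sum.cong) (auto simp: algebra_simps)
  also have "\<dots> = (1 - u) * (\<Sum>i\<le>n. x i * a i) + u * (\<Sum>i\<le>n. y i * a i)"
    by (simp add: sum.distrib sum_distrib_left)
  also have "\<dots> > 0"
  proof (cases "u = 0")
    case False
    then have "u * (\<Sum>i\<le>n. y i * a i) > 0" using y u by (simp add: open_halfspace_def)
    moreover have "(1 - u) * (\<Sum>i\<le>n. x i * a i) \<ge> 0" using x u by (simp add: open_halfspace_def)
    ultimately show ?thesis by simp
  qed (use x in \<open>simp add: open_halfspace_def\<close>)
  finally show "(\<lambda>i. (1 - u) * x i + u * y i) \<in> open_halfspace n a"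
    using x y by (simp add: open_halfspace_def)
qed

lemma open_halfspace_subset: "open_halfspace n a \<subseteq> {x. (\<forall>i>n. x i = 0) \<and> (\<exists>i\<le>n. x i \<noteq> 0)}"
  unfolding open_halfspace_def by (auto intro: ccontr)

lemma nsphere_self_halfspace: "u \<in> topspace (nsphere n) \<Longrightarrow> u \<in> open_halfspace n u"
  by (simp add: open_halfspace_def nsphere power2_eq_square)

lemma subtopology_punctured_space:
  assumes "S \<subseteq> open_halfspace n a"
  shows "subtopology (punctured_space n) S = subtopology (powertop_real UNIV) S"
proof -
  have "S \<subseteq> {x. (\<forall>i>n. x i = 0) \<and> (\<exists>i\<le>n. x i \<noteq> 0)}" using assms open_halfspace_subset by (rule order_trans)
  then show ?thesis unfolding punctured_space_def subtopology_subtopology by (simp only: Int_absorb1)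
qed

lemma punctured_space_retraction:
  obtains r where "continuous_map (punctured_space n) (nsphere n) r" "\<forall>x\<in>topspace (nsphere n). r x = x"
proof -
  define N where "N x = sqrt (\<Sum>i\<le>n. (x i)\<^sup>2)" for x :: "nat \<Rightarrow> real"
  define r where "r x = (\<lambda>i. x i / N x)" for x :: "nat \<Rightarrow> real"
  have pos: "(\<Sum>i\<le>n. (x i)\<^sup>2) > 0" if x: "x \<in> topspace (punctured_space n)" for x
  proof -
    obtain i where "i \<le> n" "x i \<noteq> 0" using x by (auto simp: punctured_space_def)
    then show ?thesis by (intro sum_pos2[of _ i]) auto
  qed
  have ci: "continuous_map (punctured_space n) euclideanreal (\<lambda>x. x i)" for i
    unfolding punctured_space_def by (intro continuous_map_from_subtopology continuous_map_product_projection) auto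
  have cN: "continuous_map (punctured_space n) euclideanreal N"
    unfolding N_def by (intro continuous_map_sqrt continuous_map_sum continuous_map_real_pow ci) auto
  have Nnz: "N x \<noteq> 0" if "x \<in> topspace (punctured_space n)" for x
    using pos[OF that] by (simp add: N_def)
  have "continuous_map (punctured_space n) (powertop_real UNIV) r"
    unfolding continuous_map_componentwise_UNIV r_def
    by (intro allI continuous_map_real_divide ci cN Nnz)
  moreover have "r x \<in> {x. (\<Sum>i\<le>n. (x i)\<^sup>2) = 1 \<and> (\<forall>i>n. x i = 0)}" if x: "x \<in> topspace (punctured_space n)" for x
  proof -
    have "(\<Sum>i\<le>n. (r x i)\<^sup>2) = (\<Sum>i\<le>n. (x i)\<^sup>2) / (N x)\<^sup>2"
      by (simp add: r_def power_divide sum_divide_distrib)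
    also have "(N x)\<^sup>2 = (\<Sum>i\<le>n. (x i)\<^sup>2)" using pos[OF x] by (simp add: N_def)
    finally show ?thesis using pos[OF x] x by (simp add: r_def punctured_space_def)
  qed
  ultimately have "continuous_map (punctured_space n) (nsphere n) r"
    unfolding nsphere continuous_map_in_subtopology by blast
  moreover have "r x = x" if "x \<in> topspace (nsphere n)" for x
    using that by (simp add: r_def N_def nsphere)
  ultimately show thesis using that by blast
qed

lemma singular_chain_constant:
  assumes "\<And>\<tau>. \<tau> \<in> Poly_Mapping.keys c \<Longrightarrow> \<exists>X. singular_simplex m X (F \<tau>)" "q0 \<in> topspace T"
    and "\<And>\<tau> s. \<tau> \<in> Poly_Mapping.keys c \<Longrightarrow> s \<in> standard_simplex m \<Longrightarrow> F \<tau> s = q0"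
  shows "singular_chain m (subtopology T {q0}) (chain_of_simplex_map F c)"
proof (rule singular_chain_chain_of_simplex_map)
  fix \<tau> assume t: "\<tau> \<in> Poly_Mapping.keys c"
  obtain X where "singular_simplex m X (F \<tau>)" using assms(1)[OF t] by blast
  then have "F \<tau> = restrict (\<lambda>_. q0) (standard_simplex m)"
    using assms(3)[OF t] by (auto simp: singular_simplex_def extensional_def fun_eq_iff)
  then show "singular_simplex m (subtopology T {q0}) (F \<tau>)"
    using singular_simplex_singleton[of "subtopology T {q0}" q0 m "F \<tau>"] assms(2) by auto
qed

section \<open>Comparison of a map to the sphere with its straightening\<close>

locale bundle_comparison =
  fixes G :: "'g monoid" and act :: "'g \<Rightarrow> 'b \<Rightarrow> 'b" and M' :: "'b topology" and p :: "'b \<Rightarrow> 'a" and M :: "'a topology"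
    and actE :: "'g \<Rightarrow> 'c \<Rightarrow> 'c" and E :: "'c topology" and q :: "'c \<Rightarrow> 'd" and B :: "'d topology"
    and C :: "'b \<Rightarrow> 'c" and c :: "'a \<Rightarrow> 'd" and \<theta> :: "'c \<Rightarrow> 'b"
    and f :: "'b \<Rightarrow> nat \<Rightarrow> real" and q0 :: "nat \<Rightarrow> real" and K :: "'b set" and n :: nat
  assumes pbM: "principal_bundle G act M' p M" and pbE: "principal_bundle G actE E q B"
    and M: "Hausdorff_space M"
    and C: "continuous_map M' E C" and C_act: "\<And>g y. g \<in> carrier G \<Longrightarrow> y \<in> topspace M' \<Longrightarrow> C (act g y) = actE g (C y)"
    and qC: "\<And>y. y \<in> topspace M' \<Longrightarrow> q (C y) = c (p y)"
    and \<theta>: "\<And>x. x \<in> topspace E \<Longrightarrow> \<theta> x \<in> topspace M'"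
    and \<theta>_act: "\<And>g x. g \<in> carrier G \<Longrightarrow> x \<in> topspace E \<Longrightarrow> \<theta> (actE g x) = act g (\<theta> x)"
    and f: "continuous_map M' (nsphere n) f" and q0: "q0 \<in> topspace (nsphere n)"
    and K: "compactin M' K" and const: "\<And>x. x \<in> topspace M' \<Longrightarrow> x \<notin> K \<Longrightarrow> f x = q0"
begin

lemmas DM = principal_bundleD[OF pbM]
lemmas DE = principal_bundleD[OF pbE]

text \<open>The truncation predicate on the side of \<open>E\<close>: if it fails, the straightened
  simplex is constantly \<open>q0\<close>. It looks only at vertices, because
  \<open>\<theta>\<close> is under no control in between.\<close>

definition moving :: "nat \<Rightarrow> ((nat \<Rightarrow> real) \<Rightarrow> 'c) \<Rightarrow> bool" where
  "moving m \<rho> \<longleftrightarrow> (\<exists>j\<le>m. f (\<theta> (simplicial_vertex j \<rho>)) \<noteq> q0)"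

definition straight :: "nat \<Rightarrow> ((nat \<Rightarrow> real) \<Rightarrow> 'c) \<Rightarrow> (nat \<Rightarrow> real) \<Rightarrow> nat \<Rightarrow> real" where
  "straight m \<rho> = oriented_simplex m (\<lambda>j. f (\<theta> (simplicial_vertex j \<rho>)))"

lemma straight_const:
  assumes "\<not> moving m \<rho>" "s \<in> standard_simplex m"
  shows "straight m \<rho> s = q0"
proof -
  have "straight m \<rho> s = (\<lambda>i. \<Sum>j\<le>m. q0 i * s j)"
    using assms unfolding straight_def oriented_simplex_def moving_def by (auto simp: fun_eq_iff)
  also have "\<dots> = q0" using assms(2) by (simp add: sum_distrib_left[symmetric] standard_simplex_def)
  finally show ?thesis .
qed

lemma straight_simplex: "\<exists>X. singular_simplex m X (straight m \<rho>)"
  using singular_simplex_oriented_simplex[OF fun_convex_UNIV] unfolding straight_def by blast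

text \<open>The lifts form one orbit, and for a moving translate by g some point g \<theta>(v),
  where v is a vertex of the fixed lift, lies in \<open>K\<close>. Properness of the action on
  \<open>M'\<close> leaves finitely many g.\<close>

lemma finite_moving_lifts: "finite {\<rho> \<in> simplex_lifts m E q \<sigma>. moving m \<rho>}"
proof (cases "simplex_lifts m E q \<sigma> = {}")
  case False
  then obtain \<rho> where r: "\<rho> \<in> simplex_lifts m E q \<sigma>" by blast
  then have sr: "singular_simplex m E \<rho>" by (simp add: simplex_lifts_def)
  let ?v = "\<lambda>j. \<theta> (simplicial_vertex j \<rho>)"
  have v: "simplicial_vertex j \<rho> \<in> topspace E" "?v j \<in> topspace M'" if "j \<le> m" for j
    using simplicial_vertex_in_topspace[OF sr that] \<theta> by auto
  have sub: "{\<rho> \<in> simplex_lifts m E q \<sigma>. moving m \<rho>} \<subseteq>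
     (\<lambda>g. simplex_map m (actE g) \<rho>) ` (\<Union>j\<le>m. {g \<in> carrier G. act g ` {?v j} \<inter> K \<noteq> {}})"
  proof
    fix \<rho>' assume "\<rho>' \<in> {\<rho> \<in> simplex_lifts m E q \<sigma>. moving m \<rho>}"
    then obtain g j where g: "g \<in> carrier G" "\<rho>' = simplex_map m (actE g) \<rho>" and j: "j \<le> m" "f (\<theta> (simplicial_vertex j \<rho>')) \<noteq> q0"
      using simplex_lifts_orbit[OF pbE r] unfolding moving_def by blast
    have "\<theta> (simplicial_vertex j \<rho>') = act g (?v j)"
      using g j(1) \<theta>_act[OF g(1) v(1)[OF j(1)]] by (simp add: simplicial_vertex_simplex_map)
    then have "act g (?v j) \<in> K" using j(2) const DM(6)[OF g(1) v(2)[OF j(1)]] by metis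
    then show "\<rho>' \<in> (\<lambda>g. simplex_map m (actE g) \<rho>) ` (\<Union>j\<le>m. {g \<in> carrier G. act g ` {?v j} \<inter> K \<noteq> {}})"
      using g j(1) by blast
  qed
  have fin: "finite {g \<in> carrier G. act g ` {?v j} \<inter> K \<noteq> {}}" if "j \<le> m" for j
    by (rule principal_bundle_proper[OF pbM M _ K]) (use v[OF that] in simp)
  then have "finite (\<Union>j\<le>m. {g \<in> carrier G. act g ` {?v j} \<inter> K \<noteq> {}})"
    by (intro finite_UN_I[OF finite_atMost] fin) (simp only: atMost_iff)
  with sub show ?thesis by (rule finite_subset[OF _ finite_imageI])
qed simp

lemma moving_face:
  assumes "k \<le> Suc m" "moving m (singular_face (Suc m) k \<rho>)"
  shows "moving (Suc m) \<rho>"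
proof -
  obtain j where j: "j \<le> m" "f (\<theta> (simplicial_vertex j (singular_face (Suc m) k \<rho>))) \<noteq> q0"
    using assms(2) by (auto simp: moving_def)
  then have "f (\<theta> (simplicial_vertex (if j < k then j else Suc j) \<rho>)) \<noteq> q0"
    using simplicial_vertex_singular_face[OF j(1), of k \<rho>] by metis
  then show ?thesis unfolding moving_def using j(1) by (intro exI[of _ "if j < k then j else Suc j"]) auto
qed

text \<open>\<open>C\<close> identifies the fibres of \<open>M'\<close> with those of
  \<open>E\<close> equivariantly, so it carries the orbit of lifts of \<sigma> to the orbit of lifts
  of its image. Freeness of the action on \<open>E\<close> gives injectivity.\<close>

lemma bij_betw_lifts:
  assumes \<sigma>: "singular_simplex m M \<sigma>"
  shows "bij_betw (simplex_map m C) (simplex_lifts m M' p \<sigma>) (simplex_lifts m E q (simplex_map m c \<sigma>))"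
proof -
  obtain v where v: "v \<in> standard_simplex m" using nonempty_standard_simplex by blast
  obtain \<tau> where t: "\<tau> \<in> simplex_lifts m M' p \<sigma>" using simplex_lifts_nonempty[OF DM(1) \<sigma>] by blast
  have st: "singular_simplex m M' \<tau>" "simplex_map m p \<tau> = \<sigma>" using t by (auto simp: simplex_lifts_def)
  have tM: "\<tau> s \<in> topspace M'" if "s \<in> standard_simplex m" for s
    using st that by (auto simp: singular_simplex_def continuous_map_def)
  have CE: "C y \<in> topspace E" if "y \<in> topspace M'" for y
    using continuous_map_image_subset_topspace[OF C] that by blast
  have "simplex_map m q (simplex_map m C \<tau>) = simplex_map m c \<sigma>"
    unfolding st(2)[symmetric] using tM qC by (auto simp: simplex_map_def fun_eq_iff)
  then have Ct: "simplex_map m C \<tau> \<in> simplex_lifts m E q (simplex_map m c \<sigma>)"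
    using singular_simplex_simplex_map[OF st(1) C] by (simp add: simplex_lifts_def)
  have comm: "simplex_map m C (simplex_map m (act g) \<tau>) = simplex_map m (actE g) (simplex_map m C \<tau>)" if "g \<in> carrier G" for g
    using tM C_act[OF that] by (auto simp: simplex_map_def fun_eq_iff)
  show ?thesis
    unfolding bij_betw_def simplex_lifts_orbit[OF pbM t] simplex_lifts_orbit[OF pbE Ct]
  proof
    show "simplex_map m C ` (\<lambda>g. simplex_map m (act g) \<tau>) ` carrier G = (\<lambda>g. simplex_map m (actE g) (simplex_map m C \<tau>)) ` carrier G"
      unfolding image_image using comm by (intro image_cong) auto
    show "inj_on (simplex_map m C) ((\<lambda>g. simplex_map m (act g) \<tau>) ` carrier G)"
    proof (rule inj_onI, elim imageE, hypsubst)
      fix g h assume gh: "g \<in> carrier G" "h \<in> carrier G"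
        and eq: "simplex_map m C (simplex_map m (act g) \<tau>) = simplex_map m C (simplex_map m (act h) \<tau>)"
      have "actE g (C (\<tau> v)) = actE h (C (\<tau> v))"
        using fun_cong[OF eq, of v] v C_act[OF gh(1) tM[OF v]] C_act[OF gh(2) tM[OF v]] by (simp add: simplex_map_def)
      moreover have "\<exists>!k. k \<in> carrier G \<and> actE k (C (\<tau> v)) = actE h (C (\<tau> v))"
        using DE(5)[OF CE[OF tM[OF v]] DE(6)[OF gh(2) CE[OF tM[OF v]]]] DE(4)[OF gh(2) CE[OF tM[OF v]]] by simp
      ultimately have "g = h" using gh by blast
      then show "simplex_map m (act g) \<tau> = simplex_map m (act h) \<tau>" by simp
    qed
  qed
qed

abbreviation movingM where "movingM m \<tau> \<equiv> moving m (simplex_map m C \<tau>)"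

lemma finite_movingM_lifts:
  assumes "singular_simplex m M \<sigma>"
  shows "finite {\<tau> \<in> simplex_lifts m M' p \<sigma>. movingM m \<tau>}"
proof (rule inj_on_finite)
  show "inj_on (simplex_map m C) {\<tau> \<in> simplex_lifts m M' p \<sigma>. movingM m \<tau>}"
    using bij_betw_lifts[OF assms] by (auto simp: bij_betw_def intro: inj_on_subset)
  show "simplex_map m C ` {\<tau> \<in> simplex_lifts m M' p \<sigma>. movingM m \<tau>} \<subseteq> {\<rho> \<in> simplex_lifts m E q (simplex_map m c \<sigma>). moving m \<rho>}"
    using bij_betw_lifts[OF assms] by (auto simp: bij_betw_def)
qed (rule finite_moving_lifts)

text \<open>The transfer is natural for maps of principal bundles, since the summands on both sides
  correspond under the bijection of lifts.\<close>

lemma transfer_chain_map: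
  assumes z: "singular_chain m M z"
  shows "transfer m E q (moving m) (chain_map m c z) = chain_map m C (transfer m M' p (movingM m) z)"
  using z unfolding singular_chain_def
proof (induction z rule: frag_induction)
  case (one \<sigma>)
  then have \<sigma>: "singular_simplex m M \<sigma>" by simp
  let ?S = "{\<tau> \<in> simplex_lifts m M' p \<sigma>. movingM m \<tau>}"
  have im: "{\<rho> \<in> simplex_lifts m E q (simplex_map m c \<sigma>). moving m \<rho>} = simplex_map m C ` ?S"
    using bij_betw_lifts[OF \<sigma>] by (auto simp: bij_betw_def)
  have inj: "inj_on (simplex_map m C) ?S"
    using bij_betw_lifts[OF \<sigma>] by (auto simp: bij_betw_def intro: inj_on_subset)
  show ?case
    unfolding chain_map_of transfer_of im chain_map_sum[OF finite_movingM_lifts[OF \<sigma>]]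
    by (simp add: sum.reindex[OF inj])
qed (simp_all add: transfer_diff chain_map_diff)

text \<open>The target of the comparison is a punctured space rather than the sphere, because there the
  carriers can be taken convex.\<close>

definition carrier_set :: "nat \<Rightarrow> ((nat \<Rightarrow> real) \<Rightarrow> 'b) \<Rightarrow> (nat \<Rightarrow> real) set" where
  "carrier_set m \<tau> = (\<lambda>s. f (\<tau> s)) ` standard_simplex m \<union> (\<lambda>j. f (\<theta> (C (simplicial_vertex j \<tau>)))) ` {..m}"

text \<open>The common open half-space is convex and misses the origin; therefore the convex hull of
  all values stays in the punctured space.\<close>

definition small_simplices :: "nat \<Rightarrow> ((nat \<Rightarrow> real) \<Rightarrow> 'b) set" where
  "small_simplices m = {\<tau>. singular_simplex m M' \<tau> \<and> (\<exists>a. carrier_set m \<tau> \<subseteq> open_halfspace n a)}"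

lemma carrier_set_face:
  assumes "k \<le> Suc m"
  shows "carrier_set m (singular_face (Suc m) k \<tau>) \<subseteq> carrier_set (Suc m) \<tau>"
proof -
  have "(\<lambda>s. f (singular_face (Suc m) k \<tau> s)) ` standard_simplex m \<subseteq> (\<lambda>s. f (\<tau> s)) ` standard_simplex (Suc m)"
    using simplical_face_in_standard_simplex[of "Suc m" k] assms by (auto simp: singular_face_def)
  moreover have "(\<lambda>j. f (\<theta> (C (simplicial_vertex j (singular_face (Suc m) k \<tau>))))) ` {..m} \<subseteq> (\<lambda>j. f (\<theta> (C (simplicial_vertex j \<tau>)))) ` {..Suc m}"
    using simplicial_vertex_singular_face[of _ m k \<tau>] by (auto intro!: imageI)
  ultimately show ?thesis unfolding carrier_set_def by blast
qed

text \<open>The two maps to be compared are composition with \<open>f\<close> and straightening. The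
  convex hull of the values of both contains both images and is contractible, and passing to a face
  only removes values.\<close>

sublocale acyclic_carriers "punctured_space n" small_simplices "\<lambda>m \<tau>. fun_convex hull carrier_set m \<tau>"
  "\<lambda>m. simplex_map m f" "\<lambda>m \<tau>. straight m (simplex_map m C \<tau>)"
proof
  have sub: "subtopology (punctured_space n) (fun_convex hull carrier_set m \<tau>) = subtopology (powertop_real UNIV) (fun_convex hull carrier_set m \<tau>)"
    if t: "\<tau> \<in> small_simplices m" for m \<tau>
  proof -
    obtain a where "carrier_set m \<tau> \<subseteq> open_halfspace n a" using t by (auto simp: small_simplices_def)
    then have "fun_convex hull carrier_set m \<tau> \<subseteq> open_halfspace n a" by (rule hull_minimal[where S=fun_convex, OF _ fun_convex_open_halfspace])
    then show ?thesis by (rule subtopology_punctured_space)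
  qed
  fix m \<tau>
  show "\<exists>X. singular_simplex m X \<tau>" if "\<tau> \<in> small_simplices m" using that by (auto simp: small_simplices_def)
  show "contractible_space (subtopology (punctured_space n) (fun_convex hull carrier_set m \<tau>))" if t: "\<tau> \<in> small_simplices m"
    unfolding sub[OF t] by (intro fun_convex_imp_contractible fun_convex_hull)
  show "singular_simplex m (subtopology (punctured_space n) (fun_convex hull carrier_set m \<tau>)) (simplex_map m f \<tau>)"
    if t: "\<tau> \<in> small_simplices m"
  proof -
    have "singular_simplex m (nsphere n) (simplex_map m f \<tau>)"
      using singular_simplex_simplex_map[OF _ f] t by (auto simp: small_simplices_def)
    then have "singular_simplex m (powertop_real UNIV) (simplex_map m f \<tau>)"
      unfolding nsphere singular_simplex_subtopology by blast
    moreover have "simplex_map m f \<tau> ` standard_simplex m \<subseteq> fun_convex hull carrier_set m \<tau>"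
      using hull_subset[of "carrier_set m \<tau>" fun_convex] by (auto simp: carrier_set_def simplex_map_def)
    ultimately show ?thesis unfolding sub[OF t] singular_simplex_subtopology by blast
  qed
  show "singular_simplex m (subtopology (punctured_space n) (fun_convex hull carrier_set m \<tau>)) (straight m (simplex_map m C \<tau>))"
    if t: "\<tau> \<in> small_simplices m"
    unfolding sub[OF t] straight_def
  proof (rule singular_simplex_oriented_simplex[OF fun_convex_hull])
    fix j assume "j \<le> m"
    then have "f (\<theta> (simplicial_vertex j (simplex_map m C \<tau>))) \<in> carrier_set m \<tau>"
      by (auto simp: carrier_set_def simplicial_vertex_simplex_map)
    then show "f (\<theta> (simplicial_vertex j (simplex_map m C \<tau>))) \<in> fun_convex hull carrier_set m \<tau>" by (rule hull_inc)
  qed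
  fix k
  assume t: "\<tau> \<in> small_simplices (Suc m)" and k: "k \<le> Suc m"
  have st: "singular_simplex (Suc m) M' \<tau>" using t by (simp add: small_simplices_def)
  show "singular_face (Suc m) k \<tau> \<in> small_simplices m"
    using singular_simplex_singular_face[OF st, of k] k t carrier_set_face[OF k, of \<tau>]
    unfolding small_simplices_def by auto
  show "fun_convex hull carrier_set m (singular_face (Suc m) k \<tau>) \<subseteq> fun_convex hull carrier_set (Suc m) \<tau>"
    by (rule hull_mono[OF carrier_set_face[OF k]])
  show "simplex_map m f (singular_face (Suc m) k \<tau>) = singular_face (Suc m) k (simplex_map (Suc m) f \<tau>)"
    by (rule simplex_map_singular_face[OF k])
  show "straight m (simplex_map m C (singular_face (Suc m) k \<tau>)) = singular_face (Suc m) k (straight (Suc m) (simplex_map (Suc m) C \<tau>))"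
    unfolding simplex_map_singular_face[OF k] straight_def by (rule singular_face_oriented_vertices[OF k])
qed

end

context bundle_comparison
begin

text \<open>
  A simplex that is not \<open>nonconstant\<close> has carrier \<open>{q0}\<close>; this is why the clause \<open>movingM\<close> is included.
\<close>

definition nonconstant :: "nat \<Rightarrow> ((nat \<Rightarrow> real) \<Rightarrow> 'b) \<Rightarrow> bool" where
  "nonconstant m \<tau> \<longleftrightarrow> (\<exists>s\<in>standard_simplex m. f (\<tau> s) \<noteq> q0) \<or> movingM m \<tau>"

lemma finite_meets_lifts: "finite {\<tau> \<in> simplex_lifts m M' p \<sigma>. meets K m \<tau>}"
  unfolding meets_def by (rule finite_lifts_meeting_compact[OF pbM M K])

lemma nonconstant_imp:
  assumes "singular_simplex m M' \<tau>" "nonconstant m \<tau>"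
  shows "meets K m \<tau> \<or> movingM m \<tau>"
proof (rule ccontr)
  assume not: "\<not> (meets K m \<tau> \<or> movingM m \<tau>)"
  then obtain s where s: "s \<in> standard_simplex m" "f (\<tau> s) \<noteq> q0" using assms(2) by (auto simp: nonconstant_def)
  have "\<tau> s \<in> topspace M'" using assms(1) s(1) by (auto simp: singular_simplex_def continuous_map_def)
  then have "\<tau> s \<in> K" using const s(2) by blast
  then show False using not s(1) by (auto simp: meets_def)
qed

lemma finite_nonconstant_lifts:
  assumes "singular_simplex m M \<sigma>"
  shows "finite {\<tau> \<in> simplex_lifts m M' p \<sigma>. nonconstant m \<tau>}"
proof (rule finite_subset)
  show "{\<tau> \<in> simplex_lifts m M' p \<sigma>. nonconstant m \<tau>} \<subseteq>
    {\<tau> \<in> simplex_lifts m M' p \<sigma>. meets K m \<tau>} \<union> {\<tau> \<in> simplex_lifts m M' p \<sigma>. movingM m \<tau>}"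
    using nonconstant_imp by (auto simp: simplex_lifts_def)
qed (use finite_meets_lifts finite_movingM_lifts[OF assms] in simp)

lemma nonconstant_face:
  assumes k: "k \<le> Suc m" and nc: "nonconstant m (singular_face (Suc m) k \<tau>)"
  shows "nonconstant (Suc m) \<tau>"
proof (cases "movingM m (singular_face (Suc m) k \<tau>)")
  case True
  then have "movingM (Suc m) \<tau>"
    unfolding simplex_map_singular_face[OF k] by (rule moving_face[OF k])
  then show ?thesis by (simp add: nonconstant_def)
next
  case False
  then obtain s where s: "s \<in> standard_simplex m" "f (singular_face (Suc m) k \<tau> s) \<noteq> q0"
    using nc by (auto simp: nonconstant_def)
  then have "f (\<tau> (simplical_face k s)) \<noteq> q0" by (simp add: singular_face_def)
  moreover have "simplical_face k s \<in> standard_simplex (Suc m)"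
    using simplical_face_in_standard_simplex[of "Suc m" k s] k s(1) by simp
  ultimately show ?thesis by (auto simp: nonconstant_def)
qed

lemma constant_carrier:
  assumes "\<not> nonconstant m \<tau>"
  shows "carrier_set m \<tau> \<subseteq> {q0}" "fun_convex hull carrier_set m \<tau> \<subseteq> {q0}"
proof -
  have "f (\<theta> (C (simplicial_vertex j \<tau>))) = q0" if "j \<le> m" for j
    using assms that simplicial_vertex_simplex_map[OF that, of C \<tau>] by (auto simp: nonconstant_def moving_def)
  then show 1: "carrier_set m \<tau> \<subseteq> {q0}"
    using assms by (auto simp: carrier_set_def nonconstant_def)
  show "fun_convex hull carrier_set m \<tau> \<subseteq> {q0}"
    by (rule hull_minimal[where S=fun_convex, OF 1 fun_convex_singleton])
qed

lemma q0_punctured: "q0 \<in> topspace (punctured_space n)"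
  using nsphere_self_halfspace[OF q0] open_halfspace_subset by (auto simp: punctured_space_def)

text \<open>Since \<open>z\<close> is a cycle, the boundary of its truncated transfer consists of
  faces on which both maps are constantly \<open>q0\<close>. Their carriers lie in {q0}, so the
  homotopy contributes nothing there modulo \<open>q0\<close>.\<close>

lemma straight_homologous:
  assumes n: "n \<noteq> 0" and z: "singular_relcycle n M {} z"
    and small: "\<And>\<sigma> \<tau>. \<sigma> \<in> Poly_Mapping.keys z \<Longrightarrow> \<tau> \<in> simplex_lifts n M' p \<sigma> \<Longrightarrow> \<exists>a. carrier_set n \<tau> \<subseteq> open_halfspace n a"
  shows "homologous_rel n (punctured_space n) {q0} (GC n (transfer n M' p (nonconstant n) z)) (FC n (transfer n M' p (nonconstant n) z))"
proof -
  obtain m where m: "n = Suc m" using n not0_implies_Suc by blast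
  let ?c = "transfer n M' p (nonconstant n) z"
  have zc: "singular_chain n M z" and bz: "chain_boundary n z = 0" using z by (auto simp: singular_cycle)
  have "homologous_rel (Suc m) (punctured_space n) {q0} (GC (Suc m) ?c) (FC (Suc m) ?c)"
  proof (rule simplex_maps_homologous)
    show "Poly_Mapping.keys ?c \<subseteq> small_simplices (Suc m)"
    proof
      fix \<tau> assume "\<tau> \<in> Poly_Mapping.keys ?c"
      then obtain \<sigma> where "\<sigma> \<in> Poly_Mapping.keys z" "\<tau> \<in> simplex_lifts n M' p \<sigma>" by (rule keys_transfer_lifts)
      then have "\<tau> \<in> small_simplices n" using small by (auto simp: small_simplices_def simplex_lifts_def)
      then show "\<tau> \<in> small_simplices (Suc m)" unfolding m[symmetric] .
    qed
    have "Poly_Mapping.keys (chain_boundary n ?c - transfer (n - 1) M' p (nonconstant (n - 1)) (chain_boundary n z))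
       \<subseteq> {\<rho>. singular_simplex (n - 1) M' \<rho> \<and> \<not> nonconstant (n - 1) \<rho>}"
    proof (rule keys_transfer_boundary[OF DM(1) zc n])
      show "finite {\<tau> \<in> simplex_lifts m M' p \<sigma>. nonconstant m \<tau>}" if "singular_simplex m M \<sigma>" for m \<sigma>
        by (rule finite_nonconstant_lifts[OF that])
      show "nonconstant n \<tau>" if "k \<le> n" "nonconstant (n - 1) (singular_face n k \<tau>)" for \<tau> k
        using nonconstant_face that m by simp
    qed
    then have "Poly_Mapping.keys (chain_boundary (Suc m) ?c) \<subseteq> {\<rho>. singular_simplex m M' \<rho> \<and> \<not> nonconstant m \<rho>}"
      using bz m by simp
    \<comment> \<open>Such faces are small without any Lipschitz condition: their only value is
      \<open>q0\<close>, which lies in the half-space in its own direction.\<close>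
    also have "\<dots> \<subseteq> {\<rho> \<in> small_simplices m. fun_convex hull carrier_set m \<rho> \<subseteq> {q0}}"
      using constant_carrier nsphere_self_halfspace[OF q0] by (fastforce simp: small_simplices_def)
    finally show "Poly_Mapping.keys (chain_boundary (Suc m) ?c) \<subseteq> {\<rho> \<in> small_simplices m. fun_convex hull carrier_set m \<rho> \<subseteq> {q0}}" .
  qed
  then show ?thesis by (simp only: m)
qed

text \<open>A lift on which the two truncations disagree is sent constantly to \<open>q0\<close> by
  \<open>f\<close>: it either misses \<open>K\<close> or is discarded by \<open>nonconstant\<close>.
  Hence the change of truncation is invisible modulo \<open>q0\<close>.\<close>

lemma FC_transfer_diff:
  assumes zc: "singular_chain n M z"
  shows "singular_chain n (subtopology (punctured_space n) {q0})
    (FC n (transfer n M' p (nonconstant n) z - transfer n M' p (meets K n) z))"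
proof (rule singular_chain_constant[OF _ q0_punctured])
  have keys: "Poly_Mapping.keys (transfer n M' p (nonconstant n) z - transfer n M' p (meets K n) z)
     \<subseteq> {\<tau>. singular_simplex n M' \<tau> \<and> nonconstant n \<tau> \<noteq> meets K n \<tau>}"
    by (rule keys_transfer_diff_subset[OF zc finite_nonconstant_lifts finite_meets_lifts])
  fix \<tau> assume "\<tau> \<in> Poly_Mapping.keys (transfer n M' p (nonconstant n) z - transfer n M' p (meets K n) z)"
  then have t: "singular_simplex n M' \<tau>" "nonconstant n \<tau> \<noteq> meets K n \<tau>" using keys by auto
  show "\<exists>X. singular_simplex n X (simplex_map n f \<tau>)" using singular_simplex_simplex_map[OF t(1) f] by blast
  fix s assume s: "s \<in> standard_simplex n"
  have ts: "\<tau> s \<in> topspace M'" using t(1) s by (auto simp: singular_simplex_def continuous_map_def)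
  have "f (\<tau> s) = q0"
  proof (cases "meets K n \<tau>")
    case True
    then show ?thesis using t(2) s by (auto simp: nonconstant_def)
  next
    case False
    then show ?thesis using const[OF ts] s by (auto simp: meets_def)
  qed
  then show "simplex_map n f \<tau> s = q0" using s by (simp add: simplex_map_def)
qed

lemma GC_transfer_diff:
  assumes zc: "singular_chain n M z"
  shows "singular_chain n (subtopology (punctured_space n) {q0})
    (GC n (transfer n M' p (nonconstant n) z - transfer n M' p (movingM n) z))"
proof (rule singular_chain_constant[OF _ q0_punctured])
  have keys: "Poly_Mapping.keys (transfer n M' p (nonconstant n) z - transfer n M' p (movingM n) z)
     \<subseteq> {\<tau>. singular_simplex n M' \<tau> \<and> nonconstant n \<tau> \<noteq> movingM n \<tau>}"
    by (rule keys_transfer_diff_subset[OF zc finite_nonconstant_lifts finite_movingM_lifts])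
  fix \<tau> assume "\<tau> \<in> Poly_Mapping.keys (transfer n M' p (nonconstant n) z - transfer n M' p (movingM n) z)"
  then have "\<not> movingM n \<tau>" using keys by (auto simp: nonconstant_def)
  then show "straight n (simplex_map n C \<tau>) s = q0" if "s \<in> standard_simplex n" for s
    by (rule straight_const[OF _ that])
  show "\<exists>X. singular_simplex n X (straight n (simplex_map n C \<tau>))" by (rule straight_simplex)
qed

text \<open>Straightening the transfer of \<open>b\<close> gives a chain in the punctured space that
  is bounded by the chain in question, up to straightened simplices that are not moving. These are
  constant and vanish modulo \<open>q0\<close>.\<close>

lemma straight_transfer_relboundary:
  assumes b: "singular_chain (Suc n) B b"
    and small: "\<And>\<sigma> \<rho>. \<sigma> \<in> Poly_Mapping.keys b \<Longrightarrow> \<rho> \<in> simplex_lifts (Suc n) E q \<sigma> \<Longrightarrow>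
       \<exists>a. \<forall>j\<le>Suc n. f (\<theta> (simplicial_vertex j \<rho>)) \<in> open_halfspace n a"
  shows "singular_relboundary n (punctured_space n) {q0}
    (chain_of_simplex_map (straight n) (transfer n E q (moving n) (chain_boundary (Suc n) b)))"
proof -
  let ?t = "transfer (Suc n) E q (moving (Suc n)) b"
  define e where "e = chain_boundary (Suc n) ?t - transfer n E q (moving n) (chain_boundary (Suc n) b)"
  have "Poly_Mapping.keys (chain_boundary (Suc n) ?t - transfer (Suc n - 1) E q (moving (Suc n - 1)) (chain_boundary (Suc n) b))
     \<subseteq> {\<rho>. singular_simplex (Suc n - 1) E \<rho> \<and> \<not> moving (Suc n - 1) \<rho>}"
    by (rule keys_transfer_boundary[OF DE(1) b]) (use finite_moving_lifts moving_face in auto)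
  then have ke: "Poly_Mapping.keys e \<subseteq> {\<rho>. \<not> moving n \<rho>}" by (auto simp: e_def)
  have e: "singular_chain n (subtopology (punctured_space n) {q0}) (chain_of_simplex_map (straight n) e)"
    by (rule singular_chain_constant[OF straight_simplex q0_punctured]) (use ke straight_const in blast)
  have t: "singular_chain (Suc n) (punctured_space n) (chain_of_simplex_map (straight (Suc n)) ?t)"
  proof (rule singular_chain_chain_of_simplex_map)
    fix \<rho> assume "\<rho> \<in> Poly_Mapping.keys ?t"
    then obtain \<sigma> where "\<sigma> \<in> Poly_Mapping.keys b" "\<rho> \<in> simplex_lifts (Suc n) E q \<sigma>" by (rule keys_transfer_lifts)
    then obtain a where a: "\<forall>j\<le>Suc n. f (\<theta> (simplicial_vertex j \<rho>)) \<in> open_halfspace n a" using small by blast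
    have "singular_simplex (Suc n) (subtopology (powertop_real UNIV) (open_halfspace n a)) (straight (Suc n) \<rho>)"
      unfolding straight_def by (rule singular_simplex_oriented_simplex[OF fun_convex_open_halfspace]) (use a in blast)
    then show "singular_simplex (Suc n) (punctured_space n) (straight (Suc n) \<rho>)"
      unfolding punctured_space_def by (rule singular_simplex_mono) (rule open_halfspace_subset)
  qed
  have "chain_boundary (Suc n) (chain_of_simplex_map (straight (Suc n)) ?t) = chain_of_simplex_map (straight n) (chain_boundary (Suc n) ?t)"
  proof (rule chain_boundary_chain_of_simplex_map[OF _ subset_UNIV])
    show "straight n (singular_face (Suc n) k \<tau>) = singular_face (Suc n) k (straight (Suc n) \<tau>)" if "k \<le> Suc n" for \<tau> k
      unfolding straight_def by (rule singular_face_oriented_vertices[OF that])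
  qed simp
  then have "chain_boundary (Suc n) (chain_of_simplex_map (straight (Suc n)) ?t) =
     chain_of_simplex_map (straight n) (transfer n E q (moving n) (chain_boundary (Suc n) b)) + chain_of_simplex_map (straight n) e"
    by (simp add: e_def chain_of_simplex_map_diff)
  then show ?thesis unfolding singular_relboundary_alt using t e by blast
qed

text \<open>Modulo \<open>q0\<close> the image of the lifts that meet \<open>K\<close> is replaced
  by that of the nonconstant lifts, then by its straightening, then by the straightening of the
  moving lifts. A multiple of the last bounds by means of \<open>b\<close>, and the retraction
  returns the result to the sphere.\<close>

theorem multiple_of_image_bounds:
  assumes n: "n \<noteq> 0" and z: "singular_relcycle n M {} z"
    and b: "singular_chain (Suc n) B b" and bd: "chain_boundary (Suc n) b = frag_cmul k (chain_map n c z)"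
    and small_z: "\<And>\<sigma> \<tau>. \<sigma> \<in> Poly_Mapping.keys z \<Longrightarrow> \<tau> \<in> simplex_lifts n M' p \<sigma> \<Longrightarrow> \<exists>a. carrier_set n \<tau> \<subseteq> open_halfspace n a"
    and small_b: "\<And>\<sigma> \<rho>. \<sigma> \<in> Poly_Mapping.keys b \<Longrightarrow> \<rho> \<in> simplex_lifts (Suc n) E q \<sigma> \<Longrightarrow>
       \<exists>a. \<forall>j\<le>Suc n. f (\<theta> (simplicial_vertex j \<rho>)) \<in> open_halfspace n a"
  shows "singular_relboundary n (nsphere n) {q0} (frag_cmul k (chain_map n f (transfer n M' p (meets K n) z)))"
proof -
  let ?P = "punctured_space n"
  let ?c0 = "transfer n M' p (nonconstant n) z" and ?cK = "transfer n M' p (meets K n) z" and ?cm = "transfer n M' p (movingM n) z"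
  have zc: "singular_chain n M z" using z by (simp add: singular_cycle)
  have 1: "singular_relboundary n ?P {q0} (GC n ?c0 - FC n ?c0)"
    using straight_homologous[OF n z small_z] by (simp add: homologous_rel_def)
  have 2: "singular_relboundary n ?P {q0} (FC n ?c0 - FC n ?cK)"
    using singular_chain_imp_relboundary[OF FC_transfer_diff[OF zc]] by (simp add: chain_of_simplex_map_diff)
  have 3: "singular_relboundary n ?P {q0} (GC n ?c0 - GC n ?cm)"
    using singular_chain_imp_relboundary[OF GC_transfer_diff[OF zc]] by (simp add: chain_of_simplex_map_diff)
  \<comment> \<open>Naturality of the transfer moves the straightened chain to \<open>E\<close>,
    where k times the image of \<open>z\<close> is the boundary of \<open>b\<close>.\<close>
  have "GC n ?cm = chain_of_simplex_map (straight n) (transfer n E q (moving n) (chain_map n c z))"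
    unfolding transfer_chain_map[OF zc] chain_of_simplex_map_chain_map by (simp add: comp_def)
  then have "frag_cmul k (GC n ?cm) = chain_of_simplex_map (straight n) (transfer n E q (moving n) (chain_boundary (Suc n) b))"
    by (simp add: bd transfer_cmul chain_of_simplex_map_cmul)
  then have 4: "singular_relboundary n ?P {q0} (frag_cmul k (GC n ?cm))"
    using straight_transfer_relboundary[OF b small_b] by simp
  have "singular_relboundary n ?P {q0} (frag_cmul k (GC n ?cm) + frag_cmul k (GC n ?c0 - GC n ?cm)
      - frag_cmul k (GC n ?c0 - FC n ?c0) - frag_cmul k (FC n ?c0 - FC n ?cK))"
    by (intro singular_relboundary_diff singular_relboundary_add singular_relboundary_cmul 1 2 3 4)
  moreover have "frag_cmul k (GC n ?cm) + frag_cmul k (GC n ?c0 - GC n ?cm)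
      - frag_cmul k (GC n ?c0 - FC n ?c0) - frag_cmul k (FC n ?c0 - FC n ?cK) = frag_cmul k (FC n ?cK)"
    by (simp add: frag_cmul_diff_right)
  ultimately have rb: "singular_relboundary n ?P {q0} (frag_cmul k (chain_map n f ?cK))"
    by (simp add: chain_map_eq_chain_of_simplex_map)
  \<comment> \<open>The values of \<open>f\<close> already lie on the sphere, so the retraction does
    not change the image chain, only the chain that it bounds.\<close>
  obtain r where r: "continuous_map ?P (nsphere n) r" "\<forall>x\<in>topspace (nsphere n). r x = x"
    by (rule punctured_space_retraction)
  have "singular_relboundary n (nsphere n) {q0} (chain_map n r (frag_cmul k (chain_map n f ?cK)))"
    by (rule singular_relboundary_chain_map[OF rb r(1)]) (use r(2) q0 in auto)
  moreover have "chain_map n r (chain_map n f ?cK) = chain_map n f ?cK"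
  proof -
    have "chain_map n r (chain_map n f ?cK) = chain_map n (r \<circ> f) ?cK" by (simp add: chain_map_compose)
    also have "\<dots> = chain_map n f ?cK"
      using r(2) continuous_map_image_subset_topspace[OF f] by (intro chain_map_eq[OF singular_chain_transfer]) auto
    finally show ?thesis .
  qed
  ultimately show ?thesis by simp
qed

end

section \<open>Equivariant maps, degree and the lifted fundamental class\<close>

lemma equivariant_map_exists:
  assumes pbE: "principal_bundle G actE E q B" and pbM: "principal_bundle G act M' p M" and y: "y \<in> topspace M'"
  obtains \<theta> where "\<And>x. x \<in> topspace E \<Longrightarrow> \<theta> x \<in> topspace M'"
    "\<And>g x. g \<in> carrier G \<Longrightarrow> x \<in> topspace E \<Longrightarrow> \<theta> (actE g x) = act g (\<theta> x)"
proof -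
  note DE = principal_bundleD[OF pbE] and DM = principal_bundleD[OF pbM]
  interpret gaE: group_action G "topspace E" actE by (rule DE(2))
  interpret gaM: group_action G "topspace M'" act by (rule DM(2))
  have grp: "group G" using gaE.group_hom by (simp add: group_hom_def)
  \<comment> \<open>In every fibre of \<open>E\<close> one point is chosen and sent to y; simple
    transitivity of the action extends this uniquely, with \<open>gg x\<close> the element that
    moves the chosen point to x.\<close>
  define base where "base u = (SOME e. e \<in> topspace E \<and> q e = u)" for u
  have base: "base (q x) \<in> topspace E" "q (base (q x)) = q x" if "x \<in> topspace E" for x
    using someI[of "\<lambda>e. e \<in> topspace E \<and> q e = q x" x] that by (auto simp: base_def)
  define gg where "gg x = (THE g. g \<in> carrier G \<and> actE g (base (q x)) = x)" for x
  have ex1: "\<exists>!g. g \<in> carrier G \<and> actE g (base (q x)) = x" if "x \<in> topspace E" for x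
    using DE(5)[OF base(1)[OF that] that base(2)[OF that]] .
  have gg: "gg x \<in> carrier G" "actE (gg x) (base (q x)) = x" if "x \<in> topspace E" for x
    using theI'[OF ex1[OF that]] by (simp_all add: gg_def)
  show thesis
  proof (rule that[of "\<lambda>x. act (gg x) y"])
    show "act (gg x) y \<in> topspace M'" if "x \<in> topspace E" for x
      by (rule DM(6)[OF gg(1)[OF that] y])
    fix g x assume g: "g \<in> carrier G" and x: "x \<in> topspace E"
    have gx: "actE g x \<in> topspace E" "q (actE g x) = q x" using DE(6,4) g x by auto
    have m: "g \<otimes>\<^bsub>G\<^esub> gg x \<in> carrier G" using monoid.m_closed[OF group.is_monoid[OF grp]] g gg(1)[OF x] by blast
    have "actE (g \<otimes>\<^bsub>G\<^esub> gg x) (base (q x)) = actE g x"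
      using gaE.composition_rule[OF base(1)[OF x] g gg(1)[OF x]] gg(2)[OF x] by simp
    then have "gg (actE g x) = g \<otimes>\<^bsub>G\<^esub> gg x"
      using ex1[OF gx(1)] gg[OF gx(1)] m unfolding gx(2) by blast
    then show "act (gg (actE g x)) y = act g (act (gg x) y)"
      using gaM.composition_rule[OF y g gg(1)[OF x]] by simp
  qed
qed

lemma homologous_rel_set_add:
  "homologous_rel_set p X S (a + b) =
     homologous_rel_set p X S a \<otimes>\<^bsub>relative_homology_group (int p) X S\<^esub> homologous_rel_set p X S b"
proof -
  have "\<exists>r s. homologous_rel p X S a r \<and> homologous_rel p X S b s \<and> x = r + s" if "homologous_rel p X S (a + b) x" for x
  proof (intro exI conjI)
    show "homologous_rel p X S a (x - b)" using homologous_rel_diff[OF that homologous_rel_refl[of p X S b]] by simp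
  qed auto
  then show ?thesis unfolding mult_relative_homology_group using homologous_rel_add by blast
qed

lemma homologous_rel_set_multiple:
  "homologous_rel_set p X S (frag_cmul (int k) a) =
     homologous_rel_set p X S a [^]\<^bsub>relative_homology_group (int p) X S\<^esub> k"
proof (induction k)
  case 0
  have "homologous_rel_set p X S 0 = singular_relboundary_set p X S"
    by (simp add: homologous_rel_set_eq_relboundary)
  then show ?case by (simp add: nat_pow_def)
next
  case (Suc k)
  have "frag_cmul (int (Suc k)) a = frag_cmul (int k) a + a"
    by (simp add: frag_cmul_distrib add.commute)
  then show ?case using Suc by (simp add: homologous_rel_set_add nat_pow_def)
qed

text \<open>H_n(S^n, {q}) is isomorphic to H_n(S^n), which is infinite cyclic and so has no
  torsion.\<close>

lemma nsphere_generator_multiple: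
  assumes n: "n \<noteq> 0" and gen: "cyclic_generator (homology_group (int n) (nsphere n)) s" and q: "q \<in> topspace (nsphere n)"
    and eq: "(hom_induced (int n) (nsphere n) {} (nsphere n) {q} id s
       [^]\<^bsub>relative_homology_group (int n) (nsphere n) {q}\<^esub> (d::int)) [^]\<^bsub>relative_homology_group (int n) (nsphere n) {q}\<^esub> (k::nat)
      = \<one>\<^bsub>relative_homology_group (int n) (nsphere n) {q}\<^esub>"
    and k: "k \<noteq> 0"
  shows "d = 0"
proof -
  let ?H = "homology_group (int n) (nsphere n)" and ?R = "relative_homology_group (int n) (nsphere n) {q}"
  let ?j = "hom_induced (int n) (nsphere n) {} (nsphere n) {q} id"
  have s: "s \<in> carrier ?H" and gen': "\<And>x. x \<in> carrier ?H \<Longrightarrow> \<exists>k::int. x = s [^]\<^bsub>?H\<^esub> k"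
    using gen by (auto simp: cyclic_generator_def)
  have "contractible_space (subtopology (nsphere n) {q})" using q by (simp add: contractible_space_subtopology_singleton)
  then have j: "?j \<in> iso ?H ?R"
    using iso_reduced_homology_by_contractible[of "nsphere n" "{q}" "int n"] q n by (simp add: un_reduced_homology_group)
  then interpret j: group_hom ?H ?R ?j by (simp add: group_hom_def group_hom_axioms_def iso_def)
  have "?H \<cong> integer_group" using reduced_homology_group_nsphere(1)[of n] n by (simp add: un_reduced_homology_group)
  then obtain \<phi> where \<phi>: "\<phi> \<in> iso ?H integer_group" by (auto simp: is_iso_def)
  then interpret \<phi>: group_hom ?H integer_group \<phi> by (simp add: group_hom_def group_hom_axioms_def iso_def)
  have pw: "\<phi> (s [^]\<^bsub>?H\<^esub> (m::int)) = m * \<phi> s" for m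
    using \<phi>.hom_int_pow[OF s, of m] by (simp add: mult.commute)
  \<comment> \<open>Some power of the generator corresponds to the integer 1.\<close>
  have "\<phi> s \<noteq> 0"
  proof
    assume 0: "\<phi> s = 0"
    obtain x where x: "x \<in> carrier ?H" "\<phi> x = 1" using \<phi> by (auto simp: iso_def bij_betw_def integer_group_def) (metis UNIV_I imageE)
    then obtain m :: int where "x = s [^]\<^bsub>?H\<^esub> m" using gen' by blast
    then show False using pw[of m] x(2) 0 by simp
  qed
  have "?j (s [^]\<^bsub>?H\<^esub> (d * int k)) = \<one>\<^bsub>?R\<^esub>"
    using eq by (simp add: j.hom_int_pow[OF s] j.H.int_pow_pow[symmetric] int_pow_int s del: one_relative_homology_group)
  also have "\<dots> = ?j \<one>\<^bsub>?H\<^esub>" by (simp only: j.hom_one)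
  finally have eqj: "?j (s [^]\<^bsub>?H\<^esub> (d * int k)) = ?j \<one>\<^bsub>?H\<^esub>" .
  have inj: "inj_on ?j (carrier ?H)" using j by (simp add: iso_def bij_betw_def)
  have "s [^]\<^bsub>?H\<^esub> (d * int k) = \<one>\<^bsub>?H\<^esub>"
    by (rule inj_onD[OF inj]) (use eqj s in \<open>simp_all del: one_relative_homology_group\<close>)
  then have "\<phi> (s [^]\<^bsub>?H\<^esub> (d * int k)) = \<phi> \<one>\<^bsub>?H\<^esub>" by simp
  then have "(d * int k) * \<phi> s = 0" unfolding pw \<phi>.hom_one by simp
  then show ?thesis using \<open>\<phi> s \<noteq> 0\<close> k by simp
qed

text \<open>At each point y of \<open>K\<close> the transferred cycle represents the orientation at
  y, because the pullback orientation is defined by a local chain on a sheet and the transfer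
  inverts \<open>p\<close> there. A class along a compact set is determined by its values at the
  points.\<close>

lemma fundamental_class_transfer:
  assumes pb: "principal_bundle G act M' p M" and M: "Hausdorff_space M" and M': "Hausdorff_space M'"
    and le: "locally_euclidean TYPE('e::euclidean_space) M'"
    and z: "singular_relcycle DIM('e) M {} z"
    and fund: "fundamental_class DIM('e) M \<omega> (homologous_rel_set DIM('e) M {} z)"
    and por: "pullback_orientation DIM('e) M' p M \<omega> \<omega>'" and K: "compactin M' K"
    and \<mu>: "fundamental_class_along DIM('e) M' K \<omega>' \<mu>"
  shows "\<mu> = homologous_rel_set DIM('e) M' (topspace M' - K) (transfer DIM('e) M' p (meets K DIM('e)) z)"
proof -
  let ?n = "DIM('e)"
  let ?t = "transfer ?n M' p (meets K ?n) z"
  have n: "?n \<noteq> 0" using DIM_positive[where 'a='e] by simp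
  have zc: "singular_chain ?n M z" using z by (simp add: singular_cycle)
  have cp: "continuous_map M' M p" using principal_bundleD(1)[OF pb] by (rule covering_map_continuous)
  have KM: "K \<subseteq> topspace M'" using K compactin_subset_topspace by blast
  obtain w where w: "singular_relcycle ?n M' (topspace M' - K) w" "\<mu> = homologous_rel_set ?n M' (topspace M' - K) w"
    using \<mu> unfolding fundamental_class_along_def carrier_relative_homology_group by blast
  have loc: "homologous_rel ?n M' (topspace M' - {y}) w ?t" if y: "y \<in> K" for y
  proof -
    have yM: "y \<in> topspace M'" using y KM by blast
    then have py: "p y \<in> topspace M" using continuous_map_image_subset_topspace[OF cp] by blast
    obtain V \<beta> where V: "openin M' V" "y \<in> V" "inj_on p V"
      and \<beta>: "\<beta> \<in> carrier (relative_homology_group (int ?n) (subtopology M' V) (V - {y}))"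
        "hom_induced (int ?n) (subtopology M' V) (V - {y}) M' (topspace M' - {y}) id \<beta> = \<omega>' y"
        "hom_induced (int ?n) (subtopology M' V) (V - {y}) M (topspace M - {p y}) p \<beta> = \<omega> (p y)"
      using por yM unfolding pullback_orientation_def by blast
    have VM: "V \<subseteq> topspace M'" using V openin_subset by blast
    obtain b where b: "singular_relcycle ?n (subtopology M' V) (V - {y}) b" "\<beta> = homologous_rel_set ?n (subtopology M' V) (V - {y}) b"
      using \<beta>(1) unfolding carrier_relative_homology_group by blast
    have bc: "singular_chain ?n (subtopology M' V) b" using b by (simp add: singular_relcycle)
    have "hom_induced (int ?n) (subtopology M' V) (V - {y}) M' (topspace M' - {y}) id \<beta> = homologous_rel_set ?n M' (topspace M' - {y}) (chain_map ?n id b)"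
      unfolding b(2) by (rule hom_induced_chain_map[OF _ _ b(1)]) (use VM in \<open>auto simp: continuous_map_from_subtopology\<close>)
    then have 1: "\<omega>' y = homologous_rel_set ?n M' (topspace M' - {y}) b" using \<beta>(2) chain_map_ident[OF bc] by simp
    have "hom_induced (int ?n) (subtopology M' V) (V - {y}) M (topspace M - {p y}) p \<beta> = homologous_rel_set ?n M (topspace M - {p y}) (chain_map ?n p b)"
      unfolding b(2)
    proof (rule hom_induced_chain_map[OF _ _ b(1)])
      show "continuous_map (subtopology M' V) M p" using cp by (rule continuous_map_from_subtopology)
      show "p \<in> V - {y} \<rightarrow> topspace M - {p y}"
      proof
        fix x assume x: "x \<in> V - {y}"
        then have "p x \<in> topspace M" using VM continuous_map_image_subset_topspace[OF cp] by blast
        moreover have "p x \<noteq> p y" using x V(2,3) by (auto simp: inj_on_def)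
        ultimately show "p x \<in> topspace M - {p y}" by simp
      qed
    qed
    then have 2: "\<omega> (p y) = homologous_rel_set ?n M (topspace M - {p y}) (chain_map ?n p b)" using \<beta>(3) by simp
    have "hom_induced (int ?n) M {} M (topspace M - {p y}) id (homologous_rel_set ?n M {} z) = \<omega> (p y)"
      using fund py unfolding fundamental_class_def fundamental_class_along_def by simp
    moreover have "hom_induced (int ?n) M {} M (topspace M - {p y}) id (homologous_rel_set ?n M {} z)
       = homologous_rel_set ?n M (topspace M - {p y}) (chain_map ?n id z)"
      by (rule hom_induced_chain_map[OF _ _ z]) auto
    ultimately have "homologous_rel ?n M (topspace M - {p y}) z (chain_map ?n p b)"
      using 2 chain_map_ident[OF zc] homologous_rel_set_eq by metis
    then have 3: "homologous_rel ?n M' (topspace M' - {y}) ?t b"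
      by (rule transfer_local[OF pb M K n y V bc zc])
    have "hom_induced (int ?n) M' (topspace M' - K) M' (topspace M' - {y}) id \<mu> = \<omega>' y"
      using \<mu> y unfolding fundamental_class_along_def by blast
    moreover have "hom_induced (int ?n) M' (topspace M' - K) M' (topspace M' - {y}) id \<mu> = homologous_rel_set ?n M' (topspace M' - {y}) (chain_map ?n id w)"
      unfolding w(2) by (rule hom_induced_chain_map[OF _ _ w(1)]) (use y in auto)
    moreover have "chain_map ?n id w = w" using w(1) chain_map_ident unfolding singular_relcycle by blast
    ultimately have "homologous_rel ?n M' (topspace M' - {y}) w b" using 1 homologous_rel_set_eq by metis
    then show ?thesis using 3 homologous_rel_sym homologous_rel_trans by metis
  qed
  have t: "singular_relcycle ?n M' (topspace M' - K) ?t" by (rule relcycle_transfer_meets[OF pb M K z n])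
  have "singular_relboundary ?n M' (topspace M' - K) (w - ?t)"
    using compactin_imp_locally_determined[OF M' le K] singular_relcycle_diff[OF w(1) t] loc
    unfolding locally_determined_def point_detected_def homologous_rel_def by blast
  then have "homologous_rel ?n M' (topspace M' - K) w ?t" unfolding homologous_rel_def .
  then show ?thesis unfolding w(2) by (simp only: homologous_rel_set_eq)
qed

lemma covering_Hausdorff:
  assumes cov: "covering_map Y p X" and X: "Hausdorff_space X"
  shows "Hausdorff_space Y"
  unfolding Hausdorff_space_def
proof (intro allI impI, elim conjE)
  fix x y assume xy: "x \<in> topspace Y" "y \<in> topspace Y" "x \<noteq> y"
  note cp = covering_map_continuous[OF cov]
  show "\<exists>U V. openin Y U \<and> openin Y V \<and> x \<in> U \<and> y \<in> V \<and> disjnt U V"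
  proof (cases "p x = p y")
    case True
    show ?thesis by (rule covering_map_disjoint_sheets[OF cov xy(1,2) True xy(3)]) (auto simp: disjnt_def)
  next
    case False
    have "p x \<in> topspace X" "p y \<in> topspace X" using continuous_map_image_subset_topspace[OF cp] xy by auto
    then obtain U V where UV: "openin X U" "openin X V" "p x \<in> U" "p y \<in> V" "disjnt U V"
      using X False unfolding Hausdorff_space_def by metis
    have "openin Y {z \<in> topspace Y. p z \<in> U}" "openin Y {z \<in> topspace Y. p z \<in> V}"
      using openin_continuous_map_preimage[OF cp] UV by blast+
    moreover have "disjnt {z \<in> topspace Y. p z \<in> U} {z \<in> topspace Y. p z \<in> V}" using UV(5) by (auto simp: disjnt_def)
    ultimately show ?thesis using xy UV by blast
  qed
qed

lemma covering_locally_euclidean: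
  fixes A :: "('a, 'e::euclidean_space) chart set"
  assumes A: "smooth_atlas M A" and cov: "covering_map M' p M"
  shows "locally_euclidean TYPE('e) M'"
  unfolding locally_euclidean_def
proof
  fix x assume x: "x \<in> topspace M'"
  have px: "p x \<in> topspace M" using continuous_map_image_subset_topspace[OF covering_map_continuous[OF cov]] x by blast
  then obtain d where d: "d \<in> A" "p x \<in> fst d" using A unfolding smooth_atlas_def by blast
  note D = smooth_atlasD[OF A d(1)]
  obtain U0 V0 where UV: "openin M U0" "p x \<in> U0" "openin M' V0" "x \<in> V0" "p ` V0 = U0"
     "homeomorphic_map (subtopology M' V0) (subtopology M U0) p"
    using covering_map_sheet[OF cov x] by metis
  define W where "W = U0 \<inter> fst d"
  define V where "V = V0 \<inter> {y \<in> topspace M'. p y \<in> fst d}"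
  have VM: "V0 \<subseteq> topspace M'" and UM: "U0 \<subseteq> topspace M" using UV openin_subset by blast+
  have oV: "openin M' V" unfolding V_def
    using UV(3) openin_continuous_map_preimage[OF covering_map_continuous[OF cov] D(1)] by blast
  have oW: "openin M W" unfolding W_def using UV(1) D(1) by blast
  have pV: "p ` V = W" using UV(5) VM by (auto simp: V_def W_def)
  have "homeomorphic_map (subtopology (subtopology M' V0) V) (subtopology (subtopology M U0) W) p"
    by (rule homeomorphic_map_subtopologies[OF UV(6)]) (use pV VM UM in \<open>auto simp: V_def W_def\<close>)
  then have h1: "homeomorphic_map (subtopology M' V) (subtopology M W) p"
    by (simp add: subtopology_subtopology V_def W_def Int_absorb1 inf.left_idem flip: inf.assoc)
  have "homeomorphic_map (subtopology (subtopology M (fst d)) W) (subtopology (top_of_set (snd d ` fst d)) (snd d ` W)) (snd d)"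
    by (rule homeomorphic_map_subtopologies[OF D(3)]) (use D(5) in \<open>auto simp: W_def\<close>)
  moreover have "fst d \<inter> W = W" "snd d ` fst d \<inter> snd d ` W = snd d ` W" by (auto simp: W_def)
  ultimately have h2: "homeomorphic_map (subtopology M W) (top_of_set (snd d ` W)) (snd d)"
    by (simp add: subtopology_subtopology)
  have im: "(snd d \<circ> p) ` V = snd d ` W" unfolding pV[symmetric] by (rule image_comp[symmetric])
  have "homeomorphic_map (subtopology M' V) (top_of_set ((snd d \<circ> p) ` V)) (snd d \<circ> p)"
    unfolding im by (rule homeomorphic_map_compose[OF h1 h2])
  moreover have "open ((snd d \<circ> p) ` V)"
    unfolding im by (rule chart_image_open[OF A d(1) oW]) (simp add: W_def)
  ultimately have "euclidean_chart M' V (snd d \<circ> p)" using oV by (simp add: euclidean_chart_def)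
  moreover have "x \<in> V" using UV(4) x d(2) by (simp add: V_def)
  ultimately show "\<exists>U \<phi>. x \<in> U \<and> euclidean_chart M' U (\<phi> :: 'b \<Rightarrow> 'e)" by blast
qed

text \<open>From |u - a|^2 = 2 - 2 u \<cdot> a, a distance of at most 1 makes the inner product at
  least 1/2.\<close>

lemma nsphere_close_imp_halfspace:
  assumes "u \<in> topspace (nsphere n)" "a \<in> topspace (nsphere n)" "L2_set (\<lambda>i. u i - a i) {..n} < 1"
  shows "u \<in> open_halfspace n a"
proof -
  have "(L2_set (\<lambda>i. u i - a i) {..n})\<^sup>2 \<le> 1"
    using assms(3) by (intro power_le_one) auto
  then have "(\<Sum>i\<le>n. u i * a i) > 0" using nsphere_dot_bounds(1)[OF assms(1,2)] by simp
  then show ?thesis using assms(1) by (simp add: open_halfspace_def nsphere)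
qed

theorem corollary1p3:
  fixes M :: "'a topology"
    and A :: "('a, 'e::euclidean_space) chart set"
    and \<omega> :: "'a \<Rightarrow> 'a chain set"
    and g :: "('a, 'e) metric_tensor"
    and M' :: "'b topology"
    and p :: "'b \<Rightarrow> 'a"
    and e :: 'b
    and act :: "(real \<Rightarrow> 'a) set \<Rightarrow> 'b \<Rightarrow> 'b"
    and E :: "'c topology"
    and B :: "'d topology"
    and q :: "'c \<Rightarrow> 'd"
    and actE :: "(real \<Rightarrow> 'a) set \<Rightarrow> 'c \<Rightarrow> 'c"
    and c :: "'a \<Rightarrow> 'd"
    and \<mu> :: "'a chain set"
  assumes closed: "closed_manifold M A"
    and oriented: "orientation DIM('e) M \<omega>"
    and universal_cover: "universal_covering M' p M"
    and metric: "riemannian_metric A g"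
    and enlargeable: "universally_enlargeable M A \<omega> g M' p"
    and base_point: "e \<in> topspace M'"
    and deck: "deck_action M' p M e act"
    and classifying_space: "universal_bundle (fundamental_group M (p e)) actE E q B"
    and classifying: "classifying_map (fundamental_group M (p e)) act M' p M actE E q B c"
    and fundamental: "fundamental_class DIM('e) M \<omega> \<mu>"
  shows "rat_hom_induced DIM('e) M B c (rationalize DIM('e) M \<mu>)
           \<noteq> \<one>\<^bsub>rat_homology_group DIM('e) B\<^esub>"
proof
  let ?n = "DIM('e)"
  let ?G = "fundamental_group M (p e)"
  assume trivial: "rat_hom_induced ?n M B c (rationalize ?n M \<mu>) = \<one>\<^bsub>rat_homology_group ?n B\<^esub>"
  have n: "?n \<noteq> 0" using DIM_positive[where 'a='e] by simp
  have hM: "Hausdorff_space M" and A: "smooth_atlas M A"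
    using closed by (auto simp: closed_manifold_def smooth_manifold_def)
  have cov: "covering_map M' p M" and conn: "connected_space M'"
    using universal_cover by (auto simp: universal_covering_def simply_connected_space_def path_connected_imp_connected_space)
  have pbM: "principal_bundle ?G act M' p M" using deck by (simp add: deck_action_def)
  have pbE: "principal_bundle ?G actE E q B" using classifying_space by (simp add: universal_bundle_def)
  obtain C where C: "continuous_map M' E C"
    "\<And>g y. g \<in> carrier ?G \<Longrightarrow> y \<in> topspace M' \<Longrightarrow> C (act g y) = actE g (C y)"
    "\<And>y. y \<in> topspace M' \<Longrightarrow> q (C y) = c (p y)"
    using classifying unfolding classifying_map_def by blast
  obtain \<theta> where \<theta>: "\<And>x. x \<in> topspace E \<Longrightarrow> \<theta> x \<in> topspace M'"
    "\<And>g x. g \<in> carrier ?G \<Longrightarrow> x \<in> topspace E \<Longrightarrow> \<theta> (actE g x) = act g (\<theta> x)"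
    using equivariant_map_exists[OF pbE pbM base_point] by metis
  interpret cr: covered_riemannian M A g M' p
    by unfold_locales (use A metric cov in auto)
  have "\<mu> \<in> carrier (homology_group (int ?n) M)"
    using fundamental unfolding fundamental_class_def fundamental_class_along_def by simp
  then obtain z where z: "singular_relcycle ?n M {} z" "\<mu> = homologous_rel_set ?n M {} z"
    unfolding carrier_relative_homology_group by blast
  have zc: "singular_chain ?n M z" using z by (simp add: singular_cycle)
  obtain k :: nat and b where k: "k \<noteq> 0" and b: "singular_chain (Suc ?n) B b"
    and bd: "chain_boundary (Suc ?n) b = frag_cmul (int k) (chain_map ?n c z)"
    using rat_hom_induced_trivial_imp_multiple_boundary[of ?n M B c z] trivial unfolding z(2) by metis
  have c\<sigma>: "singular_simplex ?n M \<sigma>" if "\<sigma> \<in> Poly_Mapping.keys z" for \<sigma>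
    using zc that by (auto simp: singular_chain_def)
  have "\<exists>\<tau>. \<tau> \<in> simplex_lifts ?n M' p \<sigma>" if "\<sigma> \<in> Poly_Mapping.keys z" for \<sigma>
    by (rule simplex_lifts_nonempty[OF cov c\<sigma>[OF that]])
  then obtain tz where tz: "\<And>\<sigma>. \<sigma> \<in> Poly_Mapping.keys z \<Longrightarrow> tz \<sigma> \<in> simplex_lifts ?n M' p \<sigma>" by metis
  have "\<exists>\<rho>. \<rho> \<in> simplex_lifts (Suc ?n) E q \<sigma>" if "\<sigma> \<in> Poly_Mapping.keys b" for \<sigma>
    by (rule simplex_lifts_nonempty[OF principal_bundleD(1)[OF pbE]]) (use b that in \<open>auto simp: singular_chain_def\<close>)
  then obtain tb where tb: "\<And>\<sigma>. \<sigma> \<in> Poly_Mapping.keys b \<Longrightarrow> tb \<sigma> \<in> simplex_lifts (Suc ?n) E q \<sigma>" by metis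
  have stz: "singular_simplex ?n M' (tz \<sigma>)" if "\<sigma> \<in> Poly_Mapping.keys z" for \<sigma>
    using tz[OF that] by (simp add: simplex_lifts_def)
  have stb: "singular_simplex (Suc ?n) E (tb \<sigma>)" if "\<sigma> \<in> Poly_Mapping.keys b" for \<sigma>
    using tb[OF that] by (simp add: simplex_lifts_def)
  have CE: "C y \<in> topspace E" if "y \<in> topspace M'" for y
    using continuous_map_image_subset_topspace[OF C(1)] that by blast
  define Lz where "Lz \<sigma> = tz \<sigma> ` standard_simplex ?n \<union> (\<lambda>j. \<theta> (C (simplicial_vertex j (tz \<sigma>)))) ` {..?n}" for \<sigma>
  define Lb where "Lb \<sigma> = (\<lambda>j. \<theta> (simplicial_vertex j (tb \<sigma>))) ` {..Suc ?n}" for \<sigma>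
  \<comment> \<open>These are all the points at which \<open>f\<close> will be compared, for one
    lift of each simplex. Over \<open>z\<close> whole simplices are needed because \<open>f\<close>
    itself is evaluated there; over \<open>b\<close> the vertices suffice.\<close>
  define L where "L = \<Union>(Lz ` Poly_Mapping.keys z) \<union> \<Union>(Lb ` Poly_Mapping.keys b)"
  have "compactin M' (Lz \<sigma>)" if s: "\<sigma> \<in> Poly_Mapping.keys z" for \<sigma>
    unfolding Lz_def
  proof (rule compactin_Un)
    show "compactin M' (tz \<sigma> ` standard_simplex ?n)"
      using compactin_chain_support[of ?n M' "frag_of (tz \<sigma>)"] stz[OF s] by (simp add: chain_support_def singular_chain_of)
    show "compactin M' ((\<lambda>j. \<theta> (C (simplicial_vertex j (tz \<sigma>)))) ` {..?n})"
      by (rule finite_imp_compactin) (use \<theta>(1) CE simplicial_vertex_in_topspace[OF stz[OF s]] in auto)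
  qed
  moreover have "compactin M' (Lb \<sigma>)" if s: "\<sigma> \<in> Poly_Mapping.keys b" for \<sigma>
    unfolding Lb_def by (rule finite_imp_compactin) (use \<theta>(1) simplicial_vertex_in_topspace[OF stb[OF s]] in auto)
  ultimately have L: "compactin M' L"
    unfolding L_def by (intro compactin_Un compactin_Union) auto
  obtain R where R: "R \<ge> 0" "\<forall>x\<in>L. \<forall>y\<in>L. cr.bundle_close ?G act ?n R x y"
    using cr.bundle_close_compact[OF pbM conn L] by blast
  \<comment> \<open>The denominator R + 1 keeps \<epsilon> defined for R = 0 and makes \<epsilon> R
    less than 1, the threshold for a common half-space.\<close>
  define \<epsilon> where "\<epsilon> = 1 / (R + 1)"
  have \<epsilon>: "\<epsilon> > 0" "\<epsilon> * R < 1" using R(1) by (auto simp: \<epsilon>_def field_simps)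
  obtain \<omega>' \<sigma> where por: "pullback_orientation ?n M' p M \<omega> \<omega>'"
    and gen: "cyclic_generator (homology_group (int ?n) (nsphere ?n)) \<sigma>"
    and maps: "\<forall>\<epsilon>>0. \<exists>f. (\<forall>x\<in>topspace M'. \<forall>y\<in>topspace M'.
         sphere_dist ?n (f x) (f y) \<le> \<epsilon> * riemannian_dist M' (pullback_atlas M' p A) (pullback_metric p A g) x y) \<and>
         (\<exists>d. d \<noteq> 0 \<and> has_degree ?n M' \<omega>' \<sigma> f d)"
    using enlargeable unfolding universally_enlargeable_def Let_def by blast
  obtain f d where lip: "\<forall>x\<in>topspace M'. \<forall>y\<in>topspace M'.
         sphere_dist ?n (f x) (f y) \<le> \<epsilon> * riemannian_dist M' (pullback_atlas M' p A) (pullback_metric p A g) x y"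
    and d: "d \<noteq> 0" "has_degree ?n M' \<omega>' \<sigma> f d"
    using maps \<epsilon>(1) by blast
  obtain K q0 \<mu>' where contf: "continuous_map M' (nsphere ?n) f" and K: "compactin M' K"
    and q0: "q0 \<in> topspace (nsphere ?n)" and const: "f ` (topspace M' - K) \<subseteq> {q0}"
    and \<mu>': "fundamental_class_along ?n M' K \<omega>' \<mu>'"
    and deg: "hom_induced (int ?n) M' (topspace M' - K) (nsphere ?n) {q0} f \<mu>' =
      hom_induced (int ?n) (nsphere ?n) {} (nsphere ?n) {q0} id \<sigma> [^]\<^bsub>relative_homology_group (int ?n) (nsphere ?n) {q0}\<^esub> d"
    using d(2) unfolding has_degree_def by blast
  interpret bc: bundle_comparison ?G act M' p M actE E q B C c \<theta> f q0 K ?n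
    by unfold_locales (use pbM pbE hM C \<theta> contf q0 K const in auto)
  \<comment> \<open>This holds for every translate \<open>h\<close> with the same \<epsilon>, and
    hence for the infinitely many lifts of the chosen finitely many simplices.\<close>
  have half: "f (act h x) \<in> open_halfspace ?n (f (act h y))" if h: "h \<in> carrier ?G" and xy: "x \<in> L" "y \<in> L" for h x y
  proof (rule nsphere_close_imp_halfspace)
    have "x \<in> topspace M'" "y \<in> topspace M'" using xy compactin_subset_topspace[OF L] by auto
    then show "f (act h x) \<in> topspace (nsphere ?n)" "f (act h y) \<in> topspace (nsphere ?n)"
      using continuous_map_image_subset_topspace[OF contf] principal_bundleD(6)[OF pbM h] by blast+
    have "L2_set (\<lambda>i. f (act h x) i - f (act h y) i) {..?n} \<le> \<epsilon> * R"
      using R(2) xy h \<epsilon>(1) contf lip unfolding cr.bundle_close_def by blast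
    then show "L2_set (\<lambda>i. f (act h x) i - f (act h y) i) {..?n} < 1" using \<epsilon>(2) by linarith
  qed
  obtain v where v: "v \<in> standard_simplex ?n" using nonempty_standard_simplex by blast
  have small_z: "\<exists>a. bc.carrier_set ?n \<tau> \<subseteq> open_halfspace ?n a"
    if s: "\<sigma> \<in> Poly_Mapping.keys z" and t: "\<tau> \<in> simplex_lifts ?n M' p \<sigma>" for \<sigma> \<tau>
  proof -
    obtain h where h: "h \<in> carrier ?G" "\<tau> = simplex_map ?n (act h) (tz \<sigma>)"
      using t simplex_lifts_orbit[OF pbM tz[OF s]] by blast
    have LzL: "Lz \<sigma> \<subseteq> L" using s by (auto simp: L_def)
    have y: "tz \<sigma> v \<in> L" using v LzL by (auto simp: Lz_def)
    have "f (\<tau> x) \<in> open_halfspace ?n (f (act h (tz \<sigma> v)))" if "x \<in> standard_simplex ?n" for x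
      using half[OF h(1) _ y, of "tz \<sigma> x"] LzL that h(2) by (auto simp: Lz_def simplex_map_def)
    moreover have "f (\<theta> (C (simplicial_vertex j \<tau>))) \<in> open_halfspace ?n (f (act h (tz \<sigma> v)))" if j: "j \<le> ?n" for j
    proof -
      have "simplicial_vertex j (tz \<sigma>) \<in> topspace M'" by (rule simplicial_vertex_in_topspace[OF stz[OF s] j])
      then have "\<theta> (C (simplicial_vertex j \<tau>)) = act h (\<theta> (C (simplicial_vertex j (tz \<sigma>))))"
        using h j C(2) \<theta>(2) CE by (simp add: simplicial_vertex_simplex_map)
      then show ?thesis using half[OF h(1) _ y] LzL j by (auto simp: Lz_def)
    qed
    ultimately show ?thesis unfolding bc.carrier_set_def by blast
  qed
  have small_b: "\<exists>a. \<forall>j\<le>Suc ?n. f (\<theta> (simplicial_vertex j \<rho>)) \<in> open_halfspace ?n a"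
    if s: "\<sigma> \<in> Poly_Mapping.keys b" and r: "\<rho> \<in> simplex_lifts (Suc ?n) E q \<sigma>" for \<sigma> \<rho>
  proof -
    obtain h where h: "h \<in> carrier ?G" "\<rho> = simplex_map (Suc ?n) (actE h) (tb \<sigma>)"
      using r simplex_lifts_orbit[OF pbE tb[OF s]] by blast
    have LbL: "Lb \<sigma> \<subseteq> L" using s by (auto simp: L_def)
    have "f (\<theta> (simplicial_vertex j \<rho>)) \<in> open_halfspace ?n (f (act h (\<theta> (simplicial_vertex 0 (tb \<sigma>)))))" if j: "j \<le> Suc ?n" for j
    proof -
      have "\<theta> (simplicial_vertex j \<rho>) = act h (\<theta> (simplicial_vertex j (tb \<sigma>)))"
        using h j \<theta>(2) simplicial_vertex_in_topspace[OF stb[OF s] j] by (simp add: simplicial_vertex_simplex_map)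
      moreover have "\<theta> (simplicial_vertex i (tb \<sigma>)) \<in> L" if "i \<le> Suc ?n" for i
        using LbL that by (auto simp: Lb_def)
      ultimately show ?thesis using half[OF h(1)] j by simp
    qed
    then show ?thesis by blast
  qed
  let ?t = "transfer ?n M' p (meets K ?n) z"
  let ?R = "relative_homology_group (int ?n) (nsphere ?n) {q0}"
  have rb: "singular_relboundary ?n (nsphere ?n) {q0} (frag_cmul (int k) (chain_map ?n f ?t))"
    by (rule bc.multiple_of_image_bounds[OF n z(1) b bd small_z small_b])
  \<comment> \<open>The class that defines the degree comes from an abstract choice for the set
    \<open>K\<close>; uniqueness makes it the class of the transferred cycle, to which the
    straightening applies.\<close>
  have "\<mu>' = homologous_rel_set ?n M' (topspace M' - K) ?t"
    by (rule fundamental_class_transfer[OF pbM hM covering_Hausdorff[OF cov hM] covering_locally_euclidean[OF A cov] z(1) _ por K \<mu>'])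
      (use fundamental z(2) in simp)
  then have "hom_induced (int ?n) M' (topspace M' - K) (nsphere ?n) {q0} f \<mu>' = homologous_rel_set ?n (nsphere ?n) {q0} (chain_map ?n f ?t)"
    using hom_induced_chain_map[OF contf _ relcycle_transfer_meets[OF pbM hM K z(1) n], of "{q0}"] const by auto
  then have "homologous_rel_set ?n (nsphere ?n) {q0} (chain_map ?n f ?t) =
     hom_induced (int ?n) (nsphere ?n) {} (nsphere ?n) {q0} id \<sigma> [^]\<^bsub>?R\<^esub> d"
    using deg by simp
  moreover have "homologous_rel_set ?n (nsphere ?n) {q0} (chain_map ?n f ?t) [^]\<^bsub>?R\<^esub> k = \<one>\<^bsub>?R\<^esub>"
    unfolding homologous_rel_set_multiple[symmetric] one_relative_homology_group homologous_rel_set_eq_relboundary by (rule rb)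
  ultimately have "d = 0" using nsphere_generator_multiple[OF n gen q0 _ k] by simp
  then show False using d(1) by contradiction
qed

end
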